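(* Fix any smooth Riemannian metric $g$ on the unit ball $B^3$. Then there are smooth Riemannian metrics $g_k$ on $B^3$ such that the scalar curvature satisfies $R(g_k)\ge 1$ for all $k$ and $g_k$ converges to $g$ in measure.
   Context: $B^3$ is the unit ball in $\mathbb{R}^3$, and $R(g)$ denotes the scalar curvature of a Riemannian metric $g$. Metrics $g_k$ converge in measure to $g$ on $B^3$ if for every $\varepsilon>0$ the Lebesgue (Euclidean) measure of $\{x\in B^3: |g_k(x)-g(x)|\ge \varepsilon\}$ tends to $0$ as $k\to\infty$, where $|\cdot|$ is the Euclidean norm of symmetric 2-tensors (matrices of metric components in the standard coordinates). *)

theory Defs
  imports "HOL-Analysis.Analysis"
begin

text \<open>
  On an open set, \<open>higher_diff_on S k f\<close> says that \<open>f\<close> is of class \<open>C\<^sup>k\<close>.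
  All notions below are meant for open \<open>S\<close>, as the derivatives are taken with respect to
  full neighbourhoods.
\<close>

primrec higher_diff_on ::
    "'a::real_normed_vector set \<Rightarrow> nat \<Rightarrow> ('a \<Rightarrow> 'b::real_normed_vector) \<Rightarrow> bool" where
  "higher_diff_on S 0 f \<longleftrightarrow> continuous_on S f"
| "higher_diff_on S (Suc k) f \<longleftrightarrow>
     (\<forall>x\<in>S. f differentiable at x) \<and>
     (\<forall>v. higher_diff_on S k (\<lambda>x. frechet_derivative f (at x) v))"

definition smooth_on ::
    "'a::real_normed_vector set \<Rightarrow> ('a \<Rightarrow> 'b::real_normed_vector) \<Rightarrow> bool" where
  "smooth_on S f \<longleftrightarrow> (\<forall>k. higher_diff_on S k f)"

text \<open>
  A metric on an open set of \<open>\<real>\<^sup>n\<close> is given by its matrix of components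
  \<open>g x $ i $ j\<close> in the standard coordinates.
\<close>

definition riemannian_metric_on ::
    "(real^'n) set \<Rightarrow> (real^'n \<Rightarrow> real^'n^'n) \<Rightarrow> bool" where
  "riemannian_metric_on S g \<longleftrightarrow>
     smooth_on S g \<and>
     (\<forall>x\<in>S. transpose (g x) = g x \<and> (\<forall>v. v \<noteq> 0 \<longrightarrow> 0 < v \<bullet> (g x *v v)))"

definition partial_deriv :: "'n \<Rightarrow> (real^'n \<Rightarrow> real) \<Rightarrow> real^'n \<Rightarrow> real" where
  "partial_deriv i f x = frechet_derivative f (at x) (axis i 1)"

text \<open>The upper index comes first: \<open>christoffel g l i j\<close> is \<open>\<Gamma>\<close> with upper index \<open>l\<close>.\<close>

definition christoffel ::
    "(real^'n \<Rightarrow> real^'n^'n) \<Rightarrow> 'n \<Rightarrow> 'n \<Rightarrow> 'n \<Rightarrow> real^'n \<Rightarrow> real" where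
  "christoffel g l i j x =
     1/2 * (\<Sum>m\<in>UNIV. matrix_inv (g x) $ l $ m *
       (partial_deriv i (\<lambda>y. g y $ j $ m) x
        + partial_deriv j (\<lambda>y. g y $ i $ m) x
        - partial_deriv m (\<lambda>y. g y $ i $ j) x))"

text \<open>
  \<open>riemann_curvature g l i j k\<close> is the \<open>\<partial>\<^sub>l\<close>-component of
  \<open>R(\<partial>\<^sub>i, \<partial>\<^sub>j) \<partial>\<^sub>k = \<nabla>\<^sub>i \<nabla>\<^sub>j \<partial>\<^sub>k - \<nabla>\<^sub>j \<nabla>\<^sub>i \<partial>\<^sub>k\<close>, and \<open>Ric(Y, Z)\<close> is the trace of
  \<open>X \<mapsto> R(X, Y) Z\<close>. With these signs the unit sphere of dimension \<open>n\<close> has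
  scalar curvature \<open>n (n - 1)\<close>.
\<close>

definition riemann_curvature ::
    "(real^'n \<Rightarrow> real^'n^'n) \<Rightarrow> 'n \<Rightarrow> 'n \<Rightarrow> 'n \<Rightarrow> 'n \<Rightarrow> real^'n \<Rightarrow> real" where
  "riemann_curvature g l i j k x =
     partial_deriv i (christoffel g l j k) x - partial_deriv j (christoffel g l i k) x
     + (\<Sum>m\<in>UNIV. christoffel g l i m x * christoffel g m j k x
                  - christoffel g l j m x * christoffel g m i k x)"

definition ricci_curvature ::
    "(real^'n \<Rightarrow> real^'n^'n) \<Rightarrow> 'n \<Rightarrow> 'n \<Rightarrow> real^'n \<Rightarrow> real" where
  "ricci_curvature g j k x = (\<Sum>i\<in>UNIV. riemann_curvature g i i j k x)"

definition scalar_curvature :: "(real^'n \<Rightarrow> real^'n^'n) \<Rightarrow> real^'n \<Rightarrow> real" where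
  "scalar_curvature g x =
     (\<Sum>j\<in>UNIV. \<Sum>k\<in>UNIV. matrix_inv (g x) $ j $ k * ricci_curvature g j k x)"

text \<open>
  The norm on \<open>real^'n^'n\<close> is the Euclidean (Frobenius) norm of the matrix entries.
  As \<open>measure\<close> is \<open>0\<close> on sets of infinite or undefined measure, this is meant for
  measurable \<open>S\<close> of finite measure and functions measurable on \<open>S\<close>.
\<close>

definition converges_in_measure_on ::
    "'a::euclidean_space set \<Rightarrow> (nat \<Rightarrow> 'a \<Rightarrow> 'b::real_normed_vector) \<Rightarrow> ('a \<Rightarrow> 'b) \<Rightarrow> bool" where
  "converges_in_measure_on S f g \<longleftrightarrow>
     (\<forall>\<epsilon>>0. (\<lambda>k. measure lebesgue {x\<in>S. \<epsilon> \<le> norm (f k x - g x)}) \<longlonglongrightarrow> 0)"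

end

theory Submission
  imports Defs "HOL-Real_Asymp.Real_Asymp"
begin

text \<open>
  The conformally flat metric \<open>u\<^sup>4 \<delta>\<close> has scalar curvature \<open>- 8 \<Delta>u / u\<^sup>5\<close>, and for
  \<open>q p s y = (\<bar>y - p\<bar>\<^sup>2 + s\<^sup>2) powr (- 1 / 2)\<close> one has \<open>- \<Delta>q = 3 s\<^sup>2 q\<^sup>5\<close>. So
  \<open>u = q 0 1 / 10 + (\<Sum>p. sqrt s q p s)\<close> gives a metric with scalar curvature at least \<open>1\<close> if \<open>s\<close>
  is small: near each of the finitely many points \<open>p\<close>, a round sphere of radius \<open>1/2\<close> is attached
  through a thin neck to a sphere of bounded size. On the ball of radius \<open>s r\<close> around \<open>p\<close>, with \<open>r\<close>
  small, this metric is almost \<open>s\<^sup>-\<^sup>2 \<delta>\<close>.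

  By Vitali's theorem, finitely many small disjoint ellipsoids \<open>\<bar>A (x - p)\<bar> < r\<close>, with \<open>A\<close> and \<open>r\<close>
  depending on \<open>p\<close>, fill the unit ball up to small measure, where \<open>A\<^sup>T A\<close> is close to \<open>g\<close> on the
  ellipsoid. There is an immersion \<open>\<Phi>\<close> that is the identity outside the ellipsoids and
  \<open>x \<mapsto> p + s A (x - p)\<close> on most of each of them: a thin shell is stretched radially so strongly that
  the twist from \<open>A\<close> to the identity does not matter. The pullback of \<open>u\<^sup>4 \<delta>\<close> by \<open>\<Phi>\<close> has scalar
  curvature at least \<open>1\<close> and is close to \<open>g\<close> outside a set of small measure.
\<close>

section \<open>Calculus of smooth functions\<close>

text \<open>Scalar curvature is invariant under pullback by local diffeomorphisms, so the curvature
  bound and the approximation of \<open>g\<close> decouple. The bound concerns one metric on all of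
  \<open>real^3\<close> and passes to every pullback. The immersion need not be injective, and
  nothing is estimated in the shells, where convergence in measure tolerates any metric. The
  obstacle to the bound is the uncontrolled number n of cells. For n bubbles alone the curvature is
  24 times the sum of their fifth powers over the fifth power of their sum, which is 24 / n^4 where
  they agree. The term at 0 cures this: it does not depend on s, while away from its own centre each
  bubble is at most a constant times sqrt s times that term, up to infinity. So for small s only two
  terms compete at any point. The weight 1/10 gives the sphere at 0 the curvature 24 * 10^4, which
  leaves ample room. The ellipsoids and \<kappa> are chosen first, s last. One s serves three
  purposes: thin necks, the factor s^2 of the immersion against s^-2 of the bubble metric, and - ln
  s as the strength of the radial stretching.\<close>

lemma higher_diff_on_cong:
  assumes "open S" "\<And>x. x \<in> S \<Longrightarrow> f x = g x"
  shows "higher_diff_on S k f \<longleftrightarrow> higher_diff_on S k g"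
proof -
  have imp: "higher_diff_on S k g" if "higher_diff_on S k f" "\<forall>x\<in>S. f x = g x" for f g :: "'a \<Rightarrow> 'b"
    using that
  proof (induction k arbitrary: f g)
    case 0
    then show ?case by (simp cong: continuous_on_cong)
  next
    case (Suc k)
    have d: "f differentiable at x" if "x \<in> S" for x
      using Suc.prems that by simp
    have "g differentiable at x" if "x \<in> S" for x
      using has_derivative_transform_within_open[OF _ \<open>open S\<close> that, of f _ UNIV g] d[OF that] Suc.prems(2)
      by (auto simp: differentiable_def)
    moreover have "higher_diff_on S k (\<lambda>x. frechet_derivative g (at x) v)" for v
    proof (rule Suc.IH)
      show "higher_diff_on S k (\<lambda>x. frechet_derivative f (at x) v)"
        using Suc.prems by simp
      show "\<forall>x\<in>S. frechet_derivative f (at x) v = frechet_derivative g (at x) v"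
      proof
        fix x assume "x \<in> S"
        have "frechet_derivative f (at x) = frechet_derivative g (at x)"
          by (rule frechet_derivative_transform_within_open[OF d[OF \<open>x \<in> S\<close>] \<open>open S\<close> \<open>x \<in> S\<close>])
            (use Suc.prems(2) in auto)
        then show "frechet_derivative f (at x) v = frechet_derivative g (at x) v" by simp
      qed
    qed
    ultimately show ?case by simp
  qed
  show ?thesis
    using imp[of f g] imp[of g f] assms(2) by auto
qed

text \<open>\<open>higher_diff_on\<close> is stated with \<open>frechet_derivative\<close>; this
  rule admits an explicit derivative instead, since on an open set
  \<open>higher_diff_on_cong\<close> only looks at values there.\<close>

lemma higher_diff_on_SucI:
  assumes "open S" "\<And>x. x \<in> S \<Longrightarrow> (f has_derivative f' x) (at x)"
    and "\<And>v. higher_diff_on S k (\<lambda>x. f' x v)"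
  shows "higher_diff_on S (Suc k) f"
proof -
  have "frechet_derivative f (at x) = f' x" if "x \<in> S" for x
    using assms(2)[OF that] by (rule frechet_derivative_at[symmetric])
  then have "higher_diff_on S k (\<lambda>x. frechet_derivative f (at x) v)" for v
    using assms(3)[of v] higher_diff_on_cong[OF assms(1), of "\<lambda>x. f' x v" "\<lambda>x. frechet_derivative f (at x) v" k]
    by auto
  then show ?thesis
    using assms(2) by (auto simp: differentiable_def)
qed

lemma higher_diff_on_SucD_deriv:
  assumes "higher_diff_on S (Suc k) f" "x \<in> S"
  shows "(f has_derivative frechet_derivative f (at x)) (at x)"
  using assms by (simp add: frechet_derivative_works)

lemma higher_diff_on_SucD: "higher_diff_on S (Suc k) f \<Longrightarrow> higher_diff_on S k f"
proof (induction k arbitrary: f)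
  case 0
  then show ?case
    by (auto intro!: continuous_at_imp_continuous_on differentiable_imp_continuous_within)
next
  case (Suc k)
  then show ?case by simp
qed

lemma higher_diff_on_subset:
  "higher_diff_on S k f \<Longrightarrow> T \<subseteq> S \<Longrightarrow> higher_diff_on T k f"
  by (induction k arbitrary: f) (auto intro: continuous_on_subset)

lemma higher_diff_on_const: "higher_diff_on S k (\<lambda>x. c)"
  by (induction k arbitrary: c) auto

lemma higher_diff_on_bounded_linear:
  assumes "open S" "bounded_linear f"
  shows "higher_diff_on S k f"
proof (cases k)
  case 0
  then show ?thesis using assms by (simp add: linear_continuous_on)
next
  case (Suc j)
  show ?thesis unfolding Suc
    by (rule higher_diff_on_SucI[OF assms(1), where f' = "\<lambda>x. f"])
      (use assms in \<open>auto intro: bounded_linear_imp_has_derivative higher_diff_on_const\<close>)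
qed

lemma higher_diff_on_add:
  assumes "open S" "higher_diff_on S k f" "higher_diff_on S k g"
  shows "higher_diff_on S k (\<lambda>x. f x + g x)"
  using assms(2,3)
proof (induction k arbitrary: f g)
  case 0
  then show ?case by (simp add: continuous_on_add)
next
  case (Suc k)
  show ?case
    by (rule higher_diff_on_SucI[OF assms(1) has_derivative_add[OF
          higher_diff_on_SucD_deriv[OF Suc.prems(1)] higher_diff_on_SucD_deriv[OF Suc.prems(2)]]])
      (use Suc in auto)
qed

lemma higher_diff_on_bounded_bilinear:
  assumes h: "bounded_bilinear h" and "open S" "higher_diff_on S k f" "higher_diff_on S k g"
  shows "higher_diff_on S k (\<lambda>x. h (f x) (g x))"
  using assms(3,4)
proof (induction k arbitrary: f g)
  case 0
  then show ?case by (simp add: bounded_bilinear.continuous_on[OF h])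
next
  case (Suc k)
  show ?case
    by (rule higher_diff_on_SucI[OF assms(2) bounded_bilinear.FDERIV[OF h
          higher_diff_on_SucD_deriv[OF Suc.prems(1)] higher_diff_on_SucD_deriv[OF Suc.prems(2)]]])
      (use Suc.prems higher_diff_on_SucD[OF Suc.prems(1)] higher_diff_on_SucD[OF Suc.prems(2)]
        in \<open>auto intro!: higher_diff_on_add[OF assms(2)] Suc.IH\<close>)
qed

lemmas higher_diff_on_mult = higher_diff_on_bounded_bilinear[OF bounded_bilinear_mult]
lemmas higher_diff_on_scaleR = higher_diff_on_bounded_bilinear[OF bounded_bilinear_scaleR]

lemma higher_diff_on_linear_compose:
  assumes "bounded_linear h" "open S" "higher_diff_on S k f"
  shows "higher_diff_on S k (\<lambda>x. h (f x))"
  using assms(3)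
proof (induction k arbitrary: f)
  case 0
  then show ?case using assms by (simp add: bounded_linear.continuous_on)
next
  case (Suc k)
  show ?case
    by (rule higher_diff_on_SucI[OF assms(2) bounded_linear.has_derivative[OF assms(1)
            higher_diff_on_SucD_deriv[OF Suc.prems]]])
      (use Suc in auto)
qed

lemma higher_diff_on_sum:
  assumes "open S" "\<And>i. i \<in> I \<Longrightarrow> higher_diff_on S k (f i)"
  shows "higher_diff_on S k (\<lambda>x. \<Sum>i\<in>I. f i x)"
proof (cases "finite I")
  case True
  then show ?thesis using assms(2)
    by (induction I rule: finite_induct) (auto simp: higher_diff_on_const intro!: higher_diff_on_add[OF assms(1)])
next
  case False
  then show ?thesis by (simp add: higher_diff_on_const)
qed

text \<open>In the chain rule the derivative of \<open>f\<close> is applied to a vector that moves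
  with the point, whereas the definition fixes directions. Expanding the moving vector in a basis
  turns the derivative into a sum of products that the induction hypothesis covers.\<close>

lemma higher_diff_on_compose:
  fixes f :: "'b::euclidean_space \<Rightarrow> 'c::real_normed_vector" and h :: "'a::real_normed_vector \<Rightarrow> 'b"
  assumes "open S" "open T" "higher_diff_on T k f" "higher_diff_on S k h" "h ` S \<subseteq> T"
  shows "higher_diff_on S k (\<lambda>x. f (h x))"
  using assms(3,4)
proof (induction k arbitrary: f)
  case 0
  then show ?case using continuous_on_compose2 assms(5) by (metis higher_diff_on.simps(1))
next
  case (Suc k)
  note h' = higher_diff_on_SucD_deriv[OF Suc.prems(2)]
  have f': "(f has_derivative frechet_derivative f (at (h x))) (at (h x))" if "x \<in> S" for x
    using higher_diff_on_SucD_deriv[OF Suc.prems(1)] assms(5) that by blast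
  show ?case
  proof (rule higher_diff_on_SucI[OF assms(1)])
    show "((\<lambda>x. f (h x)) has_derivative
        (\<lambda>v. \<Sum>b\<in>Basis. (frechet_derivative h (at x) v \<bullet> b) *\<^sub>R frechet_derivative f (at (h x)) b)) (at x)"
      if "x \<in> S" for x
    proof -
      have "frechet_derivative f (at (h x)) w = (\<Sum>b\<in>Basis. (w \<bullet> b) *\<^sub>R frechet_derivative f (at (h x)) b)" for w
      proof -
        interpret l: bounded_linear "frechet_derivative f (at (h x))"
          using f'[OF that] by (rule has_derivative_bounded_linear)
        have "frechet_derivative f (at (h x)) (\<Sum>b\<in>Basis. (w \<bullet> b) *\<^sub>R b)
            = (\<Sum>b\<in>Basis. (w \<bullet> b) *\<^sub>R frechet_derivative f (at (h x)) b)"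
          by (simp add: l.sum l.scaleR)
        then show ?thesis by (simp add: euclidean_representation)
      qed
      then have "(\<lambda>v. frechet_derivative f (at (h x)) (frechet_derivative h (at x) v)) =
          (\<lambda>v. \<Sum>b\<in>Basis. (frechet_derivative h (at x) v \<bullet> b) *\<^sub>R frechet_derivative f (at (h x)) b)"
        by (rule ext)
      then show ?thesis
        using has_derivative_compose[OF h'[OF that] f'[OF that]] by simp
    qed
    show "higher_diff_on S k (\<lambda>x. \<Sum>b\<in>Basis. (frechet_derivative h (at x) v \<bullet> b) *\<^sub>R frechet_derivative f (at (h x)) b)" for v
    proof (intro higher_diff_on_sum[OF assms(1)] higher_diff_on_scaleR[OF assms(1)])
      fix b :: 'b
      show "higher_diff_on S k (\<lambda>x. frechet_derivative h (at x) v \<bullet> b)"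
        using Suc.prems(2)
        by (intro higher_diff_on_linear_compose[OF bounded_linear_inner_left assms(1)]) simp
      show "higher_diff_on S k (\<lambda>x. frechet_derivative f (at (h x)) b)"
        using Suc.prems higher_diff_on_SucD[OF Suc.prems(2)] by (intro Suc.IH) auto
    qed
  qed
qed

lemma higher_diff_on_has_real_derivative:
  fixes f :: "real \<Rightarrow> real"
  assumes "open S" "\<And>x. x \<in> S \<Longrightarrow> (f has_real_derivative f' x) (at x)" "higher_diff_on S k f'"
  shows "higher_diff_on S (Suc k) f"
  by (rule higher_diff_on_SucI[OF assms(1), where f' = "\<lambda>x v. f' x * v"])
    (use assms in \<open>auto simp: has_field_derivative_def higher_diff_on_const intro!: higher_diff_on_mult[OF assms(1)]\<close>)

lemma smooth_on_subset: "smooth_on S f \<Longrightarrow> T \<subseteq> S \<Longrightarrow> smooth_on T f"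
  by (auto simp: smooth_on_def intro: higher_diff_on_subset)

lemma smooth_on_imp_differentiable: "smooth_on S f \<Longrightarrow> x \<in> S \<Longrightarrow> f differentiable at x"
  unfolding smooth_on_def by (metis higher_diff_on.simps(2))

lemma smooth_on_imp_continuous_on: "smooth_on S f \<Longrightarrow> continuous_on S f"
  unfolding smooth_on_def by (metis higher_diff_on.simps(1))

lemma smooth_on_frechet_derivative:
  "smooth_on S f \<Longrightarrow> smooth_on S (\<lambda>x. frechet_derivative f (at x) v)"
  unfolding smooth_on_def by (metis higher_diff_on.simps(2))

lemma smooth_on_const: "smooth_on S (\<lambda>x. c)"
  by (simp add: smooth_on_def higher_diff_on_const)

lemma smooth_on_bounded_linear: "open S \<Longrightarrow> bounded_linear f \<Longrightarrow> smooth_on S f"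
  by (simp add: smooth_on_def higher_diff_on_bounded_linear)

lemma smooth_on_id: "open S \<Longrightarrow> smooth_on S (\<lambda>x. x)"
  by (rule smooth_on_bounded_linear) (auto intro: bounded_linear_ident)

lemma smooth_on_add:
  "open S \<Longrightarrow> smooth_on S f \<Longrightarrow> smooth_on S g \<Longrightarrow> smooth_on S (\<lambda>x. f x + g x)"
  by (simp add: smooth_on_def higher_diff_on_add)

lemma smooth_on_mult:
  fixes f g :: "'a::real_normed_vector \<Rightarrow> 'b::real_normed_algebra"
  shows "open S \<Longrightarrow> smooth_on S f \<Longrightarrow> smooth_on S g \<Longrightarrow> smooth_on S (\<lambda>x. f x * g x)"
  by (simp add: smooth_on_def higher_diff_on_mult)

lemma smooth_on_scaleR:
  "open S \<Longrightarrow> smooth_on S f \<Longrightarrow> smooth_on S g \<Longrightarrow> smooth_on S (\<lambda>x. f x *\<^sub>R g x)"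
  by (simp add: smooth_on_def higher_diff_on_scaleR)

lemma smooth_on_linear_compose:
  "bounded_linear h \<Longrightarrow> open S \<Longrightarrow> smooth_on S f \<Longrightarrow> smooth_on S (\<lambda>x. h (f x))"
  by (simp add: smooth_on_def higher_diff_on_linear_compose)

lemma smooth_on_sum:
  "open S \<Longrightarrow> (\<And>i. i \<in> I \<Longrightarrow> smooth_on S (f i)) \<Longrightarrow> smooth_on S (\<lambda>x. \<Sum>i\<in>I. f i x)"
  by (simp add: smooth_on_def higher_diff_on_sum)

lemma smooth_on_compose:
  fixes f :: "'b::euclidean_space \<Rightarrow> 'c::real_normed_vector"
  assumes "smooth_on T f" "smooth_on S h" "open S" "open T" "h ` S \<subseteq> T"
  shows "smooth_on S (\<lambda>x. f (h x))"
  using assms higher_diff_on_compose[of S T _ f h] by (simp add: smooth_on_def)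

lemma smooth_on_uminus: "open S \<Longrightarrow> smooth_on S f \<Longrightarrow> smooth_on S (\<lambda>x. - f x)"
  by (rule smooth_on_linear_compose) (auto intro: bounded_linear_minus bounded_linear_ident)

lemma smooth_on_diff:
  "open S \<Longrightarrow> smooth_on S f \<Longrightarrow> smooth_on S g \<Longrightarrow> smooth_on S (\<lambda>x. f x - g x)"
  using smooth_on_add[of S f "\<lambda>x. - g x"] by (simp add: smooth_on_uminus)

lemma smooth_on_power:
  fixes f :: "'a::real_normed_vector \<Rightarrow> real"
  shows "open S \<Longrightarrow> smooth_on S f \<Longrightarrow> smooth_on S (\<lambda>x. f x ^ n)"
  by (induction n) (auto simp: smooth_on_const smooth_on_mult)

lemma smooth_on_prod:
  fixes f :: "'i \<Rightarrow> 'a::real_normed_vector \<Rightarrow> real"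
  assumes "open S" "\<And>i. i \<in> I \<Longrightarrow> smooth_on S (f i)"
  shows "smooth_on S (\<lambda>x. \<Prod>i\<in>I. f i x)"
proof (cases "finite I")
  case True
  then show ?thesis using assms(2)
    by (induction I rule: finite_induct) (auto simp: smooth_on_const intro!: smooth_on_mult[OF assms(1)])
next
  case False
  then show ?thesis by (simp add: smooth_on_const)
qed

lemma smooth_on_vec_nth: "open S \<Longrightarrow> smooth_on S f \<Longrightarrow> smooth_on S (\<lambda>x. f x $ i)"
  by (rule smooth_on_linear_compose[OF bounded_linear_vec_nth])

lemma bounded_linear_axis: "bounded_linear (axis i :: 'a::real_normed_vector \<Rightarrow> 'a ^ 'n)"
proof (rule bounded_linear_intro[where K=1])
  fix x :: 'a
  show "norm (axis i x :: 'a ^ 'n) \<le> norm x * 1"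
    by (simp add: norm_vec_def L2_set_def axis_def if_distrib[of norm] if_distrib[of "\<lambda>t. t\<^sup>2"] cong: if_cong)
qed (auto simp: axis_def vec_eq_iff)

lemma smooth_on_vecI:
  fixes f :: "'a::real_normed_vector \<Rightarrow> 'b::real_normed_vector ^ 'n"
  assumes "open S" "\<And>i. smooth_on S (\<lambda>x. f x $ i)"
  shows "smooth_on S f"
proof -
  have "f = (\<lambda>x. \<Sum>i\<in>UNIV. axis i (f x $ i))"
    by (auto simp: fun_eq_iff vec_eq_iff axis_def if_distrib cong: if_cong)
  moreover have "smooth_on S (\<lambda>x. \<Sum>i\<in>UNIV. axis i (f x $ i) :: 'b ^ 'n)"
    by (intro smooth_on_sum smooth_on_linear_compose[OF bounded_linear_axis] assms)
  ultimately show ?thesis by simp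
qed

text \<open>The derivative is built from the function itself, so the induction feeds on its own
  conclusion. \<open>powr\<close> and \<open>exp\<close> below follow the same pattern,
  \<open>powr\<close> with the exponent left free.\<close>

lemma smooth_on_inverse_real: "smooth_on (- {0}) (inverse :: real \<Rightarrow> real)"
proof -
  have "higher_diff_on (- {0}) k (inverse :: real \<Rightarrow> real)" for k
  proof (induction k)
    case 0
    then show ?case by (auto intro!: continuous_intros)
  next
    case (Suc k)
    have "higher_diff_on (- {0}) k (\<lambda>x::real. (- 1) * (inverse x * inverse x))"
      by (intro higher_diff_on_mult higher_diff_on_const Suc.IH) auto
    then show ?case
      by (intro higher_diff_on_has_real_derivative[where f' = "\<lambda>x. (- 1) * (inverse x * inverse x)"])
        (auto intro!: derivative_eq_intros)
  qed
  then show ?thesis by (simp add: smooth_on_def)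
qed

lemma smooth_on_divide:
  fixes f g :: "'a::real_normed_vector \<Rightarrow> real"
  assumes "open S" "smooth_on S f" "smooth_on S g" "\<And>x. x \<in> S \<Longrightarrow> g x \<noteq> 0"
  shows "smooth_on S (\<lambda>x. f x / g x)"
  unfolding divide_inverse
  by (intro smooth_on_mult smooth_on_compose[OF smooth_on_inverse_real]) (use assms in auto)

lemma smooth_on_powr_real: "smooth_on {0<..} (\<lambda>x::real. x powr a)"
proof -
  have "higher_diff_on {0<..} k (\<lambda>x::real. x powr a)" for k a
  proof (induction k arbitrary: a)
    case 0
    then show ?case by (auto intro!: continuous_intros)
  next
    case (Suc k)
    show ?case
      by (rule higher_diff_on_has_real_derivative[where f' = "\<lambda>x. a * x powr (a - 1)"])
        (auto intro!: higher_diff_on_mult higher_diff_on_const Suc.IH has_real_derivative_powr)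
  qed
  then show ?thesis by (simp add: smooth_on_def)
qed

lemma smooth_on_powr:
  fixes f :: "'a::real_normed_vector \<Rightarrow> real"
  assumes "open S" "smooth_on S f" "\<And>x. x \<in> S \<Longrightarrow> f x > 0"
  shows "smooth_on S (\<lambda>x. f x powr a)"
  by (rule smooth_on_compose[OF smooth_on_powr_real]) (use assms in auto)

lemma smooth_on_exp:
  fixes f :: "'a::real_normed_vector \<Rightarrow> real"
  assumes "open S" "smooth_on S f"
  shows "smooth_on S (\<lambda>x. exp (f x))"
proof -
  have "higher_diff_on UNIV k (exp :: real \<Rightarrow> real)" for k
  proof (induction k)
    case 0
    then show ?case by (auto intro!: continuous_intros)
  next
    case (Suc k)
    then show ?case by (intro higher_diff_on_has_real_derivative[where f' = exp]) auto
  qed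
  then have "smooth_on UNIV (exp :: real \<Rightarrow> real)" by (simp add: smooth_on_def)
  then show ?thesis by (rule smooth_on_compose) (use assms in auto)
qed

section \<open>Flat functions and a smooth step\<close>

definition flat_exp :: "nat \<Rightarrow> real \<Rightarrow> real" where
  "flat_exp n t = (if t \<le> 0 then 0 else exp (- 1 / t) / t ^ n)"

lemma flat_exp_tendsto_0: "((\<lambda>t. flat_exp n t) \<longlongrightarrow> 0) (at 0)"
proof -
  have "((\<lambda>t. flat_exp n t) \<longlongrightarrow> 0) (at_left 0)"
    by (rule tendsto_eventually)
      (auto simp: flat_exp_def eventually_at_left_field intro!: exI[of _ "-1"])
  moreover have "((\<lambda>t. flat_exp n t) \<longlongrightarrow> 0) (at_right 0)"
  proof -
    have "((\<lambda>t::real. exp (- 1 / t) / t ^ n) \<longlongrightarrow> 0) (at_right 0)" by real_asymp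
    moreover have "eventually (\<lambda>t. exp (- 1 / t) / t ^ n = flat_exp n t) (at_right 0)"
      by (auto simp: flat_exp_def eventually_at_right_field intro!: exI[of _ 1])
    ultimately show ?thesis by (rule Lim_transform_eventually)
  qed
  ultimately show ?thesis by (simp add: filterlim_at_split)
qed

text \<open>The power of \<open>t\<close> in the denominator is there to make the family closed
  under differentiation up to linear combinations, which gives smoothness by induction on the order.
  The member \<open>n = 0\<close> is the usual flat function.\<close>

lemma flat_exp_has_real_derivative:
  "(flat_exp n has_real_derivative flat_exp (n + 2) t - real n * flat_exp (n + 1) t) (at t)"
proof -
  consider "t < 0" | "t = 0" | "t > 0" by linarith
  then show ?thesis
  proof cases
    case 1
    have "((\<lambda>t. 0) has_real_derivative 0) (at t)" by simp
    moreover have "eventually (\<lambda>t. (0::real) = flat_exp n t) (nhds t)"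
      using eventually_nhds_in_open[of "{..<0}" t] 1
      by (auto simp: flat_exp_def elim!: eventually_mono)
    ultimately have "(flat_exp n has_real_derivative 0) (at t)"
      by (subst (asm) DERIV_cong_ev[OF refl _ refl, where g = "flat_exp n"])
    then show ?thesis using 1 by (simp add: flat_exp_def)
  next
    case 2
    have "((\<lambda>h. flat_exp n (0 + h) / h) \<longlongrightarrow> 0) (at 0)"
    proof -
      \<comment> \<open>The difference quotient at 0 is again a member of the family; for
        \<open>h \<le> 0\<close> both sides are 0.\<close>
      have "flat_exp n (0 + h) / h = flat_exp (n + 1) h" for h
        by (simp add: flat_exp_def)
      then show ?thesis using flat_exp_tendsto_0[of "n + 1"] by simp
    qed
    then have "(flat_exp n has_real_derivative 0) (at 0)"
      by (simp add: DERIV_def flat_exp_def[of n 0])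
    then show ?thesis using 2 by (simp add: flat_exp_def)
  next
    case 3
    have "((\<lambda>t. exp (- 1 / t) / t ^ n) has_real_derivative
        (exp (- 1 / t) * (1 / t\<^sup>2) * t ^ n - exp (- 1 / t) * (real n * t ^ (n - 1))) / (t ^ n * t ^ n)) (at t)"
      using 3 by (auto intro!: derivative_eq_intros simp: power2_eq_square)
    moreover have "(exp (- 1 / t) * (1 / t\<^sup>2) * t ^ n - exp (- 1 / t) * (real n * t ^ (n - 1))) / (t ^ n * t ^ n)
        = flat_exp (n + 2) t - real n * flat_exp (n + 1) t"
      using 3 by (cases n) (auto simp: flat_exp_def power2_eq_square field_simps)
    ultimately have "((\<lambda>t. exp (- 1 / t) / t ^ n) has_real_derivative
        flat_exp (n + 2) t - real n * flat_exp (n + 1) t) (at t)" by simp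
    moreover have "eventually (\<lambda>t. exp (- 1 / t) / t ^ n = flat_exp n t) (nhds t)"
      using eventually_nhds_in_open[of "{0<..}" t] 3
      by (auto simp: flat_exp_def elim!: eventually_mono)
    ultimately show ?thesis
      by (subst (asm) DERIV_cong_ev[OF refl _ refl, where g = "flat_exp n"])
  qed
qed

lemma smooth_on_flat_exp: "smooth_on UNIV (flat_exp n)"
proof -
  have "higher_diff_on UNIV k (flat_exp n)" for k n
  proof (induction k arbitrary: n)
    case 0
    then show ?case
      by (auto intro!: continuous_at_imp_continuous_on DERIV_isCont flat_exp_has_real_derivative)
  next
    case (Suc k)
    have "higher_diff_on UNIV k (\<lambda>t. flat_exp (n + 2) t + (- real n) * flat_exp (n + 1) t)"
      by (intro higher_diff_on_add higher_diff_on_mult higher_diff_on_const Suc.IH) auto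
    then show ?case
      by (intro higher_diff_on_has_real_derivative[OF _ flat_exp_has_real_derivative]) auto
  qed
  then show ?thesis by (simp add: smooth_on_def)
qed

definition smooth_step :: "real \<Rightarrow> real" where
  "smooth_step t = flat_exp 0 t / (flat_exp 0 t + flat_exp 0 (1 - t))"

lemma flat_exp_0: "flat_exp 0 t \<ge> 0" "t > 0 \<Longrightarrow> flat_exp 0 t > 0" "t \<le> 0 \<Longrightarrow> flat_exp 0 t = 0"
  by (auto simp: flat_exp_def)

lemma smooth_step_denom_pos: "flat_exp 0 t + flat_exp 0 (1 - t) > 0"
  using flat_exp_0[of t] flat_exp_0[of "1 - t"] by (cases "t > 0") (auto intro: add_pos_nonneg add_nonneg_pos)

lemma smooth_on_smooth_step: "smooth_on UNIV smooth_step"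
proof -
  have "smooth_on UNIV (\<lambda>t. flat_exp 0 (1 - t))"
    by (rule smooth_on_compose[OF smooth_on_flat_exp, where h = "\<lambda>t. 1 - t"])
      (auto intro!: smooth_on_diff smooth_on_const smooth_on_id)
  then have "smooth_on UNIV (\<lambda>t. flat_exp 0 t / (flat_exp 0 t + flat_exp 0 (1 - t)))"
    using smooth_step_denom_pos
    by (intro smooth_on_divide smooth_on_add smooth_on_flat_exp) (auto simp: less_imp_neq[symmetric])
  then show ?thesis by (simp add: smooth_step_def[abs_def])
qed

lemma smooth_step_bounds: "0 \<le> smooth_step t" "smooth_step t \<le> 1"
  using smooth_step_denom_pos[of t] flat_exp_0[of t] flat_exp_0[of "1 - t"]
  by (auto simp: smooth_step_def)

lemma smooth_step_eq_0: "t \<le> 0 \<Longrightarrow> smooth_step t = 0"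
  by (simp add: smooth_step_def flat_exp_0)

lemma smooth_step_eq_1: "t \<ge> 1 \<Longrightarrow> smooth_step t = 1"
  by (simp add: smooth_step_def flat_exp_def)

text \<open>Monotonicity is the point: \<open>D t \<ge> 0\<close> becomes the sign of
  \<open>g\<close> in \<open>cell_bump_has_derivative\<close>, which
  \<open>shrinking_injective\<close> requires.\<close>

lemma smooth_step_has_derivative:
  obtains D where "\<And>t. (smooth_step has_real_derivative D t) (at t)" "\<And>t. D t \<ge> 0"
    "\<And>t. t \<ge> 1 \<Longrightarrow> D t = 0" "\<And>t. t \<le> 0 \<Longrightarrow> D t = 0"
proof
  \<comment> \<open>The derivative of \<open>flat_exp 0\<close> is \<open>flat_exp 2\<close>, and
    the quotient rule leaves only the two mixed products in the numerator.\<close>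
  define D where "D t = (flat_exp 2 t * flat_exp 0 (1 - t) + flat_exp 0 t * flat_exp 2 (1 - t))
      / (flat_exp 0 t + flat_exp 0 (1 - t))\<^sup>2" for t
  have d: "(flat_exp 0 has_real_derivative flat_exp 2 t) (at t)" for t
    using flat_exp_has_real_derivative[of 0 t] by (simp add: numeral_2_eq_2)
  have d1: "((\<lambda>t. flat_exp 0 (1 - t)) has_real_derivative - flat_exp 2 (1 - t)) (at t)" for t
    using DERIV_chain2[OF d, of "\<lambda>t. 1 - t" "-1" t UNIV] 
    using DERIV_diff[OF DERIV_const[of "1::real" "at t"] DERIV_ident] by simp
  show "(smooth_step has_real_derivative D t) (at t)" for t
    unfolding smooth_step_def[abs_def] D_def
    using smooth_step_denom_pos[of t]
    by (auto intro!: derivative_eq_intros d d1 simp: power2_eq_square algebra_simps)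
  have f2: "flat_exp 2 t \<ge> 0" for t by (simp add: flat_exp_def)
  show "D t \<ge> 0" for t
    unfolding D_def using f2 flat_exp_0(1) by auto
  show "D t = 0" if "t \<ge> 1" for t
    using that by (simp add: D_def flat_exp_def)
  show "D t = 0" if "t \<le> 0" for t
    using that by (simp add: D_def flat_exp_def)
qed

section \<open>Partial derivatives\<close>

text \<open>A \<open>partial_deriv\<close> with values in any normed space, so that vectors and
  whole matrices can be differentiated at once.\<close>

definition partial :: "'n \<Rightarrow> (real^'n \<Rightarrow> 'b::real_normed_vector) \<Rightarrow> real^'n \<Rightarrow> 'b" where
  "partial i f x = frechet_derivative f (at x) (axis i 1)"

lemma partial_deriv_eq_partial: "partial_deriv i f = partial i f"
  by (simp add: fun_eq_iff partial_deriv_def partial_def)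

lemma partial_eqI: "(f has_derivative f') (at x) \<Longrightarrow> partial i f x = f' (axis i 1)"
  unfolding partial_def by (metis frechet_derivative_at)

lemma differentiable_has_frechet_derivative:
  "f differentiable at x \<Longrightarrow> (f has_derivative frechet_derivative f (at x)) (at x)"
  by (simp add: frechet_derivative_works)

lemma frechet_derivative_eq_partial:
  assumes "f differentiable at x"
  shows "frechet_derivative f (at x) v = (\<Sum>i\<in>UNIV. v $ i *\<^sub>R partial i f x)"
proof -
  interpret l: bounded_linear "frechet_derivative f (at x)"
    using differentiable_has_frechet_derivative[OF assms] by (rule has_derivative_bounded_linear)
  have "v = (\<Sum>i\<in>UNIV. v $ i *\<^sub>R axis i 1)"
    by (auto simp: vec_eq_iff axis_def if_distrib cong: if_cong)
  then have "frechet_derivative f (at x) v = frechet_derivative f (at x) (\<Sum>i\<in>UNIV. v $ i *\<^sub>R axis i 1)"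
    by simp
  then show ?thesis by (simp add: l.sum l.scaleR partial_def)
qed

lemma partial_cong:
  assumes "open S" "x \<in> S" "\<And>y. y \<in> S \<Longrightarrow> f y = g y" "f differentiable at x"
  shows "partial i f x = partial i g x"
  unfolding partial_def using frechet_derivative_transform_within_open[OF assms(4,1,2,3)] by simp

lemma partial_const: "partial i (\<lambda>x. c) x = 0"
  by (simp add: partial_def)

lemma partial_add:
  assumes "f differentiable at x" "g differentiable at x"
  shows "partial i (\<lambda>x. f x + g x) x = partial i f x + partial i g x"
  using partial_eqI[OF has_derivative_add[OF assms[THEN differentiable_has_frechet_derivative]]]
  by (simp add: partial_def)

lemma partial_diff:
  assumes "f differentiable at x" "g differentiable at x"
  shows "partial i (\<lambda>x. f x - g x) x = partial i f x - partial i g x"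
  using partial_eqI[OF has_derivative_diff[OF assms[THEN differentiable_has_frechet_derivative]]]
  by (simp add: partial_def)

lemma partial_bilinear:
  assumes "bounded_bilinear h" "f differentiable at x" "g differentiable at x"
  shows "partial i (\<lambda>x. h (f x) (g x)) x = h (partial i f x) (g x) + h (f x) (partial i g x)"
  using partial_eqI[OF bounded_bilinear.FDERIV[OF assms(1) assms(2,3)[THEN differentiable_has_frechet_derivative]]]
  by (simp add: partial_def add.commute)

lemmas partial_mult = partial_bilinear[OF bounded_bilinear_mult]
lemmas partial_scaleR = partial_bilinear[OF bounded_bilinear_scaleR]
lemmas partial_inner = partial_bilinear[OF bounded_bilinear_inner]

lemma partial_sum:
  assumes "\<And>j. j \<in> I \<Longrightarrow> f j differentiable at x"
  shows "partial i (\<lambda>x. \<Sum>j\<in>I. f j x) x = (\<Sum>j\<in>I. partial i (f j) x)"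
  using partial_eqI[OF has_derivative_sum[OF differentiable_has_frechet_derivative[OF assms]]]
  by (simp add: partial_def)

lemma partial_linear:
  assumes "bounded_linear h" "f differentiable at x"
  shows "partial i (\<lambda>x. h (f x)) x = h (partial i f x)"
  using partial_eqI[OF bounded_linear.has_derivative[OF assms(1) differentiable_has_frechet_derivative[OF assms(2)]]]
  by (simp add: partial_def)

lemma partial_vec_nth:
  "f differentiable at x \<Longrightarrow> partial i (\<lambda>x. f x $ k) x = partial i f x $ k"
  by (rule partial_linear[OF bounded_linear_vec_nth])

lemma partial_compose:
  assumes "\<Phi> differentiable at x" "f differentiable at (\<Phi> x)"
  shows "partial i (\<lambda>x. f (\<Phi> x)) x = (\<Sum>a\<in>UNIV. partial i \<Phi> x $ a *\<^sub>R partial a f (\<Phi> x))"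
  using partial_eqI[OF has_derivative_compose[OF assms[THEN differentiable_has_frechet_derivative]]]
  by (simp add: frechet_derivative_eq_partial[OF assms(2)]) (simp add: partial_def)

lemma smooth_on_partial: "smooth_on S f \<Longrightarrow> smooth_on S (partial i f)"
  unfolding partial_def[abs_def] by (rule smooth_on_frechet_derivative)

section \<open>Symmetry of mixed partial derivatives\<close>

lemma mixed_difference_eq:
  fixes f :: "real^'n \<Rightarrow> real"
  assumes S: "smooth_on S f" "\<And>s t. 0 \<le> s \<Longrightarrow> s \<le> h \<Longrightarrow> 0 \<le> t \<Longrightarrow> t \<le> h \<Longrightarrow> x + s *\<^sub>R axis i 1 + t *\<^sub>R axis j 1 \<in> S"
    and h: "0 < h"
  obtains s t where "0 \<le> s" "s \<le> h" "0 \<le> t" "t \<le> h"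
    "f (x + h *\<^sub>R axis i 1 + h *\<^sub>R axis j 1) - f (x + h *\<^sub>R axis i 1) - f (x + h *\<^sub>R axis j 1) + f x
      = h\<^sup>2 * partial j (partial i f) (x + s *\<^sub>R axis i 1 + t *\<^sub>R axis j 1)"
proof -
  let ?e = "axis i 1 :: real^'n" and ?d = "axis j 1 :: real^'n"
  have line: "((\<lambda>r. F (p + r *\<^sub>R axis k 1)) has_real_derivative partial k F (p + r *\<^sub>R axis k 1)) (at r)"
    if "smooth_on S F" "p + r *\<^sub>R axis k 1 \<in> S" for F :: "real^'n \<Rightarrow> real" and p r k
  proof -
    have F: "F differentiable at (p + r *\<^sub>R axis k 1)"
      using that by (rule smooth_on_imp_differentiable)
    interpret l: bounded_linear "frechet_derivative F (at (p + r *\<^sub>R axis k 1))"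
      using differentiable_has_frechet_derivative[OF F] by (rule has_derivative_bounded_linear)
    have "((\<lambda>r. p + r *\<^sub>R axis k (1::real)) has_derivative (\<lambda>r. r *\<^sub>R axis k 1)) (at r)"
      by (auto intro!: derivative_eq_intros)
    from has_derivative_compose[OF this differentiable_has_frechet_derivative[OF F]]
    moreover have "(\<lambda>r. r * c) = (*) c" for c :: real by (simp add: fun_eq_iff mult.commute)
    ultimately show ?thesis by (simp add: has_field_derivative_def partial_def l.scaleR)
  qed
  \<comment> \<open>The increment of \<open>f\<close> across the square in direction
    \<open>j\<close>, as a function of the position in direction \<open>i\<close>. The mean value
    theorem is applied to it first, and then to \<open>partial i f\<close> in direction
    \<open>j\<close>.\<close>
  define \<phi> where "\<phi> s = f (x + h *\<^sub>R ?d + s *\<^sub>R ?e) - f (x + s *\<^sub>R ?e)" for s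
  have d\<phi>: "DERIV \<phi> s :> partial i f (x + h *\<^sub>R ?d + s *\<^sub>R ?e) - partial i f (x + s *\<^sub>R ?e)" if "0 \<le> s" "s \<le> h" for s
    unfolding \<phi>_def
  proof (intro DERIV_diff line[OF S(1)])
    show "x + h *\<^sub>R ?d + s *\<^sub>R ?e \<in> S" "x + s *\<^sub>R ?e \<in> S"
      using S(2)[OF that, of h] S(2)[OF that, of 0] h by (auto simp: add_ac)
  qed
  from MVT2[OF h d\<phi>] obtain s where s: "0 < s" "s < h"
    and 1: "\<phi> h - \<phi> 0 = (h - 0) * (partial i f (x + h *\<^sub>R ?d + s *\<^sub>R ?e) - partial i f (x + s *\<^sub>R ?e))"
    by blast
  have "DERIV (\<lambda>t. partial i f (x + s *\<^sub>R ?e + t *\<^sub>R ?d)) t :> partial j (partial i f) (x + s *\<^sub>R ?e + t *\<^sub>R ?d)"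
    if "0 \<le> t" "t \<le> h" for t
    using S(2)[of s t] s that by (intro line smooth_on_partial[OF S(1)]) auto
  from MVT2[OF h this] obtain t where t: "0 < t" "t < h"
    and 2: "partial i f (x + s *\<^sub>R ?e + h *\<^sub>R ?d) - partial i f (x + s *\<^sub>R ?e + 0 *\<^sub>R ?d)
      = (h - 0) * partial j (partial i f) (x + s *\<^sub>R ?e + t *\<^sub>R ?d)"
    by blast
  show ?thesis
  proof
    show "f (x + h *\<^sub>R axis i 1 + h *\<^sub>R axis j 1) - f (x + h *\<^sub>R axis i 1) - f (x + h *\<^sub>R axis j 1) + f x
      = h\<^sup>2 * partial j (partial i f) (x + s *\<^sub>R axis i 1 + t *\<^sub>R axis j 1)"
      using 1 2 by (simp add: \<phi>_def power2_eq_square add_ac)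
  qed (use s t in auto)
qed

text \<open>The second difference of \<open>f\<close> over a square is symmetric in the two
  directions and equals \<open>h\<^sup>2\<close> times either mixed derivative at some point of the
  square. By continuity of both, they cannot differ at \<open>x\<close>.\<close>

lemma partial_commute:
  fixes f :: "real^'n \<Rightarrow> real"
  assumes "open S" "smooth_on S f" "x \<in> S"
  shows "partial i (partial j f) x = partial j (partial i f) x"
proof (rule ccontr)
  let ?A = "partial i (partial j f)" and ?B = "partial j (partial i f)"
  assume "?A x \<noteq> ?B x"
  then have e: "0 < \<bar>?A x - ?B x\<bar> / 2" by simp
  obtain r where r: "r > 0" "ball x r \<subseteq> S"
    using assms openE by blast
  have "isCont ?A x" "isCont ?B x"
    using assms by (auto intro!: differentiable_imp_continuous_within smooth_on_imp_differentiable smooth_on_partial)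
  then have "\<forall>e>0. \<exists>d>0. \<forall>y. dist y x < d \<longrightarrow> \<bar>?A y - ?A x\<bar> < e" "\<forall>e>0. \<exists>d>0. \<forall>y. dist y x < d \<longrightarrow> \<bar>?B y - ?B x\<bar> < e"
    unfolding continuous_at_eps_delta dist_real_def by blast+
  then obtain d1 d2 where d: "d1 > 0" "\<And>y. dist y x < d1 \<Longrightarrow> \<bar>?A y - ?A x\<bar> < \<bar>?A x - ?B x\<bar> / 2"
      "d2 > 0" "\<And>y. dist y x < d2 \<Longrightarrow> \<bar>?B y - ?B x\<bar> < \<bar>?A x - ?B x\<bar> / 2"
    using e by blast
  \<comment> \<open>Points of the square are at most \<open>2 * h\<close> away from
    \<open>x\<close>, so a third of the smallest radius is enough.\<close>
  define h where "h = min r (min d1 d2) / 3"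
  have h: "h > 0" "2 * h < r" "2 * h < d1" "2 * h < d2"
    using r d unfolding h_def by (auto simp: min_def)
  have near: "dist (x + s *\<^sub>R axis k 1 + t *\<^sub>R axis l 1) x \<le> 2 * h"
    if "0 \<le> s" "s \<le> h" "0 \<le> t" "t \<le> h" for s t k l
  proof -
    have "dist (x + s *\<^sub>R axis k 1 + t *\<^sub>R axis l 1) x = norm (s *\<^sub>R axis k 1 + t *\<^sub>R axis l 1 :: real^'n)"
      by (simp add: dist_norm)
    also have "\<dots> \<le> norm (s *\<^sub>R axis k 1 :: real^'n) + norm (t *\<^sub>R axis l 1 :: real^'n)"
      by (rule norm_triangle_ineq)
    finally show ?thesis using that by simp
  qed
  have inS: "x + s *\<^sub>R axis k 1 + t *\<^sub>R axis l 1 \<in> S" if "0 \<le> s" "s \<le> h" "0 \<le> t" "t \<le> h" for s t k l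
    using near[OF that, of k l] h r(2) by (auto simp: dist_commute)
  obtain s t where st: "0 \<le> s" "s \<le> h" "0 \<le> t" "t \<le> h"
    "f (x + h *\<^sub>R axis i 1 + h *\<^sub>R axis j 1) - f (x + h *\<^sub>R axis i 1) - f (x + h *\<^sub>R axis j 1) + f x
      = h\<^sup>2 * ?B (x + s *\<^sub>R axis i 1 + t *\<^sub>R axis j 1)"
    by (rule mixed_difference_eq[OF assms(2) inS h(1)]) blast+
  obtain s' t' where st': "0 \<le> s'" "s' \<le> h" "0 \<le> t'" "t' \<le> h"
    "f (x + h *\<^sub>R axis j 1 + h *\<^sub>R axis i 1) - f (x + h *\<^sub>R axis j 1) - f (x + h *\<^sub>R axis i 1) + f x
      = h\<^sup>2 * ?A (x + s' *\<^sub>R axis j 1 + t' *\<^sub>R axis i 1)"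
    by (rule mixed_difference_eq[OF assms(2) inS h(1)]) blast+
  have "?A (x + s' *\<^sub>R axis j 1 + t' *\<^sub>R axis i 1) = ?B (x + s *\<^sub>R axis i 1 + t *\<^sub>R axis j 1)"
    using st(5) st'(5) h(1) by (simp add: algebra_simps)
  moreover have "\<bar>?A (x + s' *\<^sub>R axis j 1 + t' *\<^sub>R axis i 1) - ?A x\<bar> < \<bar>?A x - ?B x\<bar> / 2"
    using near[OF st'(1-4), of j i] h by (intro d) auto
  moreover have "\<bar>?B (x + s *\<^sub>R axis i 1 + t *\<^sub>R axis j 1) - ?B x\<bar> < \<bar>?A x - ?B x\<bar> / 2"
    using near[OF st(1-4), of i j] h by (intro d) auto
  ultimately have "\<bar>?A x - ?B x\<bar> < \<bar>?A x - ?B x\<bar> / 2 + \<bar>?A x - ?B x\<bar> / 2"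
    by linarith
  then show False by simp
qed

section \<open>Matrices\<close>

lemma invertible_matrix_inv:
  assumes "invertible A"
  shows matrix_inv_right: "A ** matrix_inv A = mat 1" and matrix_inv_left: "matrix_inv A ** A = mat 1"
proof -
  have "A ** matrix_inv A = mat 1 \<and> matrix_inv A ** A = mat 1"
    using assms unfolding invertible_def matrix_inv_def by (rule someI_ex)
  then show "A ** matrix_inv A = mat 1" "matrix_inv A ** A = mat 1" by auto
qed

lemma matrix_inv_unique:
  assumes "A ** B = mat 1" "B ** A = mat 1"
  shows "matrix_inv A = B"
proof -
  have "invertible A" using assms by (auto simp: invertible_def)
  have "matrix_inv A = matrix_inv A ** (A ** B)" using assms by simp
  also have "\<dots> = B" by (simp add: matrix_mul_assoc matrix_inv_left[OF \<open>invertible A\<close>])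
  finally show ?thesis .
qed

lemma bounded_bilinear_matrix_mult:
  "bounded_bilinear ((**) :: real^'n^'m \<Rightarrow> real^'p^'n \<Rightarrow> real^'p^'m)"
  unfolding bilinear_conv_bounded_bilinear[symmetric] bilinear_def
  by (auto intro!: linearI simp: matrix_matrix_mult_def vec_eq_iff sum.distrib algebra_simps sum_distrib_left)

interpretation matmul: bounded_bilinear "(**) :: real^'n^'m \<Rightarrow> real^'p^'n \<Rightarrow> real^'p^'m"
  by (rule bounded_bilinear_matrix_mult)

lemma bounded_linear_transpose: "bounded_linear (transpose :: real^'n^'m \<Rightarrow> real^'m^'n)"
  unfolding linear_conv_bounded_linear[symmetric]
  by (auto intro!: linearI simp: transpose_def vec_eq_iff)

lemma smooth_on_matrix_mult:
  fixes A :: "'a::real_normed_vector \<Rightarrow> real^'n^'m" and B :: "'a \<Rightarrow> real^'p^'n"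
  shows "open S \<Longrightarrow> smooth_on S A \<Longrightarrow> smooth_on S B \<Longrightarrow> smooth_on S (\<lambda>x. A x ** B x)"
  by (simp add: smooth_on_def higher_diff_on_bounded_bilinear[OF bounded_bilinear_matrix_mult])

lemma smooth_on_det:
  fixes A :: "'a::real_normed_vector \<Rightarrow> real^'n^'n"
  assumes "open S" "smooth_on S A"
  shows "smooth_on S (\<lambda>x. det (A x))"
  unfolding det_def
  by (intro smooth_on_sum smooth_on_mult smooth_on_const smooth_on_prod smooth_on_vec_nth assms)

text \<open>By Cramer's rule the entries of the inverse are quotients of determinants, and these are
  polynomials in the entries.\<close>

lemma smooth_on_matrix_inv:
  fixes A :: "'a::real_normed_vector \<Rightarrow> real^'n^'n"
  assumes S: "open S" and A: "smooth_on S A" "\<And>x. x \<in> S \<Longrightarrow> invertible (A x)"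
  shows "smooth_on S (\<lambda>x. matrix_inv (A x))"
proof -
  define C where "C x = (\<chi> l m. det (\<chi> i j. if j = l then (axis m 1 :: real^'n) $ i else A x $ i $ j) / det (A x))"
    for x
  have C: "matrix_inv (A x) = C x" if "x \<in> S" for x
  proof -
    have "A x *v column m (matrix_inv (A x)) = axis m 1" for m
    proof -
      have "A x *v column m (matrix_inv (A x)) = column m (A x ** matrix_inv (A x))"
        by (simp add: column_def vec_eq_iff matrix_vector_mult_def matrix_matrix_mult_def)
      then show ?thesis
        by (simp add: matrix_inv_right[OF A(2)[OF that]] column_def mat_def axis_def vec_eq_iff)
    qed
    then have "column m (matrix_inv (A x)) = (\<chi> k. det (\<chi> i j. if j = k then (axis m 1 :: real^'n) $ i else A x $ i $ j) / det (A x))" for m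
      using cramer[of "A x"] A(2)[OF that] by (simp add: invertible_det_nz)
    then show ?thesis by (simp add: C_def vec_eq_iff column_def)
  qed
  have "smooth_on S C"
  proof (rule smooth_on_vecI[OF S], rule smooth_on_vecI[OF S])
    fix l m
    have "smooth_on S (\<lambda>x. (\<chi> i j. if j = l then (axis m 1 :: real^'n) $ i else A x $ i $ j) :: real^'n^'n)"
    proof (rule smooth_on_vecI[OF S], rule smooth_on_vecI[OF S])
      fix i j
      show "smooth_on S (\<lambda>x. (\<chi> i j. if j = l then (axis m 1 :: real^'n) $ i else A x $ i $ j) $ i $ j)"
        by (cases "j = l") (auto intro!: smooth_on_const smooth_on_vec_nth[OF S] A)
    qed
    then show "smooth_on S (\<lambda>x. C x $ l $ m)"
      unfolding C_def using A(2)
      by (simp, intro smooth_on_divide[OF S] smooth_on_det[OF S] A(1)) (auto simp: invertible_det_nz)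
  qed
  moreover have "higher_diff_on S k (\<lambda>x. matrix_inv (A x)) = higher_diff_on S k C" for k
    by (rule higher_diff_on_cong[OF S C])
  ultimately show ?thesis by (simp add: smooth_on_def)
qed

section \<open>Scalar curvature of a pullback metric\<close>

definition jacobian :: "(real^'n \<Rightarrow> real^'m) \<Rightarrow> real^'n \<Rightarrow> real^'n^'m" where
  "jacobian \<Phi> x = (\<chi> a i. partial i \<Phi> x $ a)"

definition pullback_metric :: "(real^'n \<Rightarrow> real^'m) \<Rightarrow> (real^'m \<Rightarrow> real^'m^'m) \<Rightarrow> real^'n \<Rightarrow> real^'n^'n" where
  "pullback_metric \<Phi> h x = transpose (jacobian \<Phi> x) ** h (\<Phi> x) ** jacobian \<Phi> x"

text \<open>The connection form of the Levi-Civita connection in direction \<open>i\<close>, acting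
  on column vectors, so that contractions of Christoffel symbols become matrix products.\<close>

definition christoffel_matrix :: "(real^'n \<Rightarrow> real^'n^'n) \<Rightarrow> 'n \<Rightarrow> real^'n \<Rightarrow> real^'n^'n" where
  "christoffel_matrix g i x = (\<chi> l k. christoffel g l i k x)"

text \<open>A component of the curvature form \<open>d\<omega> + \<omega> \<and> \<omega>\<close> of
  the connection form \<omega>.\<close>

definition curvature_matrix :: "(real^'n \<Rightarrow> real^'n^'n) \<Rightarrow> 'n \<Rightarrow> 'n \<Rightarrow> real^'n \<Rightarrow> real^'n^'n" where
  "curvature_matrix g i j x =
     partial i (christoffel_matrix g j) x - partial j (christoffel_matrix g i) x
     + christoffel_matrix g i x ** christoffel_matrix g j x
     - christoffel_matrix g j x ** christoffel_matrix g i x"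

lemma bounded_bilinear_matrix_vector_mult:
  "bounded_bilinear ((*v) :: real^'n^'m \<Rightarrow> real^'n \<Rightarrow> real^'m)"
  unfolding bilinear_conv_bounded_bilinear[symmetric] bilinear_def
  by (auto intro!: linearI simp: matrix_vector_mult_def vec_eq_iff sum.distrib algebra_simps sum_distrib_left)

interpretation matvec: bounded_bilinear "(*v) :: real^'n^'m \<Rightarrow> real^'n \<Rightarrow> real^'m"
  by (rule bounded_bilinear_matrix_vector_mult)

lemma inner_matrix_transpose: "u \<bullet> (A *v w) = w \<bullet> (transpose A *v u)"
  for A :: "real^'n^'n"
  by (metis dot_lmul_matrix inner_commute transpose_matrix_vector)

lemma partial_vec_nth2:
  fixes A :: "real^'n \<Rightarrow> real^'m^'k"
  assumes "A differentiable at x"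
  shows "partial i (\<lambda>y. A y $ a $ b) x = partial i A x $ a $ b"
proof -
  have "(\<lambda>y. A y $ a) differentiable at x"
    using bounded_linear.has_derivative[OF bounded_linear_vec_nth differentiable_has_frechet_derivative[OF assms]]
    by (auto simp: differentiable_def)
  then show ?thesis using assms by (simp add: partial_vec_nth)
qed

lemma smooth_on_christoffel_matrix:
  assumes "open S" "smooth_on S g" "\<And>x. x \<in> S \<Longrightarrow> invertible (g x)"
  shows "smooth_on S (christoffel_matrix g i)"
proof (rule smooth_on_vecI[OF assms(1)], rule smooth_on_vecI[OF assms(1)])
  fix l k
  show "smooth_on S (\<lambda>x. christoffel_matrix g i x $ l $ k)"
    unfolding christoffel_matrix_def christoffel_def partial_deriv_eq_partial vec_lambda_beta
    by (intro smooth_on_mult smooth_on_sum smooth_on_diff smooth_on_add smooth_on_const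
        smooth_on_vec_nth smooth_on_matrix_inv smooth_on_partial assms)
qed

lemma invertible_mult_eq:
  assumes "invertible A" "A *v u = A *v w"
  shows "u = w"
proof -
  have "matrix_inv A *v (A *v u) = matrix_inv A *v (A *v w)" by (simp only: assms(2))
  then show ?thesis
    by (simp only: matrix_vector_mul_assoc matrix_inv_left[OF assms(1)] matrix_vector_mul_lid)
qed

text \<open>Lowering the upper index cancels the inverse matrix in the definition, so that only
  derivatives of \<open>g\<close> remain.\<close>

lemma christoffel_lower:
  assumes "g differentiable at x" "invertible (g x)"
  shows "(g x *v (christoffel_matrix g i x *v axis j 1)) $ m
    = (partial i g x $ j $ m + partial j g x $ i $ m - partial m g x $ i $ j) / 2"
proof -
  define c where "c = (\<chi> m. (partial i g x $ j $ m + partial j g x $ i $ m - partial m g x $ i $ j) / 2)"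
  have "christoffel_matrix g i x *v axis j 1 = matrix_inv (g x) *v c"
    by (simp add: vec_eq_iff matrix_vector_mult_def axis_def if_distrib christoffel_matrix_def
        christoffel_def partial_deriv_eq_partial partial_vec_nth2[OF assms(1)] c_def sum_divide_distrib
        cong: if_cong)
  then have "g x *v (christoffel_matrix g i x *v axis j 1) = c"
    by (simp add: matrix_vector_mul_assoc matrix_inv_right[OF assms(2)])
  then show ?thesis by (simp add: c_def)
qed

lemma inner_frechet_derivative_expand:
  fixes h :: "real^'n \<Rightarrow> real^'n^'n"
  assumes "h differentiable at y"
  shows "v \<bullet> (frechet_derivative h (at y) u *v w)
    = (\<Sum>b\<in>UNIV. \<Sum>c\<in>UNIV. \<Sum>m\<in>UNIV. u $ b * v $ c * w $ m * partial b h y $ c $ m)"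
proof -
  have "v \<bullet> (frechet_derivative h (at y) u *v w)
      = (\<Sum>c\<in>UNIV. \<Sum>m\<in>UNIV. \<Sum>b\<in>UNIV. u $ b * v $ c * w $ m * partial b h y $ c $ m)"
    by (simp add: frechet_derivative_eq_partial[OF assms] inner_vec_def matrix_vector_mult_def
        sum_distrib_left sum_distrib_right mult_ac)
  also have "\<dots> = (\<Sum>c\<in>UNIV. \<Sum>b\<in>UNIV. \<Sum>m\<in>UNIV. u $ b * v $ c * w $ m * partial b h y $ c $ m)"
    by (intro sum.cong refl sum.swap)
  also have "\<dots> = (\<Sum>b\<in>UNIV. \<Sum>c\<in>UNIV. \<Sum>m\<in>UNIV. u $ b * v $ c * w $ m * partial b h y $ c $ m)"
    by (rule sum.swap)
  finally show ?thesis .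
qed

lemma vec_eq_sum_axis: "v = (\<Sum>c\<in>UNIV. v $ c *\<^sub>R axis c 1)" for v :: "real^'n"
  by (auto simp: vec_eq_iff axis_def if_distrib cong: if_cong)

text \<open>Koszul's formula for the constant vector fields \<open>u\<close>, \<open>v\<close>,
  \<open>w\<close>.\<close>

lemma inner_christoffel:
  fixes h :: "real^'n \<Rightarrow> real^'n^'n"
  assumes h: "h differentiable at y" "invertible (h y)"
  shows "w \<bullet> (h y *v (\<Sum>b\<in>UNIV. u $ b *\<^sub>R (christoffel_matrix h b y *v v)))
    = (v \<bullet> (frechet_derivative h (at y) u *v w) + u \<bullet> (frechet_derivative h (at y) v *v w)
       - u \<bullet> (frechet_derivative h (at y) w *v v)) / 2"
proof -
  let ?T = "\<lambda>b c m. partial b h y $ c $ m"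
  have v: "christoffel_matrix h b y *v v = (\<Sum>c\<in>UNIV. v $ c *\<^sub>R (christoffel_matrix h b y *v axis c 1))" for b
    by (subst vec_eq_sum_axis[of v]) (simp add: matvec.sum_right matvec.scaleR_right)
  have "w \<bullet> (h y *v (\<Sum>b\<in>UNIV. u $ b *\<^sub>R (christoffel_matrix h b y *v v)))
     = (\<Sum>b\<in>UNIV. \<Sum>c\<in>UNIV. u $ b * v $ c * (w \<bullet> (h y *v (christoffel_matrix h b y *v axis c 1))))"
    by (simp add: v matvec.sum_right matvec.scaleR_right inner_sum_right sum_distrib_left mult_ac
      del: matrix_vector_mul_assoc)
  also have "\<dots> = (\<Sum>b\<in>UNIV. \<Sum>c\<in>UNIV. \<Sum>m\<in>UNIV. u $ b * v $ c * w $ m * ((?T b c m + ?T c b m - ?T m b c) / 2))"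
    by (simp add: inner_vec_def[of w] christoffel_lower[OF h] sum_distrib_left mult_ac
      del: matrix_vector_mul_assoc)
  also have "\<dots> = ((\<Sum>b\<in>UNIV. \<Sum>c\<in>UNIV. \<Sum>m\<in>UNIV. u $ b * v $ c * w $ m * ?T b c m)
      + (\<Sum>b\<in>UNIV. \<Sum>c\<in>UNIV. \<Sum>m\<in>UNIV. u $ b * v $ c * w $ m * ?T c b m)
      - (\<Sum>b\<in>UNIV. \<Sum>c\<in>UNIV. \<Sum>m\<in>UNIV. u $ b * v $ c * w $ m * ?T m b c)) / 2"
    by (simp add: sum.distrib sum_subtractf sum_divide_distrib add_divide_distrib diff_divide_distrib
        distrib_left right_diff_distrib)
  also have "(\<Sum>b\<in>UNIV. \<Sum>c\<in>UNIV. \<Sum>m\<in>UNIV. u $ b * v $ c * w $ m * ?T c b m)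
      = (\<Sum>c\<in>UNIV. \<Sum>b\<in>UNIV. \<Sum>m\<in>UNIV. v $ c * u $ b * w $ m * ?T c b m)"
    by (subst sum.swap) (simp add: mult_ac)
  also have "(\<Sum>b\<in>UNIV. \<Sum>c\<in>UNIV. \<Sum>m\<in>UNIV. u $ b * v $ c * w $ m * ?T m b c)
      = (\<Sum>m\<in>UNIV. \<Sum>b\<in>UNIV. \<Sum>c\<in>UNIV. w $ m * u $ b * v $ c * ?T m b c)"
  proof -
    have "(\<Sum>b\<in>UNIV. \<Sum>c\<in>UNIV. \<Sum>m\<in>UNIV. u $ b * v $ c * w $ m * ?T m b c)
       = (\<Sum>b\<in>UNIV. \<Sum>m\<in>UNIV. \<Sum>c\<in>UNIV. w $ m * u $ b * v $ c * ?T m b c)"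
      by (rule sum.cong[OF refl], subst sum.swap) (simp add: mult_ac)
    also have "\<dots> = (\<Sum>m\<in>UNIV. \<Sum>b\<in>UNIV. \<Sum>c\<in>UNIV. w $ m * u $ b * v $ c * ?T m b c)"
      by (rule sum.swap)
    finally show ?thesis .
  qed
  finally show ?thesis
    by (simp add: inner_frechet_derivative_expand[OF h(1)])
qed

lemma riemann_curvature_eq:
  assumes "\<And>i. christoffel_matrix g i differentiable at x"
  shows "riemann_curvature g l i j k x = curvature_matrix g i j x $ l $ k"
proof -
  have "partial i (\<lambda>x. christoffel g l j k x) x = partial i (christoffel_matrix g j) x $ l $ k" for i j
    using partial_vec_nth2[OF assms, of i j l k] by (simp add: christoffel_matrix_def)
  then show ?thesis
    by (simp add: riemann_curvature_def curvature_matrix_def partial_deriv_eq_partial sum_subtractf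
        matrix_matrix_mult_def christoffel_matrix_def)
qed

section \<open>Connection and curvature under pullback\<close>

locale metric_pullback =
  fixes S T :: "(real^'n) set" and \<Phi> :: "real^'n \<Rightarrow> real^'n" and h :: "real^'n \<Rightarrow> real^'n^'n"
  assumes open_S: "open S" and open_T: "open T"
    and smooth_\<Phi>: "smooth_on S \<Phi>" and maps: "\<And>x. x \<in> S \<Longrightarrow> \<Phi> x \<in> T"
    and smooth_h: "smooth_on T h"
    and sym_h: "\<And>y. y \<in> T \<Longrightarrow> transpose (h y) = h y"
    and inv_h: "\<And>y. y \<in> T \<Longrightarrow> invertible (h y)"
    and inv_J: "\<And>x. x \<in> S \<Longrightarrow> invertible (jacobian \<Phi> x)"
begin

abbreviation "J \<equiv> jacobian \<Phi>"
abbreviation "G \<equiv> pullback_metric \<Phi> h"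
abbreviation "\<Gamma> \<equiv> christoffel_matrix G"
abbreviation "\<Gamma>' \<equiv> christoffel_matrix h"

text \<open>In terms of \<open>J\<close>, the Christoffel symbols transform like a connection under a gauge
  transformation, with \<open>\<Omega>\<close> the pulled back connection form.\<close>

definition \<Omega> :: "'n \<Rightarrow> real^'n \<Rightarrow> real^'n^'n" where
  "\<Omega> i x = (\<Sum>b\<in>UNIV. J x $ b $ i *\<^sub>R \<Gamma>' b (\<Phi> x))"

lemma smooth_J: "smooth_on S J"
  unfolding jacobian_def
  by (rule smooth_on_vecI[OF open_S], rule smooth_on_vecI[OF open_S])
    (simp, intro smooth_on_vec_nth open_S smooth_on_partial smooth_\<Phi>)

lemma smooth_on_compose_\<Phi>: "smooth_on T f \<Longrightarrow> smooth_on S (\<lambda>x. f (\<Phi> x))"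
  using maps by (intro smooth_on_compose[OF _ smooth_\<Phi> open_S open_T]) auto

lemma smooth_G: "smooth_on S G"
  unfolding pullback_metric_def
  by (intro smooth_on_matrix_mult open_S smooth_on_linear_compose[OF bounded_linear_transpose]
      smooth_J smooth_on_compose_\<Phi> smooth_h)

lemma inv_G: "x \<in> S \<Longrightarrow> invertible (G x)"
  unfolding pullback_metric_def
  by (intro invertible_mult transpose_invertible inv_J inv_h maps)

lemma smooth_\<Gamma>: "smooth_on S (\<Gamma> i)"
  by (rule smooth_on_christoffel_matrix[OF open_S smooth_G inv_G])

lemma smooth_\<Gamma>': "smooth_on T (\<Gamma>' i)"
  by (rule smooth_on_christoffel_matrix[OF open_T smooth_h inv_h])

lemma smooth_\<Omega>: "smooth_on S (\<Omega> i)"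
  unfolding \<Omega>_def
  by (intro smooth_on_sum smooth_on_scaleR smooth_on_vec_nth open_S smooth_J
      smooth_on_compose_\<Phi> smooth_\<Gamma>')

lemma J_axis: "J x *v axis i 1 = partial i \<Phi> x"
  by (simp add: vec_eq_iff matrix_vector_mult_def axis_def jacobian_def if_distrib cong: if_cong)

lemma axis_inner_transpose_J: "axis m 1 \<bullet> (transpose (J x) *v w) = partial m \<Phi> x \<bullet> w"
  by (simp only: inner_matrix_transpose[of w "J x", symmetric] J_axis inner_commute)

lemma partial_J:
  assumes "x \<in> S"
  shows "partial i J x $ a $ j = partial i (partial j \<Phi>) x $ a"
proof -
  have "partial i J x $ a $ j = partial i (\<lambda>y. J y $ a $ j) x"
    by (rule partial_vec_nth2[symmetric], rule smooth_on_imp_differentiable[OF smooth_J assms])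
  also have "\<dots> = partial i (\<lambda>y. partial j \<Phi> y $ a) x"
    by (simp add: jacobian_def)
  also have "\<dots> = partial i (partial j \<Phi>) x $ a"
    by (rule partial_vec_nth, rule smooth_on_imp_differentiable[OF smooth_on_partial[OF smooth_\<Phi>] assms])
  finally show ?thesis .
qed

lemma partial_commute_vec:
  fixes F :: "real^'n \<Rightarrow> real^'k"
  assumes "smooth_on S F" "x \<in> S"
  shows "partial i (partial j F) x = partial j (partial i F) x"
proof -
  have *: "partial i (partial j F) x $ a = partial i (partial j (\<lambda>y. F y $ a)) x" for a i j
  proof -
    have "partial i (partial j F) x $ a = partial i (\<lambda>y. partial j F y $ a) x"
      by (rule partial_vec_nth[symmetric], rule smooth_on_imp_differentiable[OF smooth_on_partial[OF assms(1)] assms(2)])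
    also have "\<dots> = partial i (partial j (\<lambda>y. F y $ a)) x"
    proof (rule partial_cong[OF open_S assms(2)])
      show "partial j F y $ a = partial j (\<lambda>y. F y $ a) y" if "y \<in> S" for y
        by (rule partial_vec_nth[symmetric], rule smooth_on_imp_differentiable[OF assms(1) that])
      show "(\<lambda>y. partial j F y $ a) differentiable at x"
        by (rule smooth_on_imp_differentiable[OF smooth_on_vec_nth[OF open_S smooth_on_partial[OF assms(1)]] assms(2)])
    qed
    finally show ?thesis .
  qed
  show ?thesis
    unfolding vec_eq_iff *
    using partial_commute[OF open_S smooth_on_vec_nth[OF open_S assms(1)] assms(2)] by blast
qed

lemma G_nth: "G x $ j $ m = partial j \<Phi> x \<bullet> (h (\<Phi> x) *v partial m \<Phi> x)"
proof -
  have "G x $ j $ m = (\<Sum>l\<in>UNIV. \<Sum>k\<in>UNIV. partial j \<Phi> x $ k * h (\<Phi> x) $ k $ l * partial m \<Phi> x $ l)"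
    by (simp add: pullback_metric_def matrix_matrix_mult_def transpose_def jacobian_def sum_distrib_right)
  also have "\<dots> = (\<Sum>k\<in>UNIV. \<Sum>l\<in>UNIV. partial j \<Phi> x $ k * h (\<Phi> x) $ k $ l * partial m \<Phi> x $ l)"
    by (rule sum.swap)
  finally show ?thesis
    by (simp add: inner_vec_def matrix_vector_mult_def sum_distrib_left mult_ac)
qed

lemma partial_h_\<Phi>:
  assumes "x \<in> S"
  shows "partial i (\<lambda>x. h (\<Phi> x)) x = frechet_derivative h (at (\<Phi> x)) (partial i \<Phi> x)"
    and "(\<lambda>x. h (\<Phi> x)) differentiable at x"
proof -
  have d: "h differentiable at (\<Phi> x)" "\<Phi> differentiable at x"
    using smooth_on_imp_differentiable[OF smooth_h maps[OF assms]]
      smooth_on_imp_differentiable[OF smooth_\<Phi> assms] by auto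
  then show "partial i (\<lambda>x. h (\<Phi> x)) x = frechet_derivative h (at (\<Phi> x)) (partial i \<Phi> x)"
    by (simp add: partial_compose frechet_derivative_eq_partial)
  show "(\<lambda>x. h (\<Phi> x)) differentiable at x"
    by (rule smooth_on_imp_differentiable[OF smooth_on_compose_\<Phi>[OF smooth_h] assms])
qed

lemma partial_G:
  assumes x: "x \<in> S"
  shows "partial i G x $ j $ m = partial i (partial j \<Phi>) x \<bullet> (h (\<Phi> x) *v partial m \<Phi> x)
    + partial j \<Phi> x \<bullet> (frechet_derivative h (at (\<Phi> x)) (partial i \<Phi> x) *v partial m \<Phi> x)
    + partial j \<Phi> x \<bullet> (h (\<Phi> x) *v partial i (partial m \<Phi>) x)"
proof -
  have d: "partial j \<Phi> differentiable at x" for j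
    by (rule smooth_on_imp_differentiable[OF smooth_on_partial[OF smooth_\<Phi>] x])
  have d2: "(\<lambda>x. h (\<Phi> x) *v partial m \<Phi> x) differentiable at x"
    using bounded_bilinear.FDERIV[OF bounded_bilinear_matrix_vector_mult
        differentiable_has_frechet_derivative[OF partial_h_\<Phi>(2)[OF x]]
        differentiable_has_frechet_derivative[OF d]]
    by (auto simp: differentiable_def)
  have "partial i G x $ j $ m = partial i (\<lambda>y. G y $ j $ m) x"
    by (rule partial_vec_nth2[symmetric], rule smooth_on_imp_differentiable[OF smooth_G x])
  also have "\<dots> = partial i (\<lambda>x. partial j \<Phi> x \<bullet> (h (\<Phi> x) *v partial m \<Phi> x)) x"
    by (simp add: G_nth)
  also have "\<dots> = partial i (partial j \<Phi>) x \<bullet> (h (\<Phi> x) *v partial m \<Phi> x)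
     + partial j \<Phi> x \<bullet> partial i (\<lambda>x. h (\<Phi> x) *v partial m \<Phi> x) x"
    by (rule partial_inner[OF d d2])
  also have "partial i (\<lambda>x. h (\<Phi> x) *v partial m \<Phi> x) x
     = frechet_derivative h (at (\<Phi> x)) (partial i \<Phi> x) *v partial m \<Phi> x + h (\<Phi> x) *v partial i (partial m \<Phi>) x"
    by (subst partial_bilinear[OF bounded_bilinear_matrix_vector_mult partial_h_\<Phi>(2)[OF x] d])
      (simp add: partial_h_\<Phi>(1)[OF x])
  finally show ?thesis by (simp add: inner_add_right)
qed

text \<open>Each column is determined by its products under \<open>h\<close> with the columns
  \<open>?e m\<close> of the Jacobian. On the left these are the Christoffel symbols of
  \<open>G\<close> with lowered index. When the derivatives of \<open>G\<close> are expanded,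
  symmetry of the second derivatives of \<Phi> leaves just one of them, and the rest is Koszul's
  formula for \<open>h\<close>.\<close>

lemma gauge:
  assumes x: "x \<in> S"
  shows "J x ** \<Gamma> i x = partial i J x + \<Omega> i x ** J x"
proof -
  let ?h = "h (\<Phi> x)" and ?e = "\<lambda>i. partial i \<Phi> x" and ?H = "\<lambda>i j. partial i (partial j \<Phi>) x"
  let ?D = "frechet_derivative h (at (\<Phi> x))"
  have hd: "h differentiable at (\<Phi> x)"
    by (rule smooth_on_imp_differentiable[OF smooth_h maps[OF x]])
  have Gd: "G differentiable at x"
    by (rule smooth_on_imp_differentiable[OF smooth_G x])
  have H: "?H i j = ?H j i" for i j
    by (rule partial_commute_vec[OF smooth_\<Phi> x])
  have sym: "u \<bullet> (?h *v w) = w \<bullet> (?h *v u)" for u w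
    by (metis inner_matrix_transpose sym_h[OF maps[OF x]])
  have col: "J x *v (\<Gamma> i x *v axis j 1) = ?H i j + (\<Sum>b\<in>UNIV. ?e i $ b *\<^sub>R (\<Gamma>' b (\<Phi> x) *v ?e j))" (is "?X = ?Y") for j
  proof -
    have "?e m \<bullet> (?h *v ?X) = ?e m \<bullet> (?h *v ?Y)" for m
    proof -
      have "?e m \<bullet> (?h *v ?X) = (G x *v (\<Gamma> i x *v axis j 1)) $ m"
      proof -
        have "?e m \<bullet> (?h *v ?X) = axis m 1 \<bullet> (transpose (J x) *v (?h *v ?X))"
          by (simp only: axis_inner_transpose_J)
        also have "\<dots> = axis m 1 \<bullet> (G x *v (\<Gamma> i x *v axis j 1))"
          by (simp only: pullback_metric_def matrix_vector_mul_assoc matrix_mul_assoc)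
        finally show ?thesis by (simp add: inner_axis')
      qed
      also have "\<dots> = (partial i G x $ j $ m + partial j G x $ i $ m - partial m G x $ i $ j) / 2"
        by (rule christoffel_lower[OF Gd inv_G[OF x]])
      also have "\<dots> = ?e m \<bullet> (?h *v ?H i j) + (?e j \<bullet> (?D (?e i) *v ?e m) + ?e i \<bullet> (?D (?e j) *v ?e m)
          - ?e i \<bullet> (?D (?e m) *v ?e j)) / 2"
        unfolding partial_G[OF x] H[of j i] H[of m i] H[of m j] sym[of "?H i j" "?e m"] sym[of "?H i m" "?e j"]
        by (simp add: field_simps)
      also have "\<dots> = ?e m \<bullet> (?h *v ?Y)"
        unfolding matvec.add_right inner_add_right inner_christoffel[OF hd inv_h[OF maps[OF x]]] ..
      finally show ?thesis .
    qed
    then have "axis m 1 \<bullet> (transpose (J x) *v (?h *v ?X)) = axis m 1 \<bullet> (transpose (J x) *v (?h *v ?Y))" for m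
      by (simp only: axis_inner_transpose_J)
    then have "transpose (J x) *v (?h *v ?X) = transpose (J x) *v (?h *v ?Y)"
      by (simp add: vec_eq_iff inner_axis' del: transpose_matrix_vector)
    then have "(transpose (J x) ** ?h) *v ?X = (transpose (J x) ** ?h) *v ?Y"
      by (simp only: matrix_vector_mul_assoc[of "transpose (J x)" ?h])
    moreover have "invertible (transpose (J x) ** ?h)"
      by (intro invertible_mult transpose_invertible inv_J inv_h maps x)
    ultimately show "?X = ?Y"
      using invertible_mult_eq by blast
  qed
  have "(J x ** \<Gamma> i x) *v axis j 1 = (partial i J x + \<Omega> i x ** J x) *v axis j 1" for j
  proof -
    have "partial i J x *v axis j 1 = ?H i j"
      by (simp add: vec_eq_iff matrix_vector_mult_def axis_def if_distrib partial_J[OF x] cong: if_cong)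
    moreover have "(\<Omega> i x ** J x) *v axis j 1 = \<Omega> i x *v ?e j"
      by (simp only: matrix_vector_mul_assoc[symmetric] J_axis)
    moreover have "\<Omega> i x *v ?e j = (\<Sum>b\<in>UNIV. ?e i $ b *\<^sub>R (\<Gamma>' b (\<Phi> x) *v ?e j))"
      by (simp add: \<Omega>_def matvec.sum_left matvec.scaleR_left jacobian_def)
    ultimately show ?thesis
      using col[of j] by (simp only: matvec.add_left matrix_vector_mul_assoc[symmetric])
  qed
  then have "column j (J x ** \<Gamma> i x) = column j (partial i J x + \<Omega> i x ** J x)" for j
    by (simp add: matrix_vector_mul_component column_def vec_eq_iff matrix_vector_mult_def axis_def if_distrib cong: if_cong)
  then show ?thesis
    by (simp add: vec_eq_iff column_def)
qed

end

section \<open>Ricci and scalar curvature under pullback\<close>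

definition ricci_matrix :: "(real^'n \<Rightarrow> real^'n^'n) \<Rightarrow> real^'n \<Rightarrow> real^'n^'n" where
  "ricci_matrix g x = (\<chi> j k. \<Sum>i\<in>UNIV. curvature_matrix g i j x $ i $ k)"

text \<open>In the form of a trace the scalar curvature is open to cyclic permutation of matrix
  factors.\<close>

lemma scalar_curvature_eq_trace:
  assumes "\<And>i. christoffel_matrix g i differentiable at x"
  shows "scalar_curvature g x = trace (transpose (matrix_inv (g x)) ** ricci_matrix g x)"
proof -
  have "trace (transpose (matrix_inv (g x)) ** ricci_matrix g x)
      = (\<Sum>j\<in>UNIV. \<Sum>k\<in>UNIV. matrix_inv (g x) $ k $ j * ricci_matrix g x $ k $ j)"
    by (simp add: trace_def matrix_matrix_mult_def transpose_def)
  also have "\<dots> = (\<Sum>k\<in>UNIV. \<Sum>j\<in>UNIV. matrix_inv (g x) $ k $ j * ricci_matrix g x $ k $ j)"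
    by (rule sum.swap)
  finally show ?thesis
    by (simp add: scalar_curvature_def ricci_curvature_def riemann_curvature_eq[OF assms] ricci_matrix_def)
qed

context metric_pullback
begin

lemma partial_\<Omega>:
  assumes x: "x \<in> S"
  shows "partial p (\<Omega> i) x = (\<Sum>b\<in>UNIV. partial p J x $ b $ i *\<^sub>R \<Gamma>' b (\<Phi> x))
    + (\<Sum>d\<in>UNIV. \<Sum>b\<in>UNIV. (J x $ d $ p * J x $ b $ i) *\<^sub>R partial d (\<Gamma>' b) (\<Phi> x))"
proof -
  have d1: "(\<lambda>x. J x $ b $ i) differentiable at x" for b i
    by (rule smooth_on_imp_differentiable[OF smooth_on_vec_nth[OF open_S smooth_on_vec_nth[OF open_S smooth_J]] x])
  have d2: "(\<lambda>x. \<Gamma>' b (\<Phi> x)) differentiable at x" for b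
    by (rule smooth_on_imp_differentiable[OF smooth_on_compose_\<Phi>[OF smooth_\<Gamma>'] x])
  have d3: "(\<lambda>x. J x $ b $ i *\<^sub>R \<Gamma>' b (\<Phi> x)) differentiable at x" for b
    by (rule smooth_on_imp_differentiable[OF smooth_on_scaleR[OF open_S
          smooth_on_vec_nth[OF open_S smooth_on_vec_nth[OF open_S smooth_J]] smooth_on_compose_\<Phi>[OF smooth_\<Gamma>']] x])
  have c: "partial p (\<lambda>x. \<Gamma>' b (\<Phi> x)) x = (\<Sum>d\<in>UNIV. J x $ d $ p *\<^sub>R partial d (\<Gamma>' b) (\<Phi> x))" for b
    using partial_compose[OF smooth_on_imp_differentiable[OF smooth_\<Phi> x]
        smooth_on_imp_differentiable[OF smooth_\<Gamma>' maps[OF x]], of p b]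
    by (simp add: jacobian_def)
  have "partial p (\<Omega> i) x = (\<Sum>b\<in>UNIV. partial p (\<lambda>x. J x $ b $ i *\<^sub>R \<Gamma>' b (\<Phi> x)) x)"
    unfolding \<Omega>_def[abs_def] by (rule partial_sum[OF d3])
  also have "\<dots> = (\<Sum>b\<in>UNIV. partial p J x $ b $ i *\<^sub>R \<Gamma>' b (\<Phi> x)
      + J x $ b $ i *\<^sub>R (\<Sum>d\<in>UNIV. J x $ d $ p *\<^sub>R partial d (\<Gamma>' b) (\<Phi> x)))"
    by (simp add: partial_scaleR[OF d1 d2] c partial_vec_nth2[OF smooth_on_imp_differentiable[OF smooth_J x]])
  also have "\<dots> = (\<Sum>b\<in>UNIV. partial p J x $ b $ i *\<^sub>R \<Gamma>' b (\<Phi> x))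
     + (\<Sum>b\<in>UNIV. \<Sum>d\<in>UNIV. (J x $ d $ p * J x $ b $ i) *\<^sub>R partial d (\<Gamma>' b) (\<Phi> x))"
    by (simp add: sum.distrib scaleR_sum_right mult.commute)
  also have "(\<Sum>b\<in>UNIV. \<Sum>d\<in>UNIV. (J x $ d $ p * J x $ b $ i) *\<^sub>R partial d (\<Gamma>' b) (\<Phi> x))
     = (\<Sum>d\<in>UNIV. \<Sum>b\<in>UNIV. (J x $ d $ p * J x $ b $ i) *\<^sub>R partial d (\<Gamma>' b) (\<Phi> x))"
    by (rule sum.swap)
  finally show ?thesis .
qed

text \<open>Pullback of forms commutes with \<open>d\<close> and with the wedge product: the terms
  with derivatives of \<open>J\<close> drop out because the second derivatives of \<Phi> are
  symmetric.\<close>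

lemma \<Omega>_curvature:
  assumes x: "x \<in> S"
  shows "partial p (\<Omega> i) x - partial i (\<Omega> p) x + \<Omega> p x ** \<Omega> i x - \<Omega> i x ** \<Omega> p x
    = (\<Sum>d\<in>UNIV. \<Sum>b\<in>UNIV. (J x $ d $ p * J x $ b $ i) *\<^sub>R curvature_matrix h d b (\<Phi> x))"
proof -
  let ?y = "\<Phi> x"
  have sym: "partial p J x $ b $ i = partial i J x $ b $ p" for b
    by (simp add: partial_J[OF x] partial_commute_vec[OF smooth_\<Phi> x, of p i])
  have 1: "(\<Sum>d\<in>UNIV. \<Sum>b\<in>UNIV. (J x $ d $ i * J x $ b $ p) *\<^sub>R F d b)
     = (\<Sum>d\<in>UNIV. \<Sum>b\<in>UNIV. (J x $ d $ p * J x $ b $ i) *\<^sub>R F b d)" for F :: "'n \<Rightarrow> 'n \<Rightarrow> real^'n^'n"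
    by (subst sum.swap) (simp add: mult.commute)
  have 2: "\<Omega> p x ** \<Omega> i x = (\<Sum>d\<in>UNIV. \<Sum>b\<in>UNIV. (J x $ d $ p * J x $ b $ i) *\<^sub>R (\<Gamma>' d ?y ** \<Gamma>' b ?y))" for p i
    unfolding \<Omega>_def matmul.sum_left matmul.sum_right
    by (subst sum.swap) (simp add: matmul.scaleR_left matmul.scaleR_right mult.commute)
  have "partial p (\<Omega> i) x - partial i (\<Omega> p) x + \<Omega> p x ** \<Omega> i x - \<Omega> i x ** \<Omega> p x
    = (\<Sum>d\<in>UNIV. \<Sum>b\<in>UNIV. (J x $ d $ p * J x $ b $ i) *\<^sub>R partial d (\<Gamma>' b) ?y)
    - (\<Sum>d\<in>UNIV. \<Sum>b\<in>UNIV. (J x $ d $ p * J x $ b $ i) *\<^sub>R partial b (\<Gamma>' d) ?y)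
    + (\<Sum>d\<in>UNIV. \<Sum>b\<in>UNIV. (J x $ d $ p * J x $ b $ i) *\<^sub>R (\<Gamma>' d ?y ** \<Gamma>' b ?y))
    - (\<Sum>d\<in>UNIV. \<Sum>b\<in>UNIV. (J x $ d $ p * J x $ b $ i) *\<^sub>R (\<Gamma>' b ?y ** \<Gamma>' d ?y))"
    unfolding partial_\<Omega>[OF x] 2 sym
    unfolding 1[of "\<lambda>d b. partial d (\<Gamma>' b) ?y"] 1[of "\<lambda>d b. \<Gamma>' d ?y ** \<Gamma>' b ?y"]
    by simp
  also have "\<dots> = (\<Sum>d\<in>UNIV. \<Sum>b\<in>UNIV. (J x $ d $ p * J x $ b $ i) *\<^sub>R curvature_matrix h d b ?y)"
    by (simp add: curvature_matrix_def scaleR_add_right scaleR_diff_right sum.distrib sum_subtractf)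
  finally show ?thesis .
qed

text \<open>Differentiate \<open>gauge\<close> and antisymmetrise in \<open>p\<close> and
  \<open>i\<close>. The second derivatives of \<open>J\<close> cancel, its first derivatives are
  eliminated by \<open>gauge\<close> itself, and what remains is the curvature of
  \<open>\<Omega>\<close>.\<close>

lemma curvature_gauge:
  assumes x: "x \<in> S"
  shows "J x ** curvature_matrix G p i x
    = (\<Sum>d\<in>UNIV. \<Sum>b\<in>UNIV. (J x $ d $ p * J x $ b $ i) *\<^sub>R curvature_matrix h d b (\<Phi> x)) ** J x"
proof -
  have dJ: "J differentiable at x" by (rule smooth_on_imp_differentiable[OF smooth_J x])
  have dP: "partial i J differentiable at x" for i
    by (rule smooth_on_imp_differentiable[OF smooth_on_partial[OF smooth_J] x])
  have d\<Gamma>: "\<Gamma> i differentiable at x" for i by (rule smooth_on_imp_differentiable[OF smooth_\<Gamma> x])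
  have d\<Omega>: "\<Omega> i differentiable at x" for i by (rule smooth_on_imp_differentiable[OF smooth_\<Omega> x])
  have d1: "(\<lambda>x. J x ** \<Gamma> i x) differentiable at x" for i
    by (rule smooth_on_imp_differentiable[OF smooth_on_matrix_mult[OF open_S smooth_J smooth_\<Gamma>] x])
  have d2: "(\<lambda>x. \<Omega> i x ** J x) differentiable at x" for i
    by (rule smooth_on_imp_differentiable[OF smooth_on_matrix_mult[OF open_S smooth_\<Omega> smooth_J] x])
  have E: "partial p J x ** \<Gamma> i x + J x ** partial p (\<Gamma> i) x
      = partial p (partial i J) x + (partial p (\<Omega> i) x ** J x + \<Omega> i x ** partial p J x)" for p i
  proof -
    have "partial p J x ** \<Gamma> i x + J x ** partial p (\<Gamma> i) x = partial p (\<lambda>x. J x ** \<Gamma> i x) x"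
      by (rule partial_bilinear[OF bounded_bilinear_matrix_mult dJ d\<Gamma>, symmetric])
    also have "\<dots> = partial p (\<lambda>x. partial i J x + \<Omega> i x ** J x) x"
      by (rule partial_cong[OF open_S x gauge d1])
    also have "\<dots> = partial p (partial i J) x + partial p (\<lambda>x. \<Omega> i x ** J x) x"
      by (rule partial_add[OF dP d2])
    also have "partial p (\<lambda>x. \<Omega> i x ** J x) x = partial p (\<Omega> i) x ** J x + \<Omega> i x ** partial p J x"
      by (rule partial_bilinear[OF bounded_bilinear_matrix_mult d\<Omega> dJ])
    finally show ?thesis .
  qed
  have P: "partial i J x = J x ** \<Gamma> i x - \<Omega> i x ** J x" for i
    using gauge[OF x, of i] by simp
  have "partial p (partial i J) x = partial i (partial p J) x"
  proof -
    have nth: "partial p (partial i J) x $ a = partial p (partial i (\<lambda>x. J x $ a)) x" for p i a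
    proof -
      have "partial p (partial i J) x $ a = partial p (\<lambda>x. partial i J x $ a) x"
        by (rule partial_vec_nth[OF dP, symmetric])
      also have "\<dots> = partial p (partial i (\<lambda>x. J x $ a)) x"
        by (rule partial_cong[OF open_S x])
          (auto intro: partial_vec_nth[symmetric] smooth_on_imp_differentiable smooth_J
            smooth_on_imp_differentiable[OF smooth_on_vec_nth[OF open_S smooth_on_partial[OF smooth_J]] x])
      finally show ?thesis .
    qed
    show ?thesis
      unfolding vec_eq_iff[where x = "partial p (partial i J) x"] nth
      using partial_commute_vec[OF smooth_on_vec_nth[OF open_S smooth_J] x] by blast
  qed
  then have comm: "partial p (partial i J) x - partial i (partial p J) x = 0" by simp
  have "J x ** curvature_matrix G p i x
     = J x ** partial p (\<Gamma> i) x - J x ** partial i (\<Gamma> p) x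
       + J x ** (\<Gamma> p x ** \<Gamma> i x) - J x ** (\<Gamma> i x ** \<Gamma> p x)"
    by (simp add: curvature_matrix_def matmul.add_right matmul.diff_right)
  also have "J x ** partial p (\<Gamma> i) x
      = partial p (partial i J) x + (partial p (\<Omega> i) x ** J x + \<Omega> i x ** partial p J x) - partial p J x ** \<Gamma> i x"
    using E[of p i] by (simp add: algebra_simps)
  also have "J x ** partial i (\<Gamma> p) x
      = partial i (partial p J) x + (partial i (\<Omega> p) x ** J x + \<Omega> p x ** partial i J x) - partial i J x ** \<Gamma> p x"
    using E[of i p] by (simp add: algebra_simps)
  also have "partial p (partial i J) x + (partial p (\<Omega> i) x ** J x + \<Omega> i x ** partial p J x) - partial p J x ** \<Gamma> i x
       - (partial i (partial p J) x + (partial i (\<Omega> p) x ** J x + \<Omega> p x ** partial i J x) - partial i J x ** \<Gamma> p x)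
       + J x ** (\<Gamma> p x ** \<Gamma> i x) - J x ** (\<Gamma> i x ** \<Gamma> p x)
     = (partial p (partial i J) x - partial i (partial p J) x)
       + (partial p (\<Omega> i) x - partial i (\<Omega> p) x + \<Omega> p x ** \<Omega> i x - \<Omega> i x ** \<Omega> p x) ** J x"
    unfolding P[of p] P[of i]
    by (simp add: matmul.add_left matmul.diff_left matmul.add_right matmul.diff_right matrix_mul_assoc)
  finally show ?thesis
    unfolding comm \<Omega>_curvature[OF x] by simp
qed

text \<open>The Ricci trace pairs the upper index, which carries the inverse of \<open>J\<close>,
  with the first form index, which carries \<open>J\<close>. These contract to the identity, and one
  factor \<open>J\<close> is left for each free index.\<close>

lemma ricci_pullback:
  assumes x: "x \<in> S"
  shows "ricci_matrix G x = transpose (J x) ** ricci_matrix h (\<Phi> x) ** J x"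
proof -
  let ?K = "matrix_inv (J x)" and ?y = "\<Phi> x"
  have JK: "J x ** ?K = mat 1" and KJ: "?K ** J x = mat 1"
    using invertible_matrix_inv[OF inv_J[OF x]] by auto
  have C: "curvature_matrix G p j x
      = (\<Sum>d\<in>UNIV. \<Sum>b\<in>UNIV. (J x $ d $ p * J x $ b $ j) *\<^sub>R (?K ** (curvature_matrix h d b ?y ** J x)))" for p j
  proof -
    have "curvature_matrix G p j x = ?K ** (J x ** curvature_matrix G p j x)"
      by (simp only: matrix_mul_assoc KJ matrix_mul_lid)
    also have "\<dots> = (\<Sum>d\<in>UNIV. \<Sum>b\<in>UNIV. (J x $ d $ p * J x $ b $ j) *\<^sub>R (?K ** (curvature_matrix h d b ?y ** J x)))"
      unfolding curvature_gauge[OF x]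
      by (simp add: matmul.sum_left matmul.sum_right matmul.scaleR_left matmul.scaleR_right)
    finally show ?thesis .
  qed
  have "ricci_matrix G x $ j $ k = (transpose (J x) ** ricci_matrix h ?y ** J x) $ j $ k" for j k
  proof -
    have "ricci_matrix G x $ j $ k
      = (\<Sum>p\<in>UNIV. \<Sum>d\<in>UNIV. \<Sum>b\<in>UNIV. J x $ b $ j * (J x $ d $ p * (?K ** (curvature_matrix h d b ?y ** J x)) $ p $ k))"
      by (simp add: ricci_matrix_def C mult_ac)
    also have "\<dots> = (\<Sum>d\<in>UNIV. \<Sum>p\<in>UNIV. \<Sum>b\<in>UNIV. J x $ b $ j * (J x $ d $ p * (?K ** (curvature_matrix h d b ?y ** J x)) $ p $ k))"
      by (rule sum.swap)
    also have "\<dots> = (\<Sum>d\<in>UNIV. \<Sum>b\<in>UNIV. \<Sum>p\<in>UNIV. J x $ b $ j * (J x $ d $ p * (?K ** (curvature_matrix h d b ?y ** J x)) $ p $ k))"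
      by (intro sum.cong refl sum.swap)
    also have "\<dots> = (\<Sum>d\<in>UNIV. \<Sum>b\<in>UNIV. J x $ b $ j * (J x ** (?K ** (curvature_matrix h d b ?y ** J x))) $ d $ k)"
      by (simp add: matrix_matrix_mult_def[of "J x"] sum_distrib_left)
    also have "\<dots> = (\<Sum>d\<in>UNIV. \<Sum>b\<in>UNIV. J x $ b $ j * (curvature_matrix h d b ?y ** J x) $ d $ k)"
      by (simp add: matrix_mul_assoc JK)
    also have "\<dots> = (\<Sum>b\<in>UNIV. \<Sum>d\<in>UNIV. J x $ b $ j * (curvature_matrix h d b ?y ** J x) $ d $ k)"
      by (rule sum.swap)
    also have "\<dots> = (\<Sum>b\<in>UNIV. J x $ b $ j * (ricci_matrix h ?y ** J x) $ b $ k)"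
    proof (rule sum.cong[OF refl])
      fix b
      have "(ricci_matrix h ?y ** J x) $ b $ k = (\<Sum>d\<in>UNIV. (curvature_matrix h d b ?y ** J x) $ d $ k)"
        unfolding matrix_matrix_mult_def ricci_matrix_def
        by (simp add: sum_distrib_right) (rule sum.swap)
      then show "(\<Sum>d\<in>UNIV. J x $ b $ j * (curvature_matrix h d b ?y ** J x) $ d $ k) = J x $ b $ j * (ricci_matrix h ?y ** J x) $ b $ k"
        by (simp add: sum_distrib_left)
    qed
    also have "\<dots> = (transpose (J x) ** (ricci_matrix h ?y ** J x)) $ j $ k"
      unfolding matrix_matrix_mult_def[of "transpose (J x)"] by (simp add: transpose_def)
    finally show ?thesis by (simp add: matrix_mul_assoc)
  qed
  then show ?thesis by (simp add: vec_eq_iff)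
qed

text \<open>The inverse of \<open>G\<close> carries the inverse Jacobian on both sides. Under the
  trace these factors cancel the two Jacobians of \<open>ricci_pullback\<close>.\<close>

theorem scalar_curvature_pullback:
  assumes x: "x \<in> S"
  shows "scalar_curvature G x = scalar_curvature h (\<Phi> x)"
proof -
  let ?K = "matrix_inv (J x)" and ?y = "\<Phi> x" and ?L = "matrix_inv (h (\<Phi> x))"
  have JK: "J x ** ?K = mat 1" and KJ: "?K ** J x = mat 1"
    using invertible_matrix_inv[OF inv_J[OF x]] by auto
  have hL: "h ?y ** ?L = mat 1" and Lh: "?L ** h ?y = mat 1"
    using invertible_matrix_inv[OF inv_h[OF maps[OF x]]] by auto
  have tJK: "transpose ?K ** transpose (J x) = mat 1" "transpose (J x) ** transpose ?K = mat 1"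
    by (simp_all add: matrix_transpose_mul[symmetric] JK KJ)
  have inv: "matrix_inv (G x) = ?K ** ?L ** transpose ?K"
  proof (rule matrix_inv_unique)
    have "G x ** (?K ** ?L ** transpose ?K) = transpose (J x) ** h ?y ** (J x ** ?K) ** ?L ** transpose ?K"
      by (simp only: pullback_metric_def matrix_mul_assoc)
    also have "\<dots> = transpose (J x) ** (h ?y ** ?L) ** transpose ?K"
      by (simp only: JK matrix_mul_rid matrix_mul_assoc)
    finally show "G x ** (?K ** ?L ** transpose ?K) = mat 1"
      by (simp add: hL tJK)
    have "(?K ** ?L ** transpose ?K) ** G x = ?K ** ?L ** (transpose ?K ** transpose (J x)) ** h ?y ** J x"
      by (simp only: pullback_metric_def matrix_mul_assoc)
    also have "\<dots> = ?K ** (?L ** h ?y) ** J x"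
      by (simp only: tJK matrix_mul_rid matrix_mul_assoc)
    finally show "(?K ** ?L ** transpose ?K) ** G x = mat 1"
      by (simp add: Lh KJ)
  qed
  have "scalar_curvature G x = trace (transpose (matrix_inv (G x)) ** ricci_matrix G x)"
    by (rule scalar_curvature_eq_trace, rule smooth_on_imp_differentiable[OF smooth_\<Gamma> x])
  also have "\<dots> = trace (?K ** (transpose ?L ** transpose ?K ** transpose (J x) ** ricci_matrix h ?y ** J x))"
    by (simp only: inv ricci_pullback[OF x] matrix_transpose_mul transpose_transpose matrix_mul_assoc)
  also have "\<dots> = trace ((transpose ?L ** transpose ?K ** transpose (J x) ** ricci_matrix h ?y ** J x) ** ?K)"
    by (rule trace_mul_sym)
  also have "(transpose ?L ** transpose ?K ** transpose (J x) ** ricci_matrix h ?y ** J x) ** ?K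
      = transpose ?L ** (transpose ?K ** transpose (J x)) ** ricci_matrix h ?y ** (J x ** ?K)"
    by (simp only: matrix_mul_assoc)
  also have "\<dots> = transpose ?L ** ricci_matrix h ?y"
    by (simp only: tJK JK matrix_mul_rid)
  also have "trace \<dots> = scalar_curvature h ?y"
    by (rule scalar_curvature_eq_trace[symmetric], rule smooth_on_imp_differentiable[OF smooth_\<Gamma>' maps[OF x]])
  finally show ?thesis .
qed

end

section \<open>Conformally flat metrics and bubbles\<close>

lemma mat_eq_scaleR: "mat c = c *\<^sub>R (mat 1 :: real^'n^'n)"
  by (simp add: mat_def vec_eq_iff)

lemma matrix_inv_mat: "c \<noteq> 0 \<Longrightarrow> matrix_inv (mat c :: real^'n^'n) = mat (1 / c)"
  by (rule matrix_inv_unique) (simp_all add: mat_eq_scaleR[of c] mat_eq_scaleR[of "1 / c"]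
      matmul.scaleR_left matmul.scaleR_right)

lemma smooth_on_mat:
  assumes "open S" "smooth_on S f"
  shows "smooth_on S (\<lambda>y. mat (f y) :: real^'n^'n)"
proof (rule smooth_on_vecI[OF assms(1)], rule smooth_on_vecI[OF assms(1)])
  fix i j :: 'n
  show "smooth_on S (\<lambda>y. (mat (f y) :: real^'n^'n) $ i $ j)"
    using assms(2) by (cases "i = j") (auto simp: mat_def smooth_on_const)
qed

lemma partial_chain_real:
  fixes g :: "real^'n \<Rightarrow> real"
  assumes "(F has_real_derivative D) (at (g x))" "g differentiable at x"
  shows "partial i (\<lambda>x. F (g x)) x = D * partial i g x"
  using partial_eqI[OF has_derivative_compose[OF differentiable_has_frechet_derivative[OF assms(2)]
        assms(1)[unfolded has_field_derivative_def]]]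
  by (simp add: partial_def)

text \<open>For a conformal factor \<open>exp (2 * \<phi>)\<close> in dimension 3 the curvature is
  \<open>exp (- 2 * \<phi>)\<close> times \<open>- 4 \<Delta>\<phi> - 2 |\<nabla>\<phi>|^2\<close>.
  The exponent 4, that is \<open>\<phi> = 2 * ln u\<close>, is the one for which the gradient terms
  cancel.\<close>

lemma scalar_curvature_conformal:
  fixes u :: "real^3 \<Rightarrow> real"
  assumes S: "open S" "y \<in> S" and u: "smooth_on S u" "\<And>y. y \<in> S \<Longrightarrow> u y > 0"
  shows "scalar_curvature (\<lambda>y. mat (u y ^ 4)) y = - 8 * (\<Sum>a\<in>UNIV. partial a (partial a u) y) / u y ^ 5"
proof -
  let ?h = "\<lambda>y. mat (u y ^ 4) :: real^3^3"
  \<comment> \<open>The partial derivatives of \<open>2 * ln u\<close>, half the logarithm of the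
    conformal factor.\<close>
  define f where "f a y = 2 * (partial a u y / u y)" for a y
  have du: "u differentiable at y" if "y \<in> S" for y
    by (rule smooth_on_imp_differentiable[OF u(1) that])
  have sf: "smooth_on S (f a)" for a
    unfolding f_def using u(2)
    by (intro smooth_on_mult smooth_on_divide smooth_on_const smooth_on_partial S u(1)) (auto simp: less_imp_neq[symmetric])
  have df: "f a differentiable at y" for a
    by (rule smooth_on_imp_differentiable[OF sf S(2)])
  have ph: "partial i (\<lambda>y. ?h y $ j $ m) y = (if j = m then 4 * u y ^ 3 * partial i u y else 0)"
    if "y \<in> S" for i j m y
  proof (cases "j = m")
    case True
    have "partial i (\<lambda>y. u y ^ 4) y = 4 * u y ^ 3 * partial i u y"
      by (rule partial_chain_real[OF _ du[OF that]]) (auto intro!: derivative_eq_intros)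
    then show ?thesis using True by (simp add: mat_def)
  qed (simp add: mat_def partial_const)
  have chr: "christoffel ?h l i j y = (if j = l then f i y else 0) + (if i = l then f j y else 0) - (if i = j then f l y else 0)"
    if y: "y \<in> S" for l i j y
  proof -
    have "christoffel ?h l i j y = 1 / 2 * (1 / u y ^ 4 * (partial i (\<lambda>y. ?h y $ j $ l) y
        + partial j (\<lambda>y. ?h y $ i $ l) y - partial l (\<lambda>y. ?h y $ i $ j) y))"
      using u(2)[OF y] unfolding christoffel_def partial_deriv_eq_partial
      by (subst matrix_inv_mat) (auto simp: mat_def if_distribR if_distrib[of "\<lambda>t. t * _"] cong: if_cong)
    also have "\<dots> = (if j = l then f i y else 0) + (if i = l then f j y else 0) - (if i = j then f l y else 0)"
      unfolding ph[OF y] f_def using u(2)[OF y] by (simp add: eval_nat_numeral field_simps)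
    finally show ?thesis .
  qed
  have pchr: "partial p (christoffel ?h l i j) y
      = (if j = l then partial p (f i) y else 0) + (if i = l then partial p (f j) y else 0) - (if i = j then partial p (f l) y else 0)"
    for p l i j
  proof -
    have s: "smooth_on S (\<lambda>y. if P then f a y else 0)" for P a
      by (cases P) (auto simp: sf smooth_on_const)
    have d: "(\<lambda>y. if P then f a y else 0) differentiable at y" for P a
      by (rule smooth_on_imp_differentiable[OF s S(2)])
    have pi: "partial p (\<lambda>y. if P then f a y else 0) y = (if P then partial p (f a) y else 0)" for P a
      by (cases P) (auto simp: partial_const)
    have "partial p (christoffel ?h l i j) y
      = partial p (\<lambda>y. (if j = l then f i y else 0) + (if i = l then f j y else 0) - (if i = j then f l y else 0)) y"
      by (rule partial_cong[symmetric, OF S])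
        (auto simp: chr intro!: differentiable_add differentiable_diff d)
    then show ?thesis
      by (simp add: partial_diff partial_add d differentiable_add pi)
  qed
  have "scalar_curvature ?h y = (\<Sum>j\<in>UNIV. 1 / u y ^ 4 * ricci_curvature ?h j j y)"
    using u(2)[OF S(2)] unfolding scalar_curvature_def
    by (subst matrix_inv_mat) (auto simp: mat_def if_distribR if_distrib[of "\<lambda>t. t * _"] cong: if_cong)
  also have "\<dots> = 1 / u y ^ 4 * (- 4 * (\<Sum>a\<in>UNIV. partial a (f a) y) - 2 * (\<Sum>a\<in>UNIV. (f a y)\<^sup>2))"
    by (simp add: ricci_curvature_def riemann_curvature_def partial_deriv_eq_partial pchr chr[OF S(2)] sum_3
        power2_eq_square algebra_simps)
  also have "\<dots> = 1 / u y ^ 4 * (- 8 * (\<Sum>a\<in>UNIV. partial a (partial a u) y) / u y)"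
  proof -
    have pf: "partial a (f a) y = 2 * (partial a (partial a u) y / u y - (partial a u y)\<^sup>2 / (u y)\<^sup>2)" for a
    proof -
      have d: "partial a u differentiable at y" "(\<lambda>y. inverse (u y)) differentiable at y"
        using smooth_on_imp_differentiable[OF smooth_on_partial[OF u(1)] S(2)]
          smooth_on_imp_differentiable[OF smooth_on_divide[OF S(1) smooth_on_const[of _ 1] u(1)] S(2)] u(2)
        by (auto simp: less_imp_neq[symmetric] divide_inverse)
      have pinv: "partial a (\<lambda>y. inverse (u y)) y = - (inverse (u y) ^ 2) * partial a u y"
        using u(2)[OF S(2)]
        by (intro partial_chain_real[OF _ du[OF S(2)]]) (auto intro!: derivative_eq_intros simp: power2_eq_square)
      have "partial a (f a) y = partial a (\<lambda>y. 2 * (partial a u y * inverse (u y))) y"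
        by (simp add: f_def[abs_def] divide_inverse)
      also have "\<dots> = 2 * partial a (\<lambda>y. partial a u y * inverse (u y)) y"
        using d by (intro partial_linear[OF bounded_linear_mult_right]) auto
      also have "\<dots> = 2 * (partial a (partial a u) y * inverse (u y) + partial a u y * (- (inverse (u y) ^ 2) * partial a u y))"
        by (simp add: partial_mult[OF d] pinv)
      finally show ?thesis
        by (simp add: divide_inverse power2_eq_square algebra_simps)
    qed
    show ?thesis
      unfolding pf unfolding f_def sum_3
      using u(2)[OF S(2)] by (simp add: field_simps power2_eq_square)
  qed
  also have "\<dots> = - 8 * (\<Sum>a\<in>UNIV. partial a (partial a u) y) / u y ^ 5"
    by (simp add: field_simps eval_nat_numeral)
  finally show ?thesis .
qed

text \<open>The metric \<open>bubble p s ^ 4 \<delta>\<close> is a round sphere in stereographic coordinates.\<close>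

definition bubble :: "real^'n \<Rightarrow> real \<Rightarrow> real^'n \<Rightarrow> real" where
  "bubble p s y = ((y - p) \<bullet> (y - p) + s\<^sup>2) powr (- 1 / 2)"

lemma bubble_denom_pos: "s \<noteq> 0 \<Longrightarrow> (y - p) \<bullet> (y - p) + s\<^sup>2 > 0"
  by (simp add: add_nonneg_pos)

lemma bubble_eq: "s \<noteq> 0 \<Longrightarrow> bubble p s y = 1 / sqrt ((norm (y - p))\<^sup>2 + s\<^sup>2)"
  using bubble_denom_pos[of s y p]
  by (simp add: bubble_def powr_minus_divide powr_half_sqrt power2_norm_eq_inner)

lemma bubble_pos: "s \<noteq> 0 \<Longrightarrow> bubble p s y > 0"
  using bubble_denom_pos[of s y p] by (simp add: bubble_def)

lemma smooth_on_sq_dist: "smooth_on UNIV (\<lambda>y::real^'n. (y - p) \<bullet> (y - p) + c)"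
proof -
  have "smooth_on UNIV (\<lambda>y::real^'n. (\<Sum>i\<in>UNIV. (y $ i - p $ i) * (y $ i - p $ i)) + c)"
    by (intro smooth_on_add smooth_on_sum smooth_on_mult smooth_on_diff smooth_on_const
        smooth_on_bounded_linear bounded_linear_vec_nth open_UNIV)
  then show ?thesis by (simp add: inner_vec_def)
qed

lemma smooth_on_bubble: "s \<noteq> 0 \<Longrightarrow> smooth_on UNIV (bubble p s)"
  unfolding bubble_def[abs_def] by (intro smooth_on_powr smooth_on_sq_dist bubble_denom_pos open_UNIV)

text \<open>With \<open>Q = |y - p|^2 + s^2\<close> the Laplacian is
  \<open>- 3 Q powr (- 3 / 2) + 3 |y - p|^2 Q powr (- 5 / 2)\<close>. In dimension 3 the parts with
  \<open>|y - p|^2\<close> cancel, as they must because \<open>1 / |y - p|\<close> is harmonic, and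
  the part with \<open>s^2\<close> remains.\<close>

lemma laplacian_bubble:
  fixes p :: "real^3"
  assumes s: "s \<noteq> 0"
  shows "(\<Sum>i\<in>UNIV. partial i (partial i (bubble p s)) y) = - 3 * s\<^sup>2 * bubble p s y ^ 5"
proof -
  define Q where "Q = (\<lambda>y::real^3. (y - p) \<bullet> (y - p) + s\<^sup>2)"
  have Q: "Q y > 0" for y unfolding Q_def by (rule bubble_denom_pos[OF s])
  have dQ: "Q differentiable at y" for y
    unfolding Q_def by (rule smooth_on_imp_differentiable[OF smooth_on_sq_dist]) simp
  have pQ: "partial i Q y = 2 * (y $ i - p $ i)" for i y
  proof -
    have "(Q has_derivative (\<lambda>v. 2 * ((y - p) \<bullet> v))) (at y)"
      unfolding Q_def by (auto intro!: derivative_eq_intros simp: inner_commute algebra_simps)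
    then show ?thesis by (auto dest!: partial_eqI[where i = i] simp: inner_axis)
  qed
  have pw: "partial i (\<lambda>y. Q y powr a) y = (2 * a) * ((y $ i - p $ i) * Q y powr (a - 1))" for i a y
    using partial_chain_real[OF has_real_derivative_powr[OF Q] dQ] by (simp add: pQ)
  have dpw: "(\<lambda>y. Q y powr a) differentiable at y" for a y
    using smooth_on_imp_differentiable[OF smooth_on_powr[OF open_UNIV smooth_on_sq_dist bubble_denom_pos[OF s]]]
    unfolding Q_def by blast
  have bQ: "bubble p s = (\<lambda>y. Q y powr (- 1 / 2))"
    by (simp add: fun_eq_iff bubble_def Q_def)
  have pb: "partial i (bubble p s) = (\<lambda>y. - ((y $ i - p $ i) * Q y powr (- 3 / 2)))" for i
    unfolding bQ by (simp add: fun_eq_iff pw)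
  have d1: "(\<lambda>y::real^3. - (y $ i - p $ i)) differentiable at y"
    and p1: "partial i (\<lambda>y::real^3. - (y $ i - p $ i)) y = - 1" for i
  proof -
    have D: "((\<lambda>y::real^3. - (y $ i - p $ i)) has_derivative (\<lambda>v. - (v $ i))) (at y)"
      by (auto intro!: derivative_eq_intros bounded_linear.has_derivative[OF bounded_linear_vec_nth])
    from D show "(\<lambda>y::real^3. - (y $ i - p $ i)) differentiable at y"
      unfolding differentiable_def by blast
    show "partial i (\<lambda>y::real^3. - (y $ i - p $ i)) y = - 1"
      using partial_eqI[OF D, of i] by (simp add: axis_def)
  qed
  have pp: "partial i (partial i (bubble p s)) y = - (Q y powr (- 3 / 2)) + 3 * (y $ i - p $ i)\<^sup>2 * Q y powr (- 5 / 2)" for i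
  proof -
    have "partial i (partial i (bubble p s)) y = partial i (\<lambda>y. - (y $ i - p $ i) * Q y powr (- 3 / 2)) y"
      unfolding pb by (simp only: mult_minus_left)
    also have "\<dots> = - 1 * Q y powr (- 3 / 2) + - (y $ i - p $ i) * ((2 * (- 3 / 2)) * ((y $ i - p $ i) * Q y powr (- 3 / 2 - 1)))"
      by (subst partial_mult[OF d1 dpw]) (simp only: p1 pw)
    finally show ?thesis by (simp add: power2_eq_square algebra_simps)
  qed
  have "(\<Sum>i\<in>UNIV. partial i (partial i (bubble p s)) y)
      = - 3 * Q y powr (- 3 / 2) + 3 * ((y - p) \<bullet> (y - p)) * Q y powr (- 5 / 2)"
    unfolding pp by (simp add: sum_3 inner_vec_def power2_eq_square algebra_simps)
  also have "Q y powr (- 3 / 2) = Q y * Q y powr (- 5 / 2)"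
    using Q[of y] powr_add[of "Q y" 1 "- 5 / 2"] by simp
  also have "- 3 * (Q y * Q y powr (- 5 / 2)) + 3 * ((y - p) \<bullet> (y - p)) * Q y powr (- 5 / 2)
      = - 3 * s\<^sup>2 * Q y powr (- 5 / 2)"
    by (simp add: Q_def algebra_simps)
  also have "Q y powr (- 5 / 2) = bubble p s y ^ 5"
    unfolding bQ using Q[of y] by (simp add: powr_power)
  finally show ?thesis .
qed

text \<open>A sphere of bounded size (the term at \<open>0\<close>) with a sphere of radius \<open>1/2\<close> attached
  near each point of \<open>I\<close> through a thin neck.\<close>

definition bubbles :: "(real^'n) set \<Rightarrow> real \<Rightarrow> real^'n \<Rightarrow> real" where
  "bubbles I s y = 1 / 10 * bubble 0 1 y + (\<Sum>p\<in>I. sqrt s * bubble p s y)"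

lemma smooth_on_bubbles: "s \<noteq> 0 \<Longrightarrow> smooth_on UNIV (bubbles I s)"
  unfolding bubbles_def[abs_def]
  by (intro smooth_on_add smooth_on_sum smooth_on_mult smooth_on_const smooth_on_bubble open_UNIV) auto

lemma bubbles_pos: "s > 0 \<Longrightarrow> bubbles I s y > 0"
  unfolding bubbles_def by (intro add_pos_nonneg sum_nonneg mult_pos_pos mult_nonneg_nonneg)
    (auto intro: less_imp_le bubble_pos)

text \<open>The Laplacian is linear, so the numerator is a plain sum over the spheres. The weight
  \<open>sqrt s\<close> turns the factor \<open>s\<^sup>2\<close> into a fifth power, so that a
  bubble by itself has curvature 24 for every \<open>s\<close>. The term at 0 keeps its weight 1/10
  to the first power only.\<close>

lemma scalar_curvature_bubbles:
  fixes I :: "(real^3) set"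
  assumes I: "finite I" and s: "s > 0"
  shows "scalar_curvature (\<lambda>y. mat (bubbles I s y ^ 4)) y
    = 24 * (1 / 10 * bubble 0 1 y ^ 5 + (\<Sum>p\<in>I. (sqrt s * bubble p s y) ^ 5)) / bubbles I s y ^ 5"
proof -
  have d: "bubble p t differentiable at y" "partial a (bubble p t) differentiable at y" if "t \<noteq> 0" for p :: "real^3" and t a y
    using that by (auto intro: smooth_on_imp_differentiable[of UNIV] smooth_on_bubble smooth_on_partial)
  have lin: "partial a (\<lambda>y. 1 / 10 * F y + (\<Sum>p\<in>I. sqrt s * H p y)) y
      = 1 / 10 * partial a F y + (\<Sum>p\<in>I. sqrt s * partial a (H p) y)"
    if "\<And>y. F differentiable at y" "\<And>y p. H p differentiable at y"
    for F :: "real^3 \<Rightarrow> real" and H a y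
  proof -
    show ?thesis
      using that I by (subst partial_add) (auto simp: partial_sum partial_linear[OF bounded_linear_mult_right] simp del: times_divide_eq_left)
  qed
  have "partial a (partial a (bubbles I s)) y
     = 1 / 10 * partial a (partial a (bubble 0 1)) y + (\<Sum>p\<in>I. sqrt s * partial a (partial a (bubble p s)) y)" for a
  proof -
    have "partial a (bubbles I s) = (\<lambda>y. 1 / 10 * partial a (bubble 0 1) y + (\<Sum>p\<in>I. sqrt s * partial a (bubble p s) y))"
      unfolding bubbles_def[abs_def] using s by (intro ext lin d) auto
    then show ?thesis using s by (simp only:) (intro lin d, auto)
  qed
  then have "(\<Sum>a\<in>UNIV. partial a (partial a (bubbles I s)) y)
      = 1 / 10 * (\<Sum>a\<in>UNIV. partial a (partial a (bubble 0 1)) y)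
        + (\<Sum>p\<in>I. sqrt s * (\<Sum>a\<in>UNIV. partial a (partial a (bubble p s)) y))"
    by (simp add: sum_3 sum.distrib algebra_simps)
  also have "\<dots> = 1 / 10 * (- 3 * bubble 0 1 y ^ 5) + (\<Sum>p\<in>I. sqrt s * (- 3 * s\<^sup>2 * bubble p s y ^ 5))"
    using s by (simp add: laplacian_bubble)
  also have "\<dots> = - 3 * (1 / 10 * bubble 0 1 y ^ 5 + (\<Sum>p\<in>I. (sqrt s * bubble p s y) ^ 5))"
  proof -
    have "sqrt s ^ 5 = sqrt s * s\<^sup>2"
      using s by (simp add: eval_nat_numeral)
    then have "sqrt s * (- 3 * s\<^sup>2 * bubble p s y ^ 5) = - 3 * (sqrt s * bubble p s y) ^ 5" for p
      by (simp add: power_mult_distrib)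
    then have "(\<Sum>p\<in>I. sqrt s * (- 3 * s\<^sup>2 * bubble p s y ^ 5)) = - 3 * (\<Sum>p\<in>I. (sqrt s * bubble p s y) ^ 5)"
      by (simp only: sum_distrib_left)
    then show ?thesis by (simp only: distrib_left)
  qed
  finally show ?thesis
    using scalar_curvature_conformal[OF open_UNIV UNIV_I smooth_on_bubbles bubbles_pos, of s I y] s
    by simp
qed

section \<open>Lower bound for the scalar curvature of the bubbles\<close>

lemma power5_add_le:
  fixes x y :: real
  assumes "x \<ge> 0" "y \<ge> 0"
  shows "(x + y) ^ 5 \<le> 16 * (x ^ 5 + y ^ 5)"
proof -
  \<comment> \<open>Convexity of the fifth power, with \<open>16 = 2 ^ 4\<close>, in explicit form:
    the difference vanishes to second order at \<open>x = y\<close>, and the cofactor has positive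
    coefficients.\<close>
  have "16 * (x ^ 5 + y ^ 5) - (x + y) ^ 5 = 5 * (x - y)\<^sup>2 * (3 * x ^ 3 + 5 * x\<^sup>2 * y + 5 * x * y\<^sup>2 + 3 * y ^ 3)"
    by (simp add: eval_nat_numeral algebra_simps)
  also have "\<dots> \<ge> 0" using assms by simp
  finally show ?thesis by simp
qed

lemma finite_separated:
  fixes I :: "'a::metric_space set"
  assumes "finite I"
  obtains d where "d > 0" "\<And>p q. p \<in> I \<Longrightarrow> q \<in> I \<Longrightarrow> p \<noteq> q \<Longrightarrow> dist p q \<ge> d"
proof -
  \<comment> \<open>The inserted 1 keeps the set nonempty when \<open>I\<close> has at most one
    point.\<close>
  let ?D = "insert 1 ((\<lambda>(p, q). dist p q) ` {(p, q) \<in> I \<times> I. p \<noteq> q})"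
  have fin: "finite ?D"
    using assms by (intro finite.insertI finite_imageI) (auto intro: finite_subset[of _ "I \<times> I"])
  show ?thesis
  proof
    show "Min ?D > 0" using fin by (subst Min_gr_iff) auto
    show "dist p q \<ge> Min ?D" if "p \<in> I" "q \<in> I" "p \<noteq> q" for p q
      using that fin by (intro Min_le) auto
  qed
qed

text \<open>Both functions decay like the inverse distance, which makes the bound uniform up to
  infinity. The constant comes from \<open>norm y + 1 \<le> dist y p + 2\<close> and
  \<open>2 \<le> 4 / d * dist y p\<close>, and it does not involve \<open>s\<close>.\<close>

lemma bubble_le_bubble_0:
  assumes p: "norm p \<le> 1" and d: "d > 0" "dist y p \<ge> d / 2" and s: "s > 0"
  shows "bubble p s y \<le> (1 + 4 / d) * bubble 0 1 y"
proof -
  have t: "dist y p > 0" using d by linarith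
  have "bubble p s y \<le> 1 / sqrt ((norm (y - p))\<^sup>2)"
    using s t by (subst bubble_eq) (auto intro!: divide_left_mono mult_pos_pos simp: dist_norm add_pos_pos)
  then have 1: "bubble p s y \<le> 1 / dist y p" by (simp add: dist_norm)
  have "norm y \<le> dist y p + 1"
    using norm_triangle_sub[of y p] p by (simp add: dist_norm)
  moreover have "sqrt ((norm y)\<^sup>2 + 1) \<le> norm y + 1"
    by (rule real_le_lsqrt) (auto simp: power2_eq_square algebra_simps)
  moreover have "2 \<le> 4 / d * dist y p" using d by (simp add: field_simps)
  ultimately have "sqrt ((norm y)\<^sup>2 + 1) \<le> (1 + 4 / d) * dist y p"
    by (simp add: algebra_simps)
  moreover have "sqrt ((norm y)\<^sup>2 + 1) > 0" by (simp add: add_nonneg_pos)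
  ultimately have "1 / dist y p \<le> (1 + 4 / d) * (1 / sqrt ((norm y)\<^sup>2 + 1))"
    using t by (simp only: divide_le_eq mult_1_right times_divide_eq_right times_divide_eq_left le_divide_eq if_True mult_1 if_P)
  then show ?thesis using 1 by (simp add: bubble_eq)
qed

lemma scalar_curvature_bubbles_ge_1:
  fixes I :: "(real^3) set"
  assumes I: "finite I" "\<And>p. p \<in> I \<Longrightarrow> norm p \<le> 1"
  shows "eventually (\<lambda>s. \<forall>y. scalar_curvature (\<lambda>y. mat (bubbles I s y ^ 4)) y \<ge> 1) (at_right 0)"
proof -
  obtain d where d: "d > 0" "\<And>p q. p \<in> I \<Longrightarrow> q \<in> I \<Longrightarrow> p \<noteq> q \<Longrightarrow> dist p q \<ge> d"
    using finite_separated[OF I(1)] by blast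
  \<comment> \<open>In units of \<open>bubble 0 1 y\<close> this bounds the sum of all bubbles but
    the nearest. Below 1/10 it at most doubles the term at 0.\<close>
  have "((\<lambda>s. real (card I) * (sqrt s * (1 + 4 / d))) \<longlongrightarrow> real (card I) * (sqrt 0 * (1 + 4 / d))) (at_right 0)"
    by (intro tendsto_intros)
  then have "eventually (\<lambda>s. real (card I) * (sqrt s * (1 + 4 / d)) < 1 / 10) (at_right 0)"
    by (rule order_tendstoD) simp
  moreover have "eventually (\<lambda>s. s > 0) (at_right (0::real))"
    by (simp add: eventually_at_right_less)
  ultimately show ?thesis
  proof eventually_elim
    case (elim s)
    show ?case
    proof
      fix y :: "real^3"
      let ?q = "bubble 0 1 y" and ?B = "\<lambda>p. sqrt s * bubble p s y"
      have q: "?q > 0" and B: "?B p \<ge> 0" for p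
        using elim by (auto intro: bubble_pos intro!: mult_nonneg_nonneg less_imp_le[OF bubble_pos])
      \<comment> \<open>All bubbles but the one nearest to \<open>y\<close> are dominated by the term at \<open>0\<close>.\<close>
      have "\<exists>b\<ge>0. bubbles I s y \<le> 2 * (1 / 10 * ?q) + b \<and> b ^ 5 \<le> (\<Sum>p\<in>I. ?B p ^ 5)"
      proof (cases "I = {}")
        case True
        then show ?thesis using q by (intro exI[of _ 0]) (auto simp: bubbles_def)
      next
        case False
        have "Min (dist y ` I) \<in> dist y ` I" using I(1) False by (intro Min_in) auto
        then obtain p where "p \<in> I" "Min (dist y ` I) = dist y p" by auto
        then have p: "p \<in> I" "\<And>p'. p' \<in> I \<Longrightarrow> dist y p \<le> dist y p'"
          using I(1) Min_le[of "dist y ` I"] by auto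
        have "?B p' \<le> sqrt s * ((1 + 4 / d) * ?q)" if "p' \<in> I - {p}" for p'
        proof -
          \<comment> \<open>As \<open>p\<close> is nearest to \<open>y\<close>, the triangle
            inequality puts every other point at distance at least \<open>d / 2\<close> from
            \<open>y\<close>.\<close>
          have "d \<le> dist p p'" using d(2) p(1) that by blast
          also have "\<dots> \<le> dist y p + dist y p'" using dist_triangle[of p p' y] by (simp add: dist_commute)
          finally have "dist y p' \<ge> d / 2" using p(2)[of p'] that by auto
          then show ?thesis
            using elim that I(2) d(1) by (intro mult_left_mono bubble_le_bubble_0) auto
        qed
        then have "(\<Sum>p'\<in>I - {p}. ?B p') \<le> real (card (I - {p})) * (sqrt s * ((1 + 4 / d) * ?q))"
          by (rule sum_bounded_above)
        also have "\<dots> \<le> real (card I) * (sqrt s * ((1 + 4 / d) * ?q))"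
          using I(1) elim d(1) q by (intro mult_right_mono of_nat_mono card_mono) auto
        also have "\<dots> \<le> 1 / 10 * ?q"
          using mult_right_mono[OF less_imp_le[OF elim(1)] less_imp_le[OF q]] by (simp add: mult_ac)
        finally have "bubbles I s y \<le> 2 * (1 / 10 * ?q) + ?B p"
          unfolding bubbles_def using sum.remove[OF I(1) p(1), of ?B] by simp
        moreover have "?B p ^ 5 \<le> (\<Sum>p\<in>I. ?B p ^ 5)"
          using p(1) I(1) B by (intro member_le_sum) auto
        ultimately show ?thesis using B by blast
      qed
      then obtain b where b: "b \<ge> 0" "bubbles I s y \<le> 2 * (1 / 10 * ?q) + b" "b ^ 5 \<le> (\<Sum>p\<in>I. ?B p ^ 5)"
        by blast
      have "bubbles I s y ^ 5 \<le> (2 * (1 / 10 * ?q) + b) ^ 5"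
        using b elim by (intro power_mono) (auto intro: less_imp_le bubbles_pos)
      also have "\<dots> \<le> 16 * ((2 * (1 / 10 * ?q)) ^ 5 + b ^ 5)"
        using b q by (intro power5_add_le) auto
      also have "\<dots> \<le> 24 * (1 / 10 * ?q ^ 5 + (\<Sum>p\<in>I. ?B p ^ 5))"
      proof -
        \<comment> \<open>The fifth power of 2/10 is so small that 16 times it stays far below
          24/10; for the nearest bubble it suffices that 16 is less than 24.\<close>
        have eq: "(2 * (1 / 10 * ?q)) ^ 5 = 1 / 3125 * ?q ^ 5" by (simp add: power_mult_distrib field_simps)
        have "?q ^ 5 \<ge> 0" "b ^ 5 \<ge> 0" using q b by auto
        moreover have "16 * (1 / 3125 * X + B) \<le> 24 * (1 / 10 * X + S)"
          if "0 \<le> X" "0 \<le> B" "B \<le> S" for X B S :: real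
        proof -
          have "16 * (1 / 3125 * X) \<le> 24 * (1 / 10 * X)" "16 * B \<le> 24 * S"
            using that by (simp_all add: field_simps)
          then show ?thesis by (simp only: distrib_left add_mono)
        qed
        ultimately show ?thesis using b(3) unfolding eq by blast
      qed
      finally show "scalar_curvature (\<lambda>y. mat (bubbles I s y ^ 4)) y \<ge> 1"
        unfolding scalar_curvature_bubbles[OF I(1) elim(2)] using bubbles_pos[OF elim(2), of I y]
        by (simp add: le_divide_eq)
    qed
  qed
qed

section \<open>An immersion that shrinks ellipsoidal cells\<close>

definition linear_path :: "real \<Rightarrow> real^'n^'n \<Rightarrow> real^'n \<Rightarrow> real^'n" where
  "linear_path t A v = (1 - t) *\<^sub>R (A *v v) + t *\<^sub>R v"

text \<open>By homogeneity in \<open>v\<close> this is the minimum of a continuous positive function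
  over the compact product of [0, 1] and the unit sphere.\<close>

lemma linear_path_lower_bound:
  fixes A :: "real^'n^'n"
  assumes "\<And>t v. 0 \<le> t \<Longrightarrow> t \<le> 1 \<Longrightarrow> linear_path t A v = 0 \<Longrightarrow> v = 0"
  obtains \<mu> where "\<mu> > 0" "\<And>t v. 0 \<le> t \<Longrightarrow> t \<le> 1 \<Longrightarrow> \<mu> * norm v \<le> norm (linear_path t A v)"
proof -
  let ?K = "{0..1::real} \<times> sphere (0::real^'n) 1"
  have cont: "continuous_on ?K (\<lambda>(t, v). norm (linear_path t A v))"
    unfolding linear_path_def case_prod_unfold
    by (intro continuous_intros bounded_bilinear.continuous_on[OF bounded_bilinear_matrix_vector_mult])
  have "axis undefined 1 \<in> sphere (0::real^'n) 1" by simp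
  then have ne: "?K \<noteq> {}" by fastforce
  obtain k where k: "k \<in> ?K" "\<And>l. l \<in> ?K \<Longrightarrow> norm (linear_path (fst k) A (snd k)) \<le> norm (linear_path (fst l) A (snd l))"
    using continuous_attains_inf[OF compact_Times[OF compact_Icc compact_sphere] ne cont]
    by (force simp: case_prod_unfold)
  let ?\<mu> = "norm (linear_path (fst k) A (snd k))"
  show ?thesis
  proof
    show "?\<mu> > 0"
      using assms[of "fst k" "snd k"] k(1) by auto
    show "?\<mu> * norm v \<le> norm (linear_path t A v)" if t: "0 \<le> t" "t \<le> 1" for t v
    proof (cases "v = 0")
      case False
      have "?\<mu> \<le> norm (linear_path t A (v /\<^sub>R norm v))"
        using k(2)[of "(t, v /\<^sub>R norm v)"] t False by simp
      also have "linear_path t A (v /\<^sub>R norm v) = linear_path t A v /\<^sub>R norm v"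
        by (simp add: linear_path_def matvec.scaleR_right scaleR_right_distrib mult.commute)
      finally show ?thesis using False by (simp add: field_simps)
    qed simp
  qed
qed

text \<open>The linear map of this lemma is, up to a factor, the derivative of \<open>cell_bump\<close> below plus
  the identity. If \<open>v\<close> is in the kernel, then \<open>v + (L g m) z\<close> is of the order of \<open>g m z\<close>, so
  that \<open>m (1 + L g \<bar>A z\<bar>\<^sup>2)\<close> is of the order of \<open>m g \<bar>A z\<bar>\<^sup>2\<close>, and \<open>m = 0\<close> if \<open>L\<close> is large.\<close>

lemma shrinking_injective:
  fixes A :: "real^'n^'n"
  assumes "\<And>t v. 0 \<le> t \<Longrightarrow> t \<le> 1 \<Longrightarrow> linear_path t A v = 0 \<Longrightarrow> v = 0"
  obtains C where "\<And>t g L z v m. 0 \<le> t \<Longrightarrow> t \<le> 1 \<Longrightarrow> 0 \<le> g \<Longrightarrow> C \<le> L \<Longrightarrow> m = (A *v z) \<bullet> (A *v v) \<Longrightarrow>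
    linear_path t A (v + (L * g * m) *\<^sub>R z) + (g * m) *\<^sub>R (z - A *v z) = 0 \<Longrightarrow> v = 0"
proof -
  obtain \<mu> where \<mu>: "\<mu> > 0" "\<And>t v. 0 \<le> t \<Longrightarrow> t \<le> 1 \<Longrightarrow> \<mu> * norm v \<le> norm (linear_path t A v)"
    by (rule linear_path_lower_bound[OF assms]) blast+
  obtain K where K: "K > 0" "\<And>v. norm (A *v v) \<le> norm v * K"
    using bounded_linear.pos_bounded[OF matvec.bounded_linear_right[of A]] by blast
  have low: "\<mu> * norm z \<le> norm (A *v z)" for z
    using \<mu>(2)[of 0 z] by (simp add: linear_path_def)
  \<comment> \<open>One factor \<open>1 / \<mu>\<close> comes from inverting the path, the other
    from bounding \<open>norm z\<close> by \<open>N / \<mu>\<close>. The factor \<open>1 + K\<close>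
    bounds the twist \<open>z - A *v z\<close>, and \<open>K\<close> the passage from
    \<open>w\<close> to \<open>A *v w\<close>.\<close>
  define C where "C = K * (1 + K) / \<mu>\<^sup>2"
  show ?thesis
  proof
    fix t g L z v m
    assume t: "0 \<le> t" "t \<le> 1" and g: "0 \<le> g" and L: "C \<le> L" and m: "m = (A *v z) \<bullet> (A *v v)"
      and eq: "linear_path t A (v + (L * g * m) *\<^sub>R z) + (g * m) *\<^sub>R (z - A *v z) = 0"
    define w where "w = v + (L * g * m) *\<^sub>R z"
    define N where "N = norm (A *v z)"
    have z: "norm z \<le> N / \<mu>"
      using low[of z] \<mu>(1) by (simp add: N_def field_simps)
    have "\<mu> * norm w \<le> norm (linear_path t A w)" using \<mu>(2) t by blast
    also have "linear_path t A w = - ((g * m) *\<^sub>R (z - A *v z))"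
      using eq by (simp add: w_def eq_neg_iff_add_eq_0)
    also have "norm \<dots> = g * \<bar>m\<bar> * norm (z - A *v z)"
      using g by (simp add: abs_mult)
    also have "\<dots> \<le> g * \<bar>m\<bar> * ((1 + K) * (N / \<mu>))"
    proof (intro mult_left_mono)
      have "norm (z - A *v z) \<le> norm z + norm (A *v z)" by (rule norm_triangle_ineq4)
      also have "\<dots> \<le> (1 + K) * norm z" using K(2)[of z] by (simp add: algebra_simps)
      also have "\<dots> \<le> (1 + K) * (N / \<mu>)" using z K(1) by (intro mult_left_mono) auto
      finally show "norm (z - A *v z) \<le> (1 + K) * (N / \<mu>)" .
    qed (use g in auto)
    finally have w: "norm w \<le> g * \<bar>m\<bar> * ((1 + K) * N / \<mu>\<^sup>2)"
      using \<mu>(1) by (simp add: field_simps power2_eq_square)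
    \<comment> \<open>Pairing with \<open>A *v z\<close> isolates \<open>m\<close>: the stretching
      adds \<open>L * g * N\<^sup>2\<close> times \<open>m\<close> to \<open>m\<close> itself, and
      the twist can offset at most the former.\<close>
    have "(A *v z) \<bullet> (A *v w) = m * (1 + L * g * N\<^sup>2)"
      by (simp add: w_def matvec.add_right matvec.scaleR_right inner_add_right m N_def power2_norm_eq_inner algebra_simps)
    then have "\<bar>m\<bar> * \<bar>1 + L * g * N\<^sup>2\<bar> \<le> N * norm (A *v w)"
      using Cauchy_Schwarz_ineq2[of "A *v z" "A *v w"] by (simp add: N_def abs_mult)
    also have "\<dots> \<le> N * (norm w * K)" using K(2) by (intro mult_left_mono) (auto simp: N_def)
    also have "\<dots> \<le> N * (g * \<bar>m\<bar> * ((1 + K) * N / \<mu>\<^sup>2) * K)"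
      using w K(1) by (intro mult_left_mono mult_right_mono) (auto simp: N_def)
    also have "\<dots> = \<bar>m\<bar> * (C * g * N\<^sup>2)"
      by (simp add: C_def power2_eq_square)
    also have "\<dots> \<le> \<bar>m\<bar> * (L * g * N\<^sup>2)"
      using L g by (intro mult_left_mono mult_right_mono) auto
    finally have "\<bar>m\<bar> * \<bar>1 + L * g * N\<^sup>2\<bar> \<le> \<bar>m\<bar> * (L * g * N\<^sup>2)" .
    moreover have "\<bar>m\<bar> * (1 + L * g * N\<^sup>2) \<le> \<bar>m\<bar> * \<bar>1 + L * g * N\<^sup>2\<bar>"
      by (intro mult_left_mono) auto
    ultimately have "m = 0" by (simp add: distrib_left)
    then have "linear_path t A v = 0" using eq by simp
    then show "v = 0" using assms t by blast
  qed
qed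

section \<open>The deformation of a single ellipsoid\<close>

definition cell_step :: "real^'n^'n \<Rightarrow> real \<Rightarrow> real \<Rightarrow> real^'n \<Rightarrow> real" where
  "cell_step A r \<kappa> z = smooth_step (((A *v z) \<bullet> (A *v z) - (\<kappa> * r)\<^sup>2) / (r\<^sup>2 - (\<kappa> * r)\<^sup>2))"

text \<open>The displacement and not the map, so that contributions of disjoint ellipsoids can be
  added. The scale interpolates geometrically between \<open>s\<close> inside and 1 outside, so that
  its logarithmic derivative brings in the large factor \<open>- ln s\<close>. The step is a
  function of the squared norm, which is smooth at the centre too.\<close>

definition cell_bump :: "real \<Rightarrow> real^'n^'n \<Rightarrow> real \<Rightarrow> real \<Rightarrow> real^'n \<Rightarrow> real^'n" where
  "cell_bump s A r \<kappa> z = s powr (1 - cell_step A r \<kappa> z) *\<^sub>R linear_path (cell_step A r \<kappa> z) A z - z"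

lemma smooth_on_matrix_vector_mult: "smooth_on UNIV (\<lambda>z. A *v z)" for A :: "real^'n^'m"
  by (rule smooth_on_bounded_linear) (auto intro: matvec.bounded_linear_right)

lemma smooth_on_inner:
  fixes f g :: "real^'n \<Rightarrow> real^'m"
  shows "open S \<Longrightarrow> smooth_on S f \<Longrightarrow> smooth_on S g \<Longrightarrow> smooth_on S (\<lambda>x. f x \<bullet> g x)"
  by (simp add: smooth_on_def higher_diff_on_bounded_bilinear[OF bounded_bilinear_inner])

lemma smooth_on_cell_step: "smooth_on UNIV (cell_step A r \<kappa>)"
proof -
  have "smooth_on UNIV (\<lambda>z. ((A *v z) \<bullet> (A *v z) - (\<kappa> * r)\<^sup>2) * (1 / (r\<^sup>2 - (\<kappa> * r)\<^sup>2)))"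
    by (intro smooth_on_mult smooth_on_diff smooth_on_const smooth_on_inner smooth_on_matrix_vector_mult open_UNIV)
  then show ?thesis
    unfolding cell_step_def[abs_def]
    by (intro smooth_on_compose[OF smooth_on_smooth_step]) auto
qed

lemma smooth_on_cell_bump:
  assumes "s > 0"
  shows "smooth_on UNIV (cell_bump s A r \<kappa>)"
proof -
  have "smooth_on UNIV (\<lambda>z. exp ((1 - cell_step A r \<kappa> z) * ln s) *\<^sub>R
      ((1 - cell_step A r \<kappa> z) *\<^sub>R (A *v z) + cell_step A r \<kappa> z *\<^sub>R z) - z)"
    by (intro smooth_on_diff smooth_on_scaleR smooth_on_exp smooth_on_mult smooth_on_add smooth_on_const
        smooth_on_cell_step smooth_on_matrix_vector_mult smooth_on_id open_UNIV)
  then show ?thesis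
    using assms by (simp add: cell_bump_def[abs_def] powr_def linear_path_def)
qed

lemma cell_step_bounds: "0 \<le> cell_step A r \<kappa> z" "cell_step A r \<kappa> z \<le> 1"
  by (auto simp: cell_step_def smooth_step_bounds)

locale cell_parameters =
  fixes \<kappa> r :: real
  assumes \<kappa>: "0 < \<kappa>" "\<kappa> < 1" and r: "0 < r"
begin

lemma denom_pos: "r\<^sup>2 - (\<kappa> * r)\<^sup>2 > 0"
  using \<kappa> r by (simp add: power2_eq_square mult_strict_mono)

lemma cell_step_arg_ge_1: "norm (A *v z) \<ge> r \<Longrightarrow> ((A *v z) \<bullet> (A *v z) - (\<kappa> * r)\<^sup>2) / (r\<^sup>2 - (\<kappa> * r)\<^sup>2) \<ge> 1"
  using denom_pos r power_mono[of r "norm (A *v z)" 2] by (simp add: power2_norm_eq_inner)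

lemma cell_step_arg_le_0: "norm (A *v z) \<le> \<kappa> * r \<Longrightarrow> ((A *v z) \<bullet> (A *v z) - (\<kappa> * r)\<^sup>2) / (r\<^sup>2 - (\<kappa> * r)\<^sup>2) \<le> 0"
  using denom_pos power_mono[of "norm (A *v z)" "\<kappa> * r" 2]
  by (simp add: power2_norm_eq_inner divide_le_0_iff)

lemma cell_step_eq_1: "norm (A *v z) \<ge> r \<Longrightarrow> cell_step A r \<kappa> z = 1"
  by (simp add: cell_step_def smooth_step_eq_1 cell_step_arg_ge_1)

lemma cell_step_eq_0: "norm (A *v z) \<le> \<kappa> * r \<Longrightarrow> cell_step A r \<kappa> z = 0"
  by (simp add: cell_step_def smooth_step_eq_0 cell_step_arg_le_0)

lemma cell_bump_outer: "s > 0 \<Longrightarrow> norm (A *v z) \<ge> r \<Longrightarrow> cell_bump s A r \<kappa> z = 0"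
  by (simp add: cell_bump_def cell_step_eq_1 linear_path_def)

lemma cell_bump_inner: "s > 0 \<Longrightarrow> norm (A *v z) \<le> \<kappa> * r \<Longrightarrow> cell_bump s A r \<kappa> z = s *\<^sub>R (A *v z) - z"
  by (simp add: cell_bump_def cell_step_eq_0 linear_path_def)

text \<open>The formula is arranged as a multiple of the map in \<open>shrinking_injective\<close>
  with \<open>L = - ln s\<close>, minus the identity. The sign of \<open>g\<close> expresses that
  the step increases outwards.\<close>

lemma cell_bump_has_derivative:
  assumes s: "s > 0"
  obtains g where "g \<ge> 0" "norm (A *v z) \<ge> r \<Longrightarrow> g = 0" "norm (A *v z) \<le> \<kappa> * r \<Longrightarrow> g = 0"
    "(cell_bump s A r \<kappa> has_derivative (\<lambda>v. s powr (1 - cell_step A r \<kappa> z) *\<^sub>R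
      (linear_path (cell_step A r \<kappa> z) A (v + (- ln s * g * ((A *v z) \<bullet> (A *v v))) *\<^sub>R z)
       + (g * ((A *v z) \<bullet> (A *v v))) *\<^sub>R (z - A *v z)) - v)) (at z)"
proof -
  obtain D where D: "\<And>t. (smooth_step has_real_derivative D t) (at t)" "\<And>t. D t \<ge> 0"
    "\<And>t. t \<ge> 1 \<Longrightarrow> D t = 0" "\<And>t. t \<le> 0 \<Longrightarrow> D t = 0"
    using smooth_step_has_derivative by blast
  let ?d = "r\<^sup>2 - (\<kappa> * r)\<^sup>2" and ?\<theta> = "cell_step A r \<kappa>"
  let ?a = "((A *v z) \<bullet> (A *v z) - (\<kappa> * r)\<^sup>2) / ?d"
  \<comment> \<open>The 2 comes from differentiating the squared norm, \<open>?d\<close> from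
    rescaling the shell to [0, 1].\<close>
  define g where "g = D ?a * 2 / ?d"
  have lin: "((\<lambda>z. A *v z) has_derivative (\<lambda>v. A *v v)) (at z)"
    by (rule bounded_linear_imp_has_derivative, rule matvec.bounded_linear_right)
  have "((\<lambda>z. ((A *v z) \<bullet> (A *v z) - (\<kappa> * r)\<^sup>2) / ?d) has_derivative (\<lambda>v. 2 * ((A *v z) \<bullet> (A *v v)) / ?d)) (at z)"
    using denom_pos by (auto intro!: derivative_eq_intros lin simp: inner_commute)
  from has_derivative_compose[OF this D(1)[unfolded has_field_derivative_def]]
  have d\<theta>: "(?\<theta> has_derivative (\<lambda>v. g * ((A *v z) \<bullet> (A *v v)))) (at z)"
    unfolding cell_step_def g_def by (simp add: mult_ac)
  have "((\<lambda>z. exp ((1 - ?\<theta> z) * ln s) *\<^sub>R ((1 - ?\<theta> z) *\<^sub>R (A *v z) + ?\<theta> z *\<^sub>R z) - z) has_derivative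
    (\<lambda>v. exp ((1 - ?\<theta> z) * ln s) *\<^sub>R
      (linear_path (?\<theta> z) A (v + (- ln s * g * ((A *v z) \<bullet> (A *v v))) *\<^sub>R z)
       + (g * ((A *v z) \<bullet> (A *v v))) *\<^sub>R (z - A *v z)) - v)) (at z)"
    by (rule derivative_eq_intros d\<theta> lin refl)+
      (simp add: fun_eq_iff linear_path_def matvec.add_right matvec.scaleR_right algebra_simps)
  then have "(cell_bump s A r \<kappa> has_derivative (\<lambda>v. s powr (1 - cell_step A r \<kappa> z) *\<^sub>R
      (linear_path (cell_step A r \<kappa> z) A (v + (- ln s * g * ((A *v z) \<bullet> (A *v v))) *\<^sub>R z)
       + (g * ((A *v z) \<bullet> (A *v v))) *\<^sub>R (z - A *v z)) - v)) (at z)"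
    using s by (simp add: cell_bump_def[abs_def] powr_def linear_path_def[of "?\<theta> _" A])
  then show ?thesis
    using that[of g] D(2-4) denom_pos cell_step_arg_ge_1[of A z] cell_step_arg_le_0[of A z]
    by (auto simp: g_def)
qed

end

section \<open>The immersion for all ellipsoids together\<close>

locale cells =
  fixes I :: "(real^'n) set" and A :: "real^'n \<Rightarrow> real^'n^'n" and r :: "real^'n \<Rightarrow> real" and \<kappa> :: real
  assumes fin: "finite I" and \<kappa>: "0 < \<kappa>" "\<kappa> < 1" and r: "\<And>p. p \<in> I \<Longrightarrow> 0 < r p"
    and path: "\<And>p t v. p \<in> I \<Longrightarrow> 0 \<le> t \<Longrightarrow> t \<le> 1 \<Longrightarrow> linear_path t (A p) v = 0 \<Longrightarrow> v = 0"
    and disjoint: "\<And>p q x. p \<in> I \<Longrightarrow> q \<in> I \<Longrightarrow> norm (A p *v (x - p)) < r p \<Longrightarrow> norm (A q *v (x - q)) < r q \<Longrightarrow> p = q"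
begin

text \<open>For \<open>s > 0\<close>, disjointness leaves at most one nonzero summand at each
  point.\<close>

definition \<Phi> :: "real \<Rightarrow> real^'n \<Rightarrow> real^'n" where
  "\<Phi> s x = x + (\<Sum>p\<in>I. cell_bump s (A p) (r p) \<kappa> (x - p))"

lemma parameters: "p \<in> I \<Longrightarrow> cell_parameters \<kappa> (r p)"
  using \<kappa> r by unfold_locales auto

lemma smooth_\<Phi>: "s > 0 \<Longrightarrow> smooth_on UNIV (\<Phi> s)"
  unfolding \<Phi>_def[abs_def]
  by (intro smooth_on_add smooth_on_sum smooth_on_id open_UNIV
      smooth_on_compose[OF smooth_on_cell_bump, where h = "\<lambda>x. x - _"] smooth_on_diff smooth_on_const) auto

lemma outside_other:
  assumes "p \<in> I" "norm (A p *v (x - p)) < r p" "q \<in> I - {p}"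
  shows "norm (A q *v (x - q)) \<ge> r q"
  using disjoint[of p q x] assms by force

text \<open>The explicit derivative also covers the boundary of the ellipsoid, where the bump need
  not vanish in a neighbourhood: with \<open>g = 0\<close> and step 1 it reduces to
  \<open>v - v\<close>.\<close>

lemma bump_outer_derivative:
  assumes s: "s > 0" and q: "q \<in> I" "norm (A q *v (x - q)) \<ge> r q"
  shows "((\<lambda>x. cell_bump s (A q) (r q) \<kappa> (x - q)) has_derivative (\<lambda>v. 0)) (at x)"
proof -
  interpret cell_parameters \<kappa> "r q" using parameters[OF q(1)] .
  obtain g where g: "norm (A q *v (x - q)) \<ge> r q \<Longrightarrow> g = 0"
    "(cell_bump s (A q) (r q) \<kappa> has_derivative (\<lambda>v. s powr (1 - cell_step (A q) (r q) \<kappa> (x - q)) *\<^sub>R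
      (linear_path (cell_step (A q) (r q) \<kappa> (x - q)) (A q) (v + (- ln s * g * ((A q *v (x - q)) \<bullet> (A q *v v))) *\<^sub>R (x - q))
       + (g * ((A q *v (x - q)) \<bullet> (A q *v v))) *\<^sub>R ((x - q) - A q *v (x - q))) - v)) (at (x - q))"
    by (rule cell_bump_has_derivative[OF s, of "A q" "x - q"]) blast
  have "(cell_bump s (A q) (r q) \<kappa> has_derivative (\<lambda>v. 0)) (at (x - q))"
    using g(2) s unfolding g(1)[OF q(2)] cell_step_eq_1[OF q(2)]
    by (simp add: linear_path_def)
  moreover have "((\<lambda>x. x - q) has_derivative (\<lambda>v. v)) (at x)"
    by (auto intro!: derivative_eq_intros)
  ultimately show ?thesis
    using has_derivative_compose[of "\<lambda>x. x - q" "\<lambda>v. v" x UNIV] by blast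
qed

lemma \<Phi>_has_derivative_outside:
  assumes s: "s > 0" and "\<And>q. q \<in> I \<Longrightarrow> norm (A q *v (x - q)) \<ge> r q"
  shows "(\<Phi> s has_derivative (\<lambda>v. v)) (at x)"
proof -
  have "(\<Phi> s has_derivative (\<lambda>v. v + (\<Sum>q\<in>I. 0))) (at x)"
    unfolding \<Phi>_def by (intro has_derivative_add has_derivative_ident has_derivative_sum bump_outer_derivative assms)
  then show ?thesis by simp
qed

lemma \<Phi>_has_derivative_cell:
  assumes s: "s > 0" and p: "p \<in> I" "norm (A p *v (x - p)) < r p"
  obtains g t where "g \<ge> 0" "0 \<le> t" "t \<le> 1" "norm (A p *v (x - p)) \<le> \<kappa> * r p \<Longrightarrow> g = 0 \<and> t = 0"
    "(\<Phi> s has_derivative (\<lambda>v. s powr (1 - t) *\<^sub>R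
      (linear_path t (A p) (v + (- ln s * g * ((A p *v (x - p)) \<bullet> (A p *v v))) *\<^sub>R (x - p))
       + (g * ((A p *v (x - p)) \<bullet> (A p *v v))) *\<^sub>R ((x - p) - A p *v (x - p))))) (at x)"
proof -
  interpret cell_parameters \<kappa> "r p" using parameters[OF p(1)] .
  let ?t = "cell_step (A p) (r p) \<kappa> (x - p)"
  obtain g where g: "g \<ge> 0" "norm (A p *v (x - p)) \<le> \<kappa> * r p \<Longrightarrow> g = 0"
    "(cell_bump s (A p) (r p) \<kappa> has_derivative (\<lambda>v. s powr (1 - ?t) *\<^sub>R
      (linear_path ?t (A p) (v + (- ln s * g * ((A p *v (x - p)) \<bullet> (A p *v v))) *\<^sub>R (x - p))
       + (g * ((A p *v (x - p)) \<bullet> (A p *v v))) *\<^sub>R ((x - p) - A p *v (x - p))) - v)) (at (x - p))"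
    (is "(_ has_derivative (\<lambda>v. ?D v - v)) _")
    by (rule cell_bump_has_derivative[OF s, of "A p" "x - p"]) blast
  have shift: "((\<lambda>x. x - p) has_derivative (\<lambda>v. v)) (at x)"
    by (auto intro!: derivative_eq_intros)
  have "((\<lambda>x. x + (cell_bump s (A p) (r p) \<kappa> (x - p) + (\<Sum>q\<in>I - {p}. cell_bump s (A q) (r q) \<kappa> (x - q))))
      has_derivative (\<lambda>v. v + ((?D v - v) + (\<Sum>q\<in>I - {p}. 0)))) (at x)"
    by (intro has_derivative_add has_derivative_ident has_derivative_sum bump_outer_derivative s
        outside_other[OF p] has_derivative_compose[OF shift g(3)]) auto
  moreover have "x + (cell_bump s (A p) (r p) \<kappa> (x - p) + (\<Sum>q\<in>I - {p}. cell_bump s (A q) (r q) \<kappa> (x - q))) = \<Phi> s x" for x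
    unfolding \<Phi>_def sum.remove[OF fin p(1)] ..
  ultimately have "(\<Phi> s has_derivative ?D) (at x)" by simp
  then show ?thesis
    using that[of g ?t] g(1,2) cell_step_bounds cell_step_eq_0 by blast
qed

lemma \<Phi>_inner:
  assumes s: "s > 0" and p: "p \<in> I" "norm (A p *v (x - p)) < \<kappa> * r p"
  shows "\<Phi> s x = p + s *\<^sub>R (A p *v (x - p))" and "jacobian (\<Phi> s) x = s *\<^sub>R A p"
proof -
  have "\<kappa> * r p < r p" using \<kappa> r[OF p(1)] by simp
  then have lt: "norm (A p *v (x - p)) < r p" using p(2) by linarith
  interpret cell_parameters \<kappa> "r p" using parameters[OF p(1)] .
  have "(\<Sum>q\<in>I - {p}. cell_bump s (A q) (r q) \<kappa> (x - q)) = 0"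
  proof (rule sum.neutral, rule)
    fix q assume q: "q \<in> I - {p}"
    interpret q: cell_parameters \<kappa> "r q" using parameters q by blast
    show "cell_bump s (A q) (r q) \<kappa> (x - q) = 0"
      by (rule q.cell_bump_outer[OF s outside_other[OF p(1) lt q]])
  qed
  then show "\<Phi> s x = p + s *\<^sub>R (A p *v (x - p))"
    unfolding \<Phi>_def sum.remove[OF fin p(1)] using cell_bump_inner[OF s, of "A p" "x - p"] p(2) by simp
  obtain g t where g: "norm (A p *v (x - p)) \<le> \<kappa> * r p \<Longrightarrow> g = 0 \<and> t = 0"
    "(\<Phi> s has_derivative (\<lambda>v. s powr (1 - t) *\<^sub>R
      (linear_path t (A p) (v + (- ln s * g * ((A p *v (x - p)) \<bullet> (A p *v v))) *\<^sub>R (x - p))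
       + (g * ((A p *v (x - p)) \<bullet> (A p *v v))) *\<^sub>R ((x - p) - A p *v (x - p))))) (at x)"
    by (rule \<Phi>_has_derivative_cell[OF s p(1) lt]) blast
  have gt: "g = 0" "t = 0" using g(1) p(2) by auto
  have "(\<Phi> s has_derivative (\<lambda>v. s *\<^sub>R (A p *v v))) (at x)"
    using g(2) s unfolding gt by (simp add: linear_path_def)
  from partial_eqI[OF this] show "jacobian (\<Phi> s) x = s *\<^sub>R A p"
    by (simp add: jacobian_def vec_eq_iff matrix_vector_mult_def axis_def if_distrib cong: if_cong)
qed

text \<open>As \<open>s\<close> tends to 0, \<open>- ln s\<close> exceeds the finitely many
  constants of \<open>shrinking_injective\<close>, so the derivative is injective in every
  ellipsoid. Elsewhere it is the identity.\<close>

lemma immersion: "eventually (\<lambda>s. \<forall>x. invertible (jacobian (\<Phi> s) x)) (at_right 0)"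
proof -
  have "\<exists>C. \<forall>t g L z v m. 0 \<le> t \<longrightarrow> t \<le> 1 \<longrightarrow> 0 \<le> g \<longrightarrow> C \<le> L \<longrightarrow> m = (A p *v z) \<bullet> (A p *v v) \<longrightarrow>
    linear_path t (A p) (v + (L * g * m) *\<^sub>R z) + (g * m) *\<^sub>R (z - A p *v z) = 0 \<longrightarrow> v = 0" if "p \<in> I" for p
    by (rule shrinking_injective[OF path[OF that]]) blast+
  then obtain C where C: "\<And>p t g L z v m. p \<in> I \<Longrightarrow> 0 \<le> t \<Longrightarrow> t \<le> 1 \<Longrightarrow> 0 \<le> g \<Longrightarrow> C p \<le> L \<Longrightarrow> m = (A p *v z) \<bullet> (A p *v v) \<Longrightarrow>
    linear_path t (A p) (v + (L * g * m) *\<^sub>R z) + (g * m) *\<^sub>R (z - A p *v z) = 0 \<Longrightarrow> v = 0"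
    by metis
  have "eventually (\<lambda>s. \<forall>p\<in>I. s < exp (- C p)) (at_right 0)"
    using fin by (intro eventually_ball_finite ballI order_tendstoD(2)[OF tendsto_ident_at]) auto
  moreover have "eventually (\<lambda>s. s > 0) (at_right (0::real))"
    by (simp add: eventually_at_right_less)
  ultimately show ?thesis
  proof eventually_elim
    case (elim s)
    then have s: "s > 0" by simp
    have Cs: "C p \<le> - ln s" if "p \<in> I" for p
      using elim that s by (metis ln_exp ln_less_cancel_iff exp_gt_zero less_imp_le neg_le_iff_le minus_minus less_eq_real_def)
    show ?case
    proof
      fix x
      have "\<exists>D. (\<Phi> s has_derivative D) (at x) \<and> (\<forall>v. D v = 0 \<longrightarrow> v = 0)"
      proof (cases "\<exists>p\<in>I. norm (A p *v (x - p)) < r p")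
        case True
        then obtain p where p: "p \<in> I" "norm (A p *v (x - p)) < r p" by blast
        obtain g t where g: "g \<ge> 0" "0 \<le> t" "t \<le> 1"
          "(\<Phi> s has_derivative (\<lambda>v. s powr (1 - t) *\<^sub>R
            (linear_path t (A p) (v + (- ln s * g * ((A p *v (x - p)) \<bullet> (A p *v v))) *\<^sub>R (x - p))
             + (g * ((A p *v (x - p)) \<bullet> (A p *v v))) *\<^sub>R ((x - p) - A p *v (x - p))))) (at x)"
          by (rule \<Phi>_has_derivative_cell[OF s p]) blast
        moreover have "v = 0" if "s powr (1 - t) *\<^sub>R
            (linear_path t (A p) (v + (- ln s * g * ((A p *v (x - p)) \<bullet> (A p *v v))) *\<^sub>R (x - p))
             + (g * ((A p *v (x - p)) \<bullet> (A p *v v))) *\<^sub>R ((x - p) - A p *v (x - p))) = 0" for v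
        proof -
          have "linear_path t (A p) (v + (- ln s * g * ((A p *v (x - p)) \<bullet> (A p *v v))) *\<^sub>R (x - p))
             + (g * ((A p *v (x - p)) \<bullet> (A p *v v))) *\<^sub>R ((x - p) - A p *v (x - p)) = 0"
            using that s by simp
          from C[OF p(1) g(2,3,1) Cs[OF p(1)] refl this] show ?thesis .
        qed
        ultimately show ?thesis by blast
      next
        case False
        then have "(\<Phi> s has_derivative (\<lambda>v. v)) (at x)"
          by (intro \<Phi>_has_derivative_outside s) force
        then show ?thesis by blast
      qed
      then obtain D where D: "(\<Phi> s has_derivative D) (at x)" "\<And>v. D v = 0 \<Longrightarrow> v = 0" by blast
      interpret D: bounded_linear D using D(1) by (rule has_derivative_bounded_linear)
      have "jacobian (\<Phi> s) x = matrix D"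
        by (simp add: jacobian_def matrix_def partial_eqI[OF D(1)])
      moreover have "linear D" "inj D"
        using D(2) by (auto simp: D.linear linear_injective_0)
      ultimately show "invertible (jacobian (\<Phi> s) x)"
        using det_nz_iff_inj invertible_det_nz by metis
    qed
  qed
qed

end

section \<open>Packing by ellipsoids\<close>

text \<open>A triangular factor is needed, since the segment from it to the identity consists of
  invertible matrices.\<close>

lemma cholesky_3:
  fixes P :: "real^3^3"
  assumes sym: "transpose P = P" and pos: "\<And>v. v \<noteq> 0 \<Longrightarrow> 0 < v \<bullet> (P *v v)"
  obtains A :: "real^3^3" where "transpose A ** A = P"
    "\<And>t v. 0 \<le> t \<Longrightarrow> t \<le> 1 \<Longrightarrow> linear_path t A v = 0 \<Longrightarrow> v = 0"
proof -
  have s: "P $ 2 $ 1 = P $ 1 $ 2" "P $ 3 $ 1 = P $ 1 $ 3" "P $ 3 $ 2 = P $ 2 $ 3"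
    using sym by (auto simp: vec_eq_iff transpose_def)
  have quad: "vector [x, y, z] \<bullet> (P *v vector [x, y, z])
    = P $ 1 $ 1 * x\<^sup>2 + P $ 2 $ 2 * y\<^sup>2 + P $ 3 $ 3 * z\<^sup>2 + 2 * P $ 1 $ 2 * x * y + 2 * P $ 1 $ 3 * x * z + 2 * P $ 2 $ 3 * y * z"
    for x y z
    by (simp add: inner_vec_def matrix_vector_mult_def sum_3 s power2_eq_square algebra_simps)
  have nz: "(vector [x, y, z] :: real^3) \<noteq> 0" if "x \<noteq> 0 \<or> y \<noteq> 0 \<or> z \<noteq> 0" for x y z :: real
    using that by (auto simp: vec_eq_iff forall_3)
  have "P $ 1 $ 1 > 0" using pos[OF nz[of 1 0 0]] quad[of 1 0 0] by simp
  define a where "a = sqrt (P $ 1 $ 1)"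
  have a: "a > 0" "P $ 1 $ 1 = a * a" using \<open>P $ 1 $ 1 > 0\<close> by (auto simp: a_def)
  define b where "b = P $ 1 $ 2 / a"
  define c where "c = P $ 1 $ 3 / a"
  have bc: "P $ 1 $ 2 = a * b" "P $ 1 $ 3 = a * c" using a by (auto simp: b_def c_def)
  have "P $ 2 $ 2 - b * b > 0"
  proof -
    \<comment> \<open>The test vector is annihilated by the first row of the factor, so the form
      there is the Schur complement.\<close>
    have "0 < P $ 1 $ 1 * (- b / a)\<^sup>2 + P $ 2 $ 2 + 2 * P $ 1 $ 2 * (- b / a)"
      using pos[OF nz[of "- b / a" 1 0]] quad[of "- b / a" 1 0] by simp
    also have "\<dots> = P $ 2 $ 2 - b * b"
      using a(1) by (simp add: a(2) bc power2_eq_square field_simps)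
    finally show ?thesis .
  qed
  define d where "d = sqrt (P $ 2 $ 2 - b * b)"
  have d: "d > 0" "P $ 2 $ 2 = b * b + d * d" using \<open>P $ 2 $ 2 - b * b > 0\<close> by (auto simp: d_def)
  define e where "e = (P $ 2 $ 3 - b * c) / d"
  have e: "P $ 2 $ 3 = b * c + d * e" using d by (auto simp: e_def)
  have "P $ 3 $ 3 - c * c - e * e > 0"
  proof -
    \<comment> \<open>Back substitution: the first two rows of the factor annihilate
      \<open>(x, y, 1)\<close>, so the form there is exactly what is left for the last diagonal
      entry.\<close>
    define y where "y = - e / d"
    define x where "x = - (b * y + c) / a"
    have xy: "d * y + e = 0" "a * x + b * y + c = 0" using a d by (auto simp: x_def y_def)
    have "0 < P $ 1 $ 1 * x\<^sup>2 + P $ 2 $ 2 * y\<^sup>2 + P $ 3 $ 3 + 2 * P $ 1 $ 2 * x * y + 2 * P $ 1 $ 3 * x + 2 * P $ 2 $ 3 * y"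
      using pos[OF nz[of x y 1]] quad[of x y 1] by simp
    also have "\<dots> = (a * x + b * y + c)\<^sup>2 + (d * y + e)\<^sup>2 + (P $ 3 $ 3 - c * c - e * e)"
      by (simp add: a(2) bc d(2) e power2_eq_square algebra_simps)
    finally show ?thesis by (simp add: xy)
  qed
  define f where "f = sqrt (P $ 3 $ 3 - c * c - e * e)"
  have f: "f > 0" "P $ 3 $ 3 = c * c + e * e + f * f" using \<open>P $ 3 $ 3 - c * c - e * e > 0\<close> by (auto simp: f_def)
  define A :: "real^3^3" where "A = vector [vector [a, b, c], vector [0, d, e], vector [0, 0, f]]"
  show ?thesis
  proof
    show "transpose A ** A = P"
      by (simp add: vec_eq_iff forall_3 matrix_matrix_mult_def transpose_def sum_3 A_def a(2) bc d(2) e f(2) s algebra_simps)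
    show "v = 0" if t: "0 \<le> t" "t \<le> 1" and v: "linear_path t A v = 0" for t v
    proof -
      \<comment> \<open>The matrices on the segment are triangular, with diagonal entries of this
        form.\<close>
      have pos: "(1 - t) * k + t > 0" if "k > 0" for k
        using t that by (cases "t = 1") (auto intro: add_pos_nonneg)
      have v3: "((1 - t) * f + t) * v $ 3 = 0"
        and v2: "((1 - t) * d + t) * v $ 2 + (1 - t) * e * v $ 3 = 0"
        and v1: "((1 - t) * a + t) * v $ 1 + (1 - t) * b * v $ 2 + (1 - t) * c * v $ 3 = 0"
        using v by (simp_all add: linear_path_def vec_eq_iff forall_3 matrix_vector_mult_def sum_3 A_def algebra_simps)
      have "v $ 3 = 0" using v3 pos[OF f(1)] by simp
      moreover have "v $ 2 = 0" using v2 pos[OF d(1)] calculation by simp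
      moreover have "v $ 1 = 0" using v1 pos[OF a(1)] calculation by simp
      ultimately show "v = 0" by (simp add: vec_eq_iff forall_3)
    qed
  qed
qed

section \<open>Vitali covers by ellipsoids and finite subfamilies\<close>

type_synonym 'n ellipsoid = "(real^'n) \<times> (real^'n^'n) \<times> real"

definition cell :: "real \<Rightarrow> 'n ellipsoid \<Rightarrow> (real^'n) set" where
  "cell c E = (case E of (p, A, r) \<Rightarrow> {x. norm (A *v (x - p)) < c * r})"

lemma open_cell: "open (cell c E)"
proof -
  obtain p A r where E: "E = (p, A, r)" by (cases E)
  have "continuous_on UNIV (\<lambda>x. norm (A *v (x - p)))"
    by (intro continuous_intros bounded_bilinear.continuous_on[OF bounded_bilinear_matrix_vector_mult])
  then show ?thesis
    unfolding cell_def E by (auto intro!: open_Collect_less continuous_on_const)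
qed

text \<open>The map \<open>A\<close> turns these ellipsoids into balls. Vitali's theorem for balls
  is applied to the image of \<open>ball c \<rho>\<close> and carried back by the inverse map, which
  preserves negligible sets.\<close>

lemma ellipsoid_cover_ball:
  fixes A :: "real^'n^'n"
  assumes A: "\<And>v. A *v v = 0 \<Longrightarrow> v = 0" and \<delta>: "\<delta> > 0"
  obtains F where "countable F" "\<And>E. E \<in> F \<Longrightarrow> \<exists>p r. E = (p, A, r) \<and> 0 < r \<and> r < \<delta>"
    "\<And>E. E \<in> F \<Longrightarrow> cell 1 E \<subseteq> ball c \<rho>" "pairwise (\<lambda>E E'. disjnt (cell 1 E) (cell 1 E')) F"
    "negligible (ball c \<rho> - (\<Union>E\<in>F. cell 1 E))"
proof -
  have lin: "linear ((*v) A)" by simp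
  have "inj ((*v) A)" using A linear_injective_0[OF lin] by blast
  then have bij: "bij ((*v) A)" using linear_injective_imp_surjective[OF lin] by (simp add: bij_def)
  define B where "B = inv ((*v) A)"
  have BA: "B (A *v x) = x" and AB: "A *v B y = y" for x y
    using bij by (simp_all add: B_def bij_is_inj bij_is_surj surj_f_inv_f)
  have linB: "linear B"
    unfolding B_def using lin bij by (metis linear_injective_left_inverse bij_is_inj inv_unique_comp left_right_inverse_eq linear_surjective_right_inverse bij_is_surj)
  define T where "T = (*v) A ` ball c \<rho>"
  have "open T"
    unfolding T_def using lin \<open>inj ((*v) A)\<close> by (intro open_surjective_linear_image) (auto simp: bij bij_is_surj)
  define K where "K = {i. 0 < snd i \<and> snd i < \<delta> \<and> ball (fst i) (snd i) \<subseteq> T}"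
  have "\<exists>i. i \<in> K \<and> w \<in> ball (fst i) (snd i) \<and> snd i < d" if "w \<in> T" "0 < d" for w d
  proof -
    obtain e where e: "e > 0" "ball w e \<subseteq> T" using \<open>open T\<close> \<open>w \<in> T\<close> openE by blast
    define r where "r = min e (min d \<delta>) / 2"
    have r: "0 < r" "r < e" "r < d" "r < \<delta>" using e that \<delta> by (auto simp: r_def min_def)
    then have "ball w r \<subseteq> T" using e(2) by (meson ball_subset_ball_iff less_imp_le order_trans subset_ball)
    then show ?thesis using r by (intro exI[of _ "(w, r)"]) (auto simp: K_def)
  qed
  then obtain C where C: "countable C" "C \<subseteq> K" "pairwise (\<lambda>i j. disjnt (ball (fst i) (snd i)) (ball (fst j) (snd j))) C"
    "negligible (T - (\<Union>i\<in>C. ball (fst i) (snd i)))"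
    using Vitali_covering_theorem_balls[of T K fst snd] by blast
  define E where "E i = (B (fst i), A, snd i)" for i :: "(real^'n) \<times> real"
  have cellE: "x \<in> cell 1 (E i) \<longleftrightarrow> A *v x \<in> ball (fst i) (snd i)" for x i
    by (simp add: cell_def E_def matvec.diff_right AB dist_norm norm_minus_commute)
  show ?thesis
  proof
    show "countable (E ` C)" using C(1) by simp
    show "\<exists>p r. F = (p, A, r) \<and> 0 < r \<and> r < \<delta>" if "F \<in> E ` C" for F
      using that C(2) by (auto simp: E_def K_def simp del: mem_ball)
    show "cell 1 F \<subseteq> ball c \<rho>" if "F \<in> E ` C" for F
    proof
      fix x assume x: "x \<in> cell 1 F"
      obtain i where i: "i \<in> C" "F = E i" using \<open>F \<in> E ` C\<close> by blast
      then have "A *v x \<in> ball (fst i) (snd i)" using cellE x by blast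
      moreover have "ball (fst i) (snd i) \<subseteq> T" using i C(2) by (auto simp: K_def simp del: mem_ball)
      ultimately have "A *v x \<in> T" by blast
      then obtain x' where "x' \<in> ball c \<rho>" "A *v x = A *v x'" by (auto simp: T_def)
      then show "x \<in> ball c \<rho>" by (metis BA)
    qed
    show "pairwise (\<lambda>E E'. disjnt (cell 1 E) (cell 1 E')) (E ` C)"
    proof (rule pairwiseI)
      fix F F' assume F: "F \<in> E ` C" "F' \<in> E ` C" "F \<noteq> F'"
      then obtain i j where ij: "i \<in> C" "F = E i" "j \<in> C" "F' = E j" "i \<noteq> j" by blast
      then have "disjnt (ball (fst i) (snd i)) (ball (fst j) (snd j))"
        using C(3) by (simp add: pairwise_def)
      then show "disjnt (cell 1 F) (cell 1 F')"
        using cellE ij by (auto simp: disjnt_iff simp del: mem_ball)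
    qed
    have "negligible (B ` (T - (\<Union>i\<in>C. ball (fst i) (snd i))))"
      using C(4) linB
      by (intro negligible_differentiable_image_negligible order_refl)
        (auto intro: linear_imp_differentiable_on)
    moreover have "ball c \<rho> - (\<Union>F\<in>E ` C. cell 1 F) \<subseteq> B ` (T - (\<Union>i\<in>C. ball (fst i) (snd i)))"
    proof
      fix x assume x: "x \<in> ball c \<rho> - (\<Union>F\<in>E ` C. cell 1 F)"
      then have "A *v x \<in> T - (\<Union>i\<in>C. ball (fst i) (snd i))"
        using cellE by (auto simp: T_def simp del: mem_ball)
      then show "x \<in> B ` (T - (\<Union>i\<in>C. ball (fst i) (snd i)))" using BA by (metis imageI)
    qed
    ultimately show "negligible (ball c \<rho> - (\<Union>F\<in>E ` C. cell 1 F))"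
      by (rule negligible_subset)
  qed
qed

text \<open>On each ball of a first Vitali cover, \<open>g\<close> is almost constant and determines the shape of
  the ellipsoids of a second one.\<close>

lemma ellipsoid_cover:
  fixes g :: "real^3 \<Rightarrow> real^3^3"
  assumes U: "open U" and cont: "continuous_on U g" and \<eta>: "\<eta> > 0"
    and sym: "\<And>x. x \<in> U \<Longrightarrow> transpose (g x) = g x"
    and pos: "\<And>x v. x \<in> U \<Longrightarrow> v \<noteq> 0 \<Longrightarrow> 0 < v \<bullet> (g x *v v)"
  obtains F where "countable F" "pairwise (\<lambda>E E'. disjnt (cell 1 E) (cell 1 E')) F"
    "\<And>p A r. (p, A, r) \<in> F \<Longrightarrow> 0 < r \<and> r\<^sup>2 * norm (transpose A ** A) < \<eta> \<and>
       (\<forall>t v. 0 \<le> t \<longrightarrow> t \<le> 1 \<longrightarrow> linear_path t A v = 0 \<longrightarrow> v = 0) \<and> cell 1 (p, A, r) \<subseteq> U \<and>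
       (\<forall>x\<in>cell 1 (p, A, r). norm (g x - transpose A ** A) < \<eta>)"
    "negligible (U - (\<Union>E\<in>F. cell 1 E))"
proof -
  define K where "K = {i. 0 < snd i \<and> ball (fst i) (snd i) \<subseteq> U \<and>
    (\<forall>x\<in>ball (fst i) (snd i). norm (g x - g (fst i)) < \<eta>)}"
  have "\<exists>i. i \<in> K \<and> c \<in> ball (fst i) (snd i) \<and> snd i < d" if c: "c \<in> U" and "0 < d" for c d
  proof -
    obtain e where e: "e > 0" "ball c e \<subseteq> U" using U c openE by blast
    obtain e' where e': "e' > 0" "\<And>x. x \<in> U \<Longrightarrow> dist x c < e' \<Longrightarrow> norm (g x - g c) < \<eta>"
      using cont c \<eta> unfolding continuous_on_iff dist_norm by meson
    define \<rho> where "\<rho> = min e (min d e') / 2"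
    have \<rho>: "0 < \<rho>" "\<rho> < e" "\<rho> < d" "\<rho> < e'" using e e' that by (auto simp: \<rho>_def min_def)
    have sub: "ball c \<rho> \<subseteq> U" using e(2) \<rho>(2) by (meson less_imp_le order_trans subset_ball)
    have "norm (g x - g c) < \<eta>" if "x \<in> ball c \<rho>" for x
      using that \<rho> sub by (intro e'(2)) (auto simp: dist_commute)
    then show ?thesis using \<rho> sub by (intro exI[of _ "(c, \<rho>)"]) (auto simp: K_def)
  qed
  then obtain C where C: "countable C" "C \<subseteq> K" "pairwise (\<lambda>i j. disjnt (ball (fst i) (snd i)) (ball (fst j) (snd j))) C"
    "negligible (U - (\<Union>i\<in>C. ball (fst i) (snd i)))"
    using Vitali_covering_theorem_balls[of U K fst snd] by blast
  define good where "good c A F i \<longleftrightarrow> transpose A ** A = g c \<and>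
      (\<forall>t v. 0 \<le> t \<longrightarrow> t \<le> 1 \<longrightarrow> linear_path t A v = 0 \<longrightarrow> v = 0) \<and>
      countable F \<and> (\<forall>E\<in>F. \<exists>p r. E = (p, A, r) \<and> 0 < r \<and> r\<^sup>2 * norm (transpose A ** A) < \<eta>) \<and>
      (\<forall>E\<in>F. cell 1 E \<subseteq> ball (fst i) (snd i)) \<and> pairwise (\<lambda>E E'. disjnt (cell 1 E) (cell 1 E')) F \<and>
      negligible (ball (fst i) (snd i) - (\<Union>E\<in>F. cell 1 E))"
    for c :: "real^3" and A and F :: "(3 ellipsoid) set" and i :: "(real^3) \<times> real"
  have "\<exists>F. \<exists>A. good (fst i) A F i" if "i \<in> C" for i
  proof -
    have "0 < snd i" "ball (fst i) (snd i) \<subseteq> U" using that C(2) by (auto simp: K_def simp del: mem_ball)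
    then have "fst i \<in> U" by (meson centre_in_ball subsetD)
    then obtain A where A: "transpose A ** A = g (fst i)" "\<And>t v. 0 \<le> t \<Longrightarrow> t \<le> 1 \<Longrightarrow> linear_path t A v = 0 \<Longrightarrow> v = 0"
      using cholesky_3[OF sym pos] by blast
    have inj: "v = 0" if "A *v v = 0" for v
      using A(2)[of 0 v] that by (simp add: linear_path_def)
    define m where "m = norm (transpose A ** A) + 1"
    have m: "m > 0" "norm (transpose A ** A) < m" by (auto simp: m_def add_nonneg_pos)
    \<comment> \<open>A radius below 1 satisfies \<open>r\<^sup>2 \<le> r\<close>, and one below
      \<open>\<eta> / m\<close> then meets the bound on
      \<open>r\<^sup>2 * norm (transpose A ** A)\<close>.\<close>
    have \<delta>: "min 1 (\<eta> / m) > 0" using m \<eta> by simp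
    obtain F where F: "countable F" "\<And>E. E \<in> F \<Longrightarrow> \<exists>p r. E = (p, A, r) \<and> 0 < r \<and> r < min 1 (\<eta> / m)"
      "\<And>E. E \<in> F \<Longrightarrow> cell 1 E \<subseteq> ball (fst i) (snd i)" "pairwise (\<lambda>E E'. disjnt (cell 1 E) (cell 1 E')) F"
      "negligible (ball (fst i) (snd i) - (\<Union>E\<in>F. cell 1 E))"
      by (rule ellipsoid_cover_ball[OF inj \<delta>, where c = "fst i" and \<rho> = "snd i"]) blast+
    have "r\<^sup>2 * norm (transpose A ** A) < \<eta>" if "0 < r" "r < min 1 (\<eta> / m)" for r
    proof -
      have "r\<^sup>2 * norm (transpose A ** A) \<le> r * m"
        using that m by (intro mult_mono) (auto simp: power2_eq_square mult_le_cancel_left1)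
      also have "\<dots> < \<eta>" using that m by (simp add: field_simps)
      finally show ?thesis .
    qed
    then have r: "\<forall>E\<in>F. \<exists>p r. E = (p, A, r) \<and> 0 < r \<and> r\<^sup>2 * norm (transpose A ** A) < \<eta>"
      using F(2) by meson
    have "good (fst i) A F i"
      unfolding good_def
    proof (intro conjI)
      show "\<forall>t v. 0 \<le> t \<longrightarrow> t \<le> 1 \<longrightarrow> linear_path t A v = 0 \<longrightarrow> v = 0" using A(2) by blast
      show "\<forall>E\<in>F. cell 1 E \<subseteq> ball (fst i) (snd i)" using F(3) by blast
    qed (rule A(1) F(1) r F(4) F(5))+
    then show ?thesis by blast
  qed
  then obtain F where F: "\<And>i. i \<in> C \<Longrightarrow> \<exists>A. good (fst i) A (F i) i" by metis
  show ?thesis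
  proof
    show "countable (\<Union>i\<in>C. F i)"
      using C(1) F by (intro countable_UN) (auto simp: good_def)
    show "pairwise (\<lambda>E E'. disjnt (cell 1 E) (cell 1 E')) (\<Union>i\<in>C. F i)"
    proof (rule pairwiseI)
      fix E E' assume EE: "E \<in> (\<Union>i\<in>C. F i)" "E' \<in> (\<Union>i\<in>C. F i)" "E \<noteq> E'"
      then obtain i j where ij: "i \<in> C" "E \<in> F i" "j \<in> C" "E' \<in> F j" by blast
      show "disjnt (cell 1 E) (cell 1 E')"
      proof (cases "i = j")
        case True
        then show ?thesis using F[OF ij(1)] ij EE(3) by (auto simp: good_def pairwise_def)
      next
        case False
        then have "disjnt (ball (fst i) (snd i)) (ball (fst j) (snd j))"
          using C(3) ij by (auto simp: pairwise_def)
        moreover have "cell 1 E \<subseteq> ball (fst i) (snd i)" "cell 1 E' \<subseteq> ball (fst j) (snd j)"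
          using F[OF ij(1)] F[OF ij(3)] ij by (auto simp: good_def)
        ultimately show ?thesis by (meson disjnt_subset1 disjnt_subset2)
      qed
    qed
    show "0 < r \<and> r\<^sup>2 * norm (transpose A ** A) < \<eta> \<and>
       (\<forall>t v. 0 \<le> t \<longrightarrow> t \<le> 1 \<longrightarrow> linear_path t A v = 0 \<longrightarrow> v = 0) \<and> cell 1 (p, A, r) \<subseteq> U \<and>
       (\<forall>x\<in>cell 1 (p, A, r). norm (g x - transpose A ** A) < \<eta>)"
      if "(p, A, r) \<in> (\<Union>i\<in>C. F i)" for p A r
    proof -
      obtain i where i: "i \<in> C" "(p, A, r) \<in> F i"
        using \<open>(p, A, r) \<in> (\<Union>i\<in>C. F i)\<close> by blast
      obtain A' where A': "good (fst i) A' (F i) i" using F[OF i(1)] by blast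
      then have "\<exists>p' r'. (p, A, r) = (p', A', r') \<and> 0 < r' \<and> r'\<^sup>2 * norm (transpose A' ** A') < \<eta>"
        using i(2) unfolding good_def by blast
      then have AA: "A' = A" and r: "0 < r" "r\<^sup>2 * norm (transpose A ** A) < \<eta>" by auto
      have sub: "cell 1 (p, A, r) \<subseteq> ball (fst i) (snd i)"
        using A' i(2) unfolding good_def by blast
      have K: "ball (fst i) (snd i) \<subseteq> U" "\<And>x. x \<in> ball (fst i) (snd i) \<Longrightarrow> norm (g x - g (fst i)) < \<eta>"
        using i(1) C(2) by (auto simp: K_def simp del: mem_ball)
      have gA: "transpose A ** A = g (fst i)" and path: "\<forall>t v. 0 \<le> t \<longrightarrow> t \<le> 1 \<longrightarrow> linear_path t A v = 0 \<longrightarrow> v = 0"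
        using A' unfolding good_def AA by blast+
      show ?thesis using r sub K path unfolding gA by blast
    qed
    have "negligible ((U - (\<Union>i\<in>C. ball (fst i) (snd i))) \<union> (\<Union>i\<in>C. ball (fst i) (snd i) - (\<Union>E\<in>F i. cell 1 E)))"
      using C(1,4) F by (intro negligible_Un negligible_countable_Union) (auto simp: good_def)
    then show "negligible (U - (\<Union>E\<in>(\<Union>i\<in>C. F i). cell 1 E))"
      by (rule negligible_subset) blast
  qed
qed

lemma cell_mono: "c \<le> c' \<Longrightarrow> 0 \<le> r \<Longrightarrow> cell c (p, A, r) \<subseteq> cell c' (p, A, r)"
  by (auto simp: cell_def intro: order_less_le_trans mult_right_mono)

text \<open>Truncating the countable family and shrinking its ellipsoids leaves decreasing
  remainders with negligible intersection. They have finite measure because \<open>U\<close> is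
  bounded, so their measures tend to 0.\<close>

lemma finite_ellipsoid_cover:
  fixes g :: "real^3 \<Rightarrow> real^3^3"
  assumes U: "open U" "bounded U" and cont: "continuous_on U g" and \<eta>: "\<eta> > 0"
    and sym: "\<And>x. x \<in> U \<Longrightarrow> transpose (g x) = g x"
    and pos: "\<And>x v. x \<in> U \<Longrightarrow> v \<noteq> 0 \<Longrightarrow> 0 < v \<bullet> (g x *v v)"
  obtains F \<kappa> where "finite F" "0 < \<kappa>" "\<kappa> < 1" "pairwise (\<lambda>E E'. disjnt (cell 1 E) (cell 1 E')) F"
    "\<And>p A r. (p, A, r) \<in> F \<Longrightarrow> 0 < r \<and> r\<^sup>2 * norm (transpose A ** A) < \<eta> \<and>
       (\<forall>t v. 0 \<le> t \<longrightarrow> t \<le> 1 \<longrightarrow> linear_path t A v = 0 \<longrightarrow> v = 0) \<and> cell 1 (p, A, r) \<subseteq> U \<and>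
       (\<forall>x\<in>cell 1 (p, A, r). norm (g x - transpose A ** A) < \<eta>)"
    "measure lebesgue (U - (\<Union>E\<in>F. cell \<kappa> E)) < \<eta>"
proof -
  obtain F where F: "countable F" "pairwise (\<lambda>E E'. disjnt (cell 1 E) (cell 1 E')) F"
    "\<And>p A r. (p, A, r) \<in> F \<Longrightarrow> 0 < r \<and> r\<^sup>2 * norm (transpose A ** A) < \<eta> \<and>
       (\<forall>t v. 0 \<le> t \<longrightarrow> t \<le> 1 \<longrightarrow> linear_path t A v = 0 \<longrightarrow> v = 0) \<and> cell 1 (p, A, r) \<subseteq> U \<and>
       (\<forall>x\<in>cell 1 (p, A, r). norm (g x - transpose A ** A) < \<eta>)"
    "negligible (U - (\<Union>E\<in>F. cell 1 E))"
    by (rule ellipsoid_cover[OF U(1) cont \<eta> sym pos]) blast+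
  \<comment> \<open>The same index governs shrinking and truncation, which gives a single decreasing
    sequence of remainders. The factors increase to 1 but stay below it, so that each ellipsoid
    keeps a shell.\<close>
  define k :: "nat \<Rightarrow> real" where "k n = 1 - 1 / (real n + 2)" for n
  have k: "0 < k n" "k n < 1" for n by (auto simp: k_def field_simps)
  have k_mono: "k n \<le> k m" if "n \<le> m" for n m using that by (auto simp: k_def field_simps)
  have k_lim: "k \<longlonglongrightarrow> 1" unfolding k_def by real_asymp
  define Fn where "Fn n = {E \<in> F. to_nat_on F E \<le> n}" for n
  have fin: "finite (Fn n)" for n
  proof -
    have "inj_on (to_nat_on F) (Fn n)"
      using inj_on_to_nat_on[OF F(1)] by (rule inj_on_subset) (auto simp: Fn_def)
    moreover have "to_nat_on F ` Fn n \<subseteq> {..n}" by (auto simp: Fn_def)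
    ultimately show ?thesis by (meson finite_atMost inj_on_finite)
  qed
  define R where "R n = U - (\<Union>E\<in>Fn n. cell (k n) E)" for n
  have R_sets: "R n \<in> sets lebesgue" for n
    unfolding R_def using U(1) open_cell
    by (intro sets.Diff sets_completionI_sets) (auto intro!: borel_open open_UN)
  have "decseq R"
  proof (rule decseq_SucI, rule)
    fix n x assume x: "x \<in> R (Suc n)"
    have "x \<notin> cell (k n) E" if "E \<in> Fn n" for E
    proof -
      obtain p A r where E: "E = (p, A, r)" by (cases E)
      have "E \<in> Fn (Suc n)" using that by (auto simp: Fn_def)
      then have "x \<notin> cell (k (Suc n)) E" using x by (auto simp: R_def)
      moreover have "cell (k n) E \<subseteq> cell (k (Suc n)) E"
        unfolding E using F(3)[of p A r] that E by (intro cell_mono k_mono) (auto simp: Fn_def)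
      ultimately show ?thesis by blast
    qed
    then show "x \<in> R n" using x by (auto simp: R_def)
  qed
  have "(\<Inter>n. R n) = U - (\<Union>E\<in>F. cell 1 E)"
  proof (intro equalityI subsetI)
    fix x assume x: "x \<in> (\<Inter>n. R n)"
    have "x \<notin> cell 1 E" if E: "E \<in> F" for E
    proof
      assume xE: "x \<in> cell 1 E"
      obtain p A r where Eq: "E = (p, A, r)" by (cases E)
      have "norm (A *v (x - p)) < r" using xE by (simp add: Eq cell_def)
      moreover have "(\<lambda>n. k n * r) \<longlonglongrightarrow> 1 * r" by (intro tendsto_intros k_lim)
      ultimately have "eventually (\<lambda>n. norm (A *v (x - p)) < k n * r) sequentially"
        using order_tendstoD(1)[of "\<lambda>n. k n * r" "1 * r"] by simp
      then obtain n where n: "n \<ge> to_nat_on F E" "norm (A *v (x - p)) < k n * r"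
        unfolding eventually_sequentially by (meson nat_le_linear)
      then have "x \<in> cell (k n) E" "E \<in> Fn n" using E by (auto simp: Eq cell_def Fn_def)
      then show False using x by (auto simp: R_def)
    qed
    then show "x \<in> U - (\<Union>E\<in>F. cell 1 E)" using x by (auto simp: R_def)
  next
    fix x assume x: "x \<in> U - (\<Union>E\<in>F. cell 1 E)"
    have "x \<notin> cell (k n) E" if "E \<in> F" for n E
    proof -
      obtain p A r where E: "E = (p, A, r)" by (cases E)
      have "cell (k n) E \<subseteq> cell 1 E"
        unfolding E using F(3)[of p A r] that E k(2)[of n] by (intro cell_mono) auto
      then show ?thesis using x that by blast
    qed
    then show "x \<in> (\<Inter>n. R n)" using x by (auto simp: R_def Fn_def)
  qed
  then have "measure lebesgue (\<Inter>n. R n) = 0"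
    using F(4) negligible_imp_measure0 by simp
  moreover have "(\<lambda>n. measure lebesgue (R n)) \<longlonglongrightarrow> measure lebesgue (\<Inter>n. R n)"
  proof (rule Lim_measure_decseq)
    show "range R \<subseteq> sets lebesgue" using R_sets by blast
    show "emeasure lebesgue (R n) \<noteq> \<infinity>" for n
    proof -
      have "bounded (R n)" using U(2) by (rule bounded_subset) (auto simp: R_def)
      then have "R n \<in> lmeasurable" using R_sets by (simp add: bounded_set_imp_lmeasurable)
      then show ?thesis by (metis fmeasurableD2 infinity_ennreal_def)
    qed
  qed fact
  ultimately have "eventually (\<lambda>n. measure lebesgue (R n) < \<eta>) sequentially"
    using \<eta> order_tendstoD(2)[of "\<lambda>n. measure lebesgue (R n)" 0] by simp
  then obtain n where n: "measure lebesgue (R n) < \<eta>"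
    using eventually_happens'[OF sequentially_bot] by blast
  show ?thesis
  proof (rule that[of "Fn n" "k n"])
    show "pairwise (\<lambda>E E'. disjnt (cell 1 E) (cell 1 E')) (Fn n)"
      using F(2) by (rule pairwise_subset) (auto simp: Fn_def)
    show "measure lebesgue (U - (\<Union>E\<in>Fn n. cell (k n) E)) < \<eta>"
      using n by (simp add: R_def)
  qed (use fin k F(3) in \<open>auto simp: Fn_def\<close>)
qed

section \<open>Approximation in measure\<close>

text \<open>The right side is \<open>1 / (1 + N\<^sup>2)\<^sup>2\<close>, convex in
  \<open>N\<^sup>2\<close>, and the left side is its tangent at 0. It controls the loss of a bubble
  metric against its value at the centre.\<close>

lemma one_minus_le_inverse_sqrt_power4: "1 - 2 * N\<^sup>2 \<le> (1 / sqrt (N\<^sup>2 + 1)) ^ 4"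
proof -
  have "sqrt (N\<^sup>2 + 1) ^ 4 = (N\<^sup>2 + 1)\<^sup>2"
    using real_sqrt_pow2[of "N\<^sup>2 + 1"] by (metis add_nonneg_nonneg mult_2 numeral_Bit0 power_add power2_eq_square zero_le_one zero_le_power2)
  moreover have "(1 - 2 * N\<^sup>2) * (N\<^sup>2 + 1)\<^sup>2 \<le> 1"
  proof -
    have "(1 - 2 * N\<^sup>2) * (N\<^sup>2 + 1)\<^sup>2 = 1 - 3 * (N\<^sup>2)\<^sup>2 - 2 * (N\<^sup>2)\<^sup>2 * N\<^sup>2"
      by (simp add: power2_eq_square algebra_simps)
    moreover have "0 \<le> (N\<^sup>2)\<^sup>2" "0 \<le> (N\<^sup>2)\<^sup>2 * N\<^sup>2" by simp_all
    ultimately show ?thesis by linarith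
  qed
  moreover have "N\<^sup>2 + 1 > 0" by (simp add: add_nonneg_pos)
  ultimately show ?thesis
    by (simp add: power_divide pos_le_divide_eq)
qed

text \<open>The first summand is the bubble of the cell itself, at most 1, and \<open>b\<close>
  collects all other terms. Only \<open>b\<close> can push the value above 1, and only the first
  summand can pull it below.\<close>

lemma power4_deviation:
  fixes N b :: real
  assumes "0 \<le> b" "b \<le> \<delta>" "0 \<le> N" "N \<le> r"
  shows "\<bar>(1 / sqrt (N\<^sup>2 + 1) + b) ^ 4 - 1\<bar> \<le> max (2 * r\<^sup>2) ((1 + \<delta>) ^ 4 - 1)"
proof -
  let ?a = "1 / sqrt (N\<^sup>2 + 1)"
  have a: "0 \<le> ?a" by (intro divide_nonneg_nonneg) auto
  have a1: "?a \<le> 1" using frac_le[of 1 1 1 "sqrt (N\<^sup>2 + 1)"] by simp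
  have "(?a + b) ^ 4 \<le> (1 + \<delta>) ^ 4" using a a1 assms by (intro power_mono) auto
  moreover have "?a ^ 4 \<le> (?a + b) ^ 4" using a assms by (intro power_mono) auto
  moreover have "1 - 2 * r\<^sup>2 \<le> 1 - 2 * N\<^sup>2" using assms by (simp add: power_mono)
  ultimately show ?thesis
    using one_minus_le_inverse_sqrt_power4[of N] by (auto simp: abs_le_iff max_def)
qed

lemma invertible_mat: "c \<noteq> 0 \<Longrightarrow> invertible (mat c :: real^'n^'n)"
  unfolding invertible_def
  by (intro exI[of _ "mat (1 / c)"]) (simp add: mat_eq_scaleR[of c] mat_eq_scaleR[of "1 / c"]
      matmul.scaleR_left matmul.scaleR_right)

lemma pullback_conformal:
  assumes "jacobian \<Phi> x = s *\<^sub>R A"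
  shows "pullback_metric \<Phi> (\<lambda>y. mat (u y)) x = (s\<^sup>2 * u (\<Phi> x)) *\<^sub>R (transpose A ** A)"
  by (simp add: pullback_metric_def assms transpose_scalar mat_eq_scaleR[of "u (\<Phi> x)"]
      matmul.scaleR_left matmul.scaleR_right power2_eq_square)

lemma riemannian_metric_pullback_conformal:
  fixes \<Phi> :: "real^'n \<Rightarrow> real^'n"
  assumes \<Phi>: "smooth_on UNIV \<Phi>" "\<And>x. invertible (jacobian \<Phi> x)"
    and u: "smooth_on UNIV u" "\<And>y. u y > 0"
  shows "metric_pullback UNIV UNIV \<Phi> (\<lambda>y. mat (u y))"
    and "riemannian_metric_on S (pullback_metric \<Phi> (\<lambda>y. mat (u y)))"
proof -
  have "u y \<noteq> 0" for y using u(2)[of y] by simp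
  then show mp: "metric_pullback UNIV UNIV \<Phi> (\<lambda>y. mat (u y))"
    using \<Phi> smooth_on_mat[OF open_UNIV u(1)] by unfold_locales (auto intro: invertible_mat)
  have "transpose (pullback_metric \<Phi> (\<lambda>y. mat (u y)) x) = pullback_metric \<Phi> (\<lambda>y. mat (u y)) x" for x
    by (simp add: pullback_metric_def matrix_transpose_mul matrix_mul_assoc)
  moreover have "0 < v \<bullet> (pullback_metric \<Phi> (\<lambda>y. mat (u y)) x *v v)" if "v \<noteq> 0" for x v
  proof -
    let ?J = "jacobian \<Phi> x"
    have "?J *v v \<noteq> 0"
      using invertible_mult_eq[OF \<Phi>(2)[of x], of v 0] that by auto
    then have "0 < u (\<Phi> x) * ((?J *v v) \<bullet> (?J *v v))" using u(2)[of "\<Phi> x"] by simp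
    also have "\<dots> = v \<bullet> (transpose ?J *v (mat (u (\<Phi> x)) *v (?J *v v)))"
      by (simp only: inner_matrix_transpose[of _ ?J, symmetric] mat_eq_scaleR[of "u (\<Phi> x)"] matvec.scaleR_left
          matrix_vector_mul_lid inner_scaleR_left)
    also have "\<dots> = v \<bullet> (pullback_metric \<Phi> (\<lambda>y. mat (u y)) x *v v)"
      by (simp only: pullback_metric_def matrix_vector_mul_assoc matrix_mul_assoc)
    finally show ?thesis .
  qed
  ultimately show "riemannian_metric_on S (pullback_metric \<Phi> (\<lambda>y. mat (u y)))"
    using metric_pullback.smooth_G[OF mp] smooth_on_subset unfolding riemannian_metric_on_def by blast
qed

text \<open>One \<eta> of the error is the distance of \<open>g\<close> from
  \<open>transpose A ** A\<close> on a cell. The other two bound the deviation of \<open>G\<close>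
  from it, where the small radius controls \<open>2 * r\<^sup>2\<close> and the small
  \<open>s\<close> the influence of the other bubbles. \<open>N\<close> is what the shrunk cells
  miss.\<close>

lemma approximate_metric:
  fixes g :: "real^3 \<Rightarrow> real^3^3"
  assumes g: "riemannian_metric_on (ball 0 1) g" and \<eta>: "\<eta> > 0"
  obtains G N where "riemannian_metric_on (ball 0 1) G" "\<And>x. scalar_curvature G x \<ge> 1"
    "N \<in> lmeasurable" "measure lebesgue N < \<eta>"
    "\<And>x. x \<in> ball 0 1 - N \<Longrightarrow> norm (G x - g x) < 3 * \<eta>"
proof -
  have g': "continuous_on (ball 0 1) g" "\<And>x. x \<in> ball 0 1 \<Longrightarrow> transpose (g x) = g x"
    "\<And>x v. x \<in> ball 0 1 \<Longrightarrow> v \<noteq> 0 \<Longrightarrow> 0 < v \<bullet> (g x *v v)"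
    using g smooth_on_imp_continuous_on unfolding riemannian_metric_on_def by blast+
  obtain F \<kappa> where F: "finite F" "0 < \<kappa>" "\<kappa> < 1" "pairwise (\<lambda>E E'. disjnt (cell 1 E) (cell 1 E')) F"
    "\<And>p A r. (p, A, r) \<in> F \<Longrightarrow> 0 < r \<and> r\<^sup>2 * norm (transpose A ** A) < \<eta> \<and>
       (\<forall>t v. 0 \<le> t \<longrightarrow> t \<le> 1 \<longrightarrow> linear_path t A v = 0 \<longrightarrow> v = 0) \<and> cell 1 (p, A, r) \<subseteq> ball 0 1 \<and>
       (\<forall>x\<in>cell 1 (p, A, r). norm (g x - transpose A ** A) < \<eta>)"
    "measure lebesgue (ball 0 1 - (\<Union>E\<in>F. cell \<kappa> E)) < \<eta>"
    by (rule finite_ellipsoid_cover[OF open_ball bounded_ball g'(1) \<eta> g'(2,3)]) blast+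
  have centre: "fst E \<in> cell 1 E" if "E \<in> F" for E
  proof -
    obtain p A r where E: "E = (p, A, r)" by (cases E)
    show ?thesis using F(5)[of p A r] that by (simp add: E cell_def)
  qed
  \<comment> \<open>A centre lies in its own cell, so by disjointness it determines the cell. Matrix
    and radius thus become functions of the centre, as \<open>cells\<close> expects.\<close>
  have inj: "inj_on fst F"
  proof (rule inj_onI)
    fix E E' assume E: "E \<in> F" "E' \<in> F" "fst E = fst E'"
    have "fst E \<in> cell 1 E" "fst E' \<in> cell 1 E'"
      using centre E by blast+
    then show "E = E'"
      using F(4) E unfolding pairwise_def disjnt_iff by metis
  qed
  define I where "I = fst ` F"
  define A where "A p = fst (snd (inv_into F fst p))" for p
  define r where "r p = snd (snd (inv_into F fst p))" for p
  have sel: "(p, A p, r p) = inv_into F fst p" if "p \<in> I" for p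
    using f_inv_into_f[of p fst F] that by (simp add: I_def A_def r_def prod_eq_iff)
  have inF: "(p, A p, r p) \<in> F" if "p \<in> I" for p
    using inv_into_into[of p fst F] that sel[OF that] by (simp add: I_def)
  have FI: "p \<in> I" "A p = M" "r p = R" if "(p, M, R) \<in> F" for p M R
    using that inv_into_f_f[OF inj that] by (auto simp: I_def A_def r_def image_iff intro: bexI[OF _ that])
  note props = F(5)[OF inF]
  let ?P = "\<lambda>p. transpose (A p) ** A p"
  have finI: "finite I" using F(1) by (simp add: I_def)
  interpret c: cells I A r \<kappa>
  proof
    show "p = q" if "p \<in> I" "q \<in> I" "norm (A p *v (x - p)) < r p" "norm (A q *v (x - q)) < r q" for p q x
    proof (rule ccontr)
      assume "p \<noteq> q"
      then have "disjnt (cell 1 (p, A p, r p)) (cell 1 (q, A q, r q))"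
        using F(4) inF that by (auto simp: pairwise_def)
      then show False using that by (auto simp: disjnt_iff cell_def)
    qed
  qed (use finI F(2,3) props in auto)
  have I1: "norm p \<le> 1" if "p \<in> I" for p
    using centre[OF inF[OF that]] props[OF that] by (auto simp: subset_iff)
  obtain d where d: "d > 0" "\<And>p q. p \<in> I \<Longrightarrow> q \<in> I \<Longrightarrow> p \<noteq> q \<Longrightarrow> dist p q \<ge> d"
    using finite_separated[OF finI] by blast
  \<comment> \<open>An upper bound for \<open>b\<close> below: \<open>bubble 0 1\<close> is at most
    1, and a bubble at distance at least \<open>d / 2\<close> from its centre is at most
    \<open>2 / d\<close>.\<close>
  define \<delta> where "\<delta> s = sqrt s * (1 / 10 + real (card I) * (sqrt s * (2 / d)))" for s
  \<comment> \<open>The image of a shrunk cell lies within \<open>s * r p\<close> of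
    \<open>p\<close>, hence at distance at least \<open>d / 2\<close> from all other
    centres.\<close>
  have "eventually (\<lambda>s. \<forall>p\<in>I. s * r p < d / 2) (at_right 0)"
  proof (intro eventually_ball_finite ballI finI)
    fix p
    have "((\<lambda>s. s * r p) \<longlongrightarrow> 0 * r p) (at_right 0)" by (intro tendsto_intros)
    then show "eventually (\<lambda>s. s * r p < d / 2) (at_right 0)"
      by (rule order_tendstoD) (use d(1) in simp)
  qed
  moreover have "eventually (\<lambda>s. \<forall>p\<in>I. ((1 + \<delta> s) ^ 4 - 1) * norm (?P p) < \<eta>) (at_right 0)"
  proof (intro eventually_ball_finite ballI finI)
    fix p
    have "((\<lambda>s. ((1 + \<delta> s) ^ 4 - 1) * norm (?P p)) \<longlongrightarrow>
        ((1 + sqrt 0 * (1 / 10 + real (card I) * (sqrt 0 * (2 / d)))) ^ 4 - 1) * norm (?P p)) (at_right 0)"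
      unfolding \<delta>_def by (intro tendsto_intros)
    then show "eventually (\<lambda>s. ((1 + \<delta> s) ^ 4 - 1) * norm (?P p) < \<eta>) (at_right 0)"
      by (rule order_tendstoD) (use \<eta> in simp)
  qed
  moreover have "eventually (\<lambda>s. \<forall>y. scalar_curvature (\<lambda>y. mat (bubbles I s y ^ 4)) y \<ge> 1) (at_right 0)"
    by (rule scalar_curvature_bubbles_ge_1[OF finI I1])
  moreover note c.immersion
  moreover have "eventually (\<lambda>s. s > 0) (at_right (0::real))"
    by (simp add: eventually_at_right_less)
  ultimately have "eventually (\<lambda>s. (\<forall>p\<in>I. s * r p < d / 2) \<and> (\<forall>p\<in>I. ((1 + \<delta> s) ^ 4 - 1) * norm (?P p) < \<eta>) \<and>
      (\<forall>y. scalar_curvature (\<lambda>y. mat (bubbles I s y ^ 4)) y \<ge> 1) \<and> (\<forall>x. invertible (jacobian (c.\<Phi> s) x)) \<and> s > 0)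
      (at_right 0)"
    by eventually_elim blast
  then obtain s where s: "\<And>p. p \<in> I \<Longrightarrow> s * r p < d / 2"
      "\<And>p. p \<in> I \<Longrightarrow> ((1 + \<delta> s) ^ 4 - 1) * norm (?P p) < \<eta>"
      "\<And>y. scalar_curvature (\<lambda>y. mat (bubbles I s y ^ 4)) y \<ge> 1"
      "\<And>x. invertible (jacobian (c.\<Phi> s) x)" "s > 0"
    using eventually_happens'[OF trivial_limit_at_right_real] by blast
  define u where "u y = bubbles I s y ^ 4" for y
  have u: "smooth_on UNIV u" "u y > 0" for y
    unfolding u_def using s(5) bubbles_pos[OF s(5), of I y]
    by (auto intro!: smooth_on_power smooth_on_bubbles)
  define G where "G = pullback_metric (c.\<Phi> s) (\<lambda>y. mat (u y))"
  note mp = riemannian_metric_pullback_conformal[OF c.smooth_\<Phi>[OF s(5)] s(4) u]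
  have close: "norm (G x - g x) < 3 * \<eta>" if p: "p \<in> I" and x: "x \<in> cell \<kappa> (p, A p, r p)" for p x
  proof -
    define N where "N = norm (A p *v (x - p))"
    have rp: "r p > 0" using props[OF p] by blast
    have N: "0 \<le> N" "N < \<kappa> * r p" using x by (auto simp: cell_def N_def)
    have "\<kappa> * r p < r p" using rp F(3) by simp
    then have Nr: "N \<le> r p" using N by linarith
    let ?y = "c.\<Phi> s x"
    have y: "?y = p + s *\<^sub>R (A p *v (x - p))" "jacobian (c.\<Phi> s) x = s *\<^sub>R A p"
      using c.\<Phi>_inner[OF s(5) p] N(2) by (auto simp: N_def)
    have yp: "norm (?y - p) = s * N" using s(5) by (simp add: y N_def)
    \<comment> \<open>The Jacobian contributes \<open>s\<^sup>2\<close>, the fourth power of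
      \<open>sqrt s\<close>. So \<open>sqrt s * bubbles I s ?y\<close> is what matters, split into
      the bubble of \<open>p\<close>, which in terms of \<open>N\<close> no longer depends on
      \<open>s\<close>, and the rest \<open>b\<close>.\<close>
    define b where "b = sqrt s * (1 / 10 * bubble 0 1 ?y + (\<Sum>q\<in>I - {p}. sqrt s * bubble q s ?y))"
    have own: "s * bubble p s ?y = 1 / sqrt (N\<^sup>2 + 1)"
    proof -
      have "sqrt ((s * N)\<^sup>2 + s\<^sup>2) = sqrt (s\<^sup>2 * (N\<^sup>2 + 1))" by (simp add: power_mult_distrib algebra_simps)
      also have "\<dots> = s * sqrt (N\<^sup>2 + 1)" using s(5) by (simp add: real_sqrt_mult)
      finally show ?thesis using s(5) by (simp add: bubble_eq yp)
    qed
    have "sqrt s * bubbles I s ?y = sqrt s * sqrt s * bubble p s ?y + b"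
      unfolding bubbles_def b_def sum.remove[OF finI p] by (simp add: algebra_simps)
    then have ub: "sqrt s * bubbles I s ?y = 1 / sqrt (N\<^sup>2 + 1) + b"
      using own s(5) by simp
    have "s\<^sup>2 * u ?y = (sqrt s * bubbles I s ?y) ^ 4"
    proof -
      have "sqrt s ^ 4 = s\<^sup>2" using s(5) by (simp add: eval_nat_numeral)
      then show ?thesis by (simp add: u_def power_mult_distrib)
    qed
    then have Gx: "G x = (1 / sqrt (N\<^sup>2 + 1) + b) ^ 4 *\<^sub>R ?P p"
      unfolding G_def pullback_conformal[OF y(2)] ub by simp
    have b0: "0 \<le> b"
      unfolding b_def using s(5)
      by (intro mult_nonneg_nonneg add_nonneg_nonneg sum_nonneg) (auto intro: less_imp_le[OF bubble_pos])
    have b1: "b \<le> \<delta> s"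
    proof -
      have "bubble 0 1 ?y \<le> 1"
        using frac_le[of 1 1 1 "sqrt ((norm ?y)\<^sup>2 + 1)"] by (simp add: bubble_eq)
      moreover have "(\<Sum>q\<in>I - {p}. sqrt s * bubble q s ?y) \<le> real (card I) * (sqrt s * (2 / d))"
      proof -
        have "sqrt s * bubble q s ?y \<le> sqrt s * (2 / d)" if q: "q \<in> I - {p}" for q
        proof (intro mult_left_mono)
          have "d \<le> dist p q" using d(2) p q by blast
          also have "\<dots> \<le> norm (?y - p) + norm (?y - q)"
            using dist_triangle[of p q ?y] by (simp add: dist_norm norm_minus_commute)
          also have "norm (?y - p) \<le> s * r p" using yp Nr s(5) by simp
          finally have dq: "d / 2 \<le> norm (?y - q)" using s(1)[OF p] by simp
          have "(norm (?y - q))\<^sup>2 \<le> (norm (?y - q))\<^sup>2 + s\<^sup>2" by simp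
          then have "norm (?y - q) \<le> sqrt ((norm (?y - q))\<^sup>2 + s\<^sup>2)"
            by (rule real_le_rsqrt)
          with dq have "d / 2 \<le> sqrt ((norm (?y - q))\<^sup>2 + s\<^sup>2)" by linarith
          then have "1 / sqrt ((norm (?y - q))\<^sup>2 + s\<^sup>2) \<le> 1 / (d / 2)"
            using d(1) by (intro frac_le) auto
          then show "bubble q s ?y \<le> 2 / d" using s(5) by (simp add: bubble_eq)
        qed (use s(5) in simp)
        then have "(\<Sum>q\<in>I - {p}. sqrt s * bubble q s ?y) \<le> real (card (I - {p})) * (sqrt s * (2 / d))"
          by (rule sum_bounded_above)
        also have "\<dots> \<le> real (card I) * (sqrt s * (2 / d))"
          using finI d(1) s(5) by (intro mult_right_mono of_nat_mono card_mono) auto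
        finally show ?thesis .
      qed
      ultimately show ?thesis
        unfolding b_def \<delta>_def using s(5) by (intro mult_left_mono add_mono) auto
    qed
    have "G x - ?P p = ((1 / sqrt (N\<^sup>2 + 1) + b) ^ 4 - 1) *\<^sub>R ?P p"
      by (simp only: Gx scaleR_left_diff_distrib scaleR_one)
    then have "norm (G x - ?P p) = \<bar>(1 / sqrt (N\<^sup>2 + 1) + b) ^ 4 - 1\<bar> * norm (?P p)"
      by (simp only: norm_scaleR)
    also have "\<dots> \<le> max (2 * (r p)\<^sup>2) ((1 + \<delta> s) ^ 4 - 1) * norm (?P p)"
      by (intro mult_right_mono power4_deviation b0 b1 N(1) Nr) simp
    also have "\<dots> < 2 * \<eta>"
      using props[OF p] s(2)[OF p] \<eta> by (auto simp: max_def)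
    finally have "norm (G x - ?P p) < 2 * \<eta>" .
    moreover have "norm (g x - ?P p) < \<eta>"
      using props[OF p] Nr N \<open>\<kappa> * r p < r p\<close> by (auto simp: cell_def N_def)
    moreover have "norm (G x - g x) \<le> norm (G x - ?P p) + norm (g x - ?P p)"
      using norm_triangle_ineq4[of "G x - ?P p" "g x - ?P p"] by simp
    ultimately show ?thesis by linarith
  qed
  show ?thesis
  proof (rule that[of G "ball 0 1 - (\<Union>E\<in>F. cell \<kappa> E)"])
    show "riemannian_metric_on (ball 0 1) G" unfolding G_def by (rule mp(2))
    show "scalar_curvature G x \<ge> 1" for x
      using metric_pullback.scalar_curvature_pullback[OF mp(1) UNIV_I, of x] s(3)
      unfolding G_def u_def by simp
    show "ball 0 1 - (\<Union>E\<in>F. cell \<kappa> E) \<in> lmeasurable"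
      by (intro fmeasurable_Diff lmeasurable_ball) (auto intro!: borel_open open_UN open_cell)
    show "norm (G x - g x) < 3 * \<eta>" if x: "x \<in> ball 0 1 - (ball 0 1 - (\<Union>E\<in>F. cell \<kappa> E))" for x
    proof -
      obtain E where E: "E \<in> F" "x \<in> cell \<kappa> E" using x by blast
      obtain p M R where "E = (p, M, R)" by (cases E)
      then show ?thesis using close[of p x] FI[of p M R] E by simp
    qed
  qed (rule F(6))
qed

theorem theorem3:
  fixes g :: "real^3 \<Rightarrow> real^3^3"
  assumes "riemannian_metric_on (ball 0 1) g"
  shows "\<exists>G :: nat \<Rightarrow> real^3 \<Rightarrow> real^3^3.
           (\<forall>k. riemannian_metric_on (ball 0 1) (G k) \<and>
                (\<forall>x\<in>ball 0 1. scalar_curvature (G k) x \<ge> 1)) \<and>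
           converges_in_measure_on (ball 0 1) G g"
proof -
  define \<eta> where "\<eta> k = inverse (real (Suc k))" for k
  have \<eta>: "\<eta> k > 0" for k by (simp add: \<eta>_def)
  define good where "good k G N \<longleftrightarrow> riemannian_metric_on (ball 0 1) G \<and> (\<forall>x. scalar_curvature G x \<ge> 1) \<and>
      N \<in> lmeasurable \<and> measure lebesgue N < \<eta> k \<and> (\<forall>x\<in>ball 0 1 - N. norm (G x - g x) < 3 * \<eta> k)" for k G N
  have "\<exists>G N. good k G N" for k
    unfolding good_def by (rule approximate_metric[OF assms \<eta>[of k]]) blast
  then obtain G N where "\<And>k. good k (G k) (N k)" by metis
  then have GN: "\<And>k. riemannian_metric_on (ball 0 1) (G k)" "\<And>k x. scalar_curvature (G k) x \<ge> 1"
      "\<And>k. N k \<in> lmeasurable" "\<And>k. measure lebesgue (N k) < \<eta> k"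
      "\<And>k x. x \<in> ball 0 1 - N k \<Longrightarrow> norm (G k x - g x) < 3 * \<eta> k"
    unfolding good_def by blast+
  have lim: "\<eta> \<longlonglongrightarrow> 0" unfolding \<eta>_def by (rule LIMSEQ_inverse_real_of_nat)
  have "(\<lambda>k. measure lebesgue {x\<in>ball 0 1. \<epsilon> \<le> norm (G k x - g x)}) \<longlonglongrightarrow> 0" if "\<epsilon> > 0" for \<epsilon>
  proof (rule tendsto_sandwich[OF _ _ tendsto_const lim])
    have "eventually (\<lambda>k. \<eta> k < \<epsilon> / 3) sequentially"
      using lim that by (intro order_tendstoD) auto
    then show "eventually (\<lambda>k. measure lebesgue {x\<in>ball 0 1. \<epsilon> \<le> norm (G k x - g x)} \<le> \<eta> k) sequentially"
    proof eventually_elim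
      case (elim k)
      let ?S = "{x\<in>ball 0 1. \<epsilon> \<le> norm (G k x - g x)}"
      have "?S \<subseteq> N k" using GN(5)[of _ k] elim by force
      show ?case
      proof (cases "?S \<in> sets lebesgue")
        case True
        have "measure lebesgue ?S \<le> measure lebesgue (N k)"
          by (rule measure_mono_fmeasurable[OF \<open>?S \<subseteq> N k\<close> True GN(3)])
        then show ?thesis using GN(4)[of k] by linarith
      next
        \<comment> \<open>Both metrics being continuous on the ball, this case does not occur; the
          default value 0 of \<open>measure\<close> settles it without an argument for
          measurability.\<close>
        case False
        show ?thesis unfolding measure_notin_sets[OF False] by (rule less_imp_le[OF \<eta>])
      qed
    qed
  qed simp
  then show ?thesis
    using GN(1,2) unfolding converges_in_measure_on_def by blast
qed

end
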